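(* Let $(M,g)$ be a connected oriented three-dimensional Riemannian manifold with an algebraically general Ricci tensor $R$ that admits a $G_3$ acting transitively as maximal group of isometries. Let $\eta$ be the volume form, $r=\mathrm{tr}\,R$, $S=R-\frac13 r\,g$, $s=\mathrm{tr}\,S^2$, $t=\mathrm{tr}\,S^3$, $e=s^3-6t^2$ (which is nonzero), $K_i{}^j=(\nabla S\cdot S)_{ikl}\,\eta^{lkj}$, and $$Z=\frac1e\,K\cdot\Big[3s\,S^2+6t\,S+\frac12s^2\,g\Big],\qquad N_{ij}=Z_{(ij)}-(\mathrm{tr}\,Z)g_{ij},\qquad a_i=-\frac12\eta_{ijk}Z^{jk},$$ $$\nu=\mathrm{tr}\,N,\qquad \nu_2=\frac12\big(\nu^2-\mathrm{tr}\,N^2\big),\qquad \nu_3=\frac13\mathrm{tr}\,N^3-\frac12\,\nu\,\mathrm{tr}\,N^2+\frac16\nu^3 .$$ Then: (i) the group is of Bianchi-Behr type IV if and only if $\nu\neq0$ and $\nu_2=\nu_3=0$; (ii) the group is of Bianchi-Behr type VI$_0$ (respectively, type VI$_h$, $h\neq-1$) if and only if $\nu_2<0$, $\nu_3=0$ and $a=0$ (respectively, $a\neq0$); (iii) the group is of Bianchi-Behr type VII$_0$ (respectively, type VII$_h$) if and only if $\nu_2>0$, $\nu_3=0$ and $a=0$ (respectively, $a\neq0$); (iv) the group is of Bianchi-Behr type IX if and only if $\nu_2>0$ and $\nu\,\nu_3>0$; (v) the group is of Bianchi-Behr type VIII if and only if either $\nu_2\leqslant0$ or $\nu\,\nu_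3\leqslant0$.
   Context: All considerations are local: "group of isometries $G_k$" refers to a $k$-dimensional Lie algebra of Killing vector fields defined near each point. It acts transitively if these fields span the tangent space at each point. It is maximal if, near each point, it is the Lie algebra of all local Killing fields. A symmetric 2-tensor is algebraically general if its three eigenvalues are distinct. Notation: $(A\cdot B)_{ij}=A_i{}^kB_{kj}$, $A^2=A\cdot A$, $A^3=A^2\cdot A$; indices are raised and lowered with $g$; $(\nabla S\cdot S)_{klm}=(\nabla_kS_l{}^{n})S_{nm}$; parentheses around indices denote symmetrization with factor $\tfrac12$. Bianchi-Behr types: a three-dimensional Lie algebra (here, of Killing fields) is of the indicated type if it has a basis $\xi_1,\xi_2,\xi_3$ with the following brackets. IV: $[\xi_1,\xi_2]=0$, $[\xi_2,\xi_3]=\xi_1+\xi_2$, $[\xi_3,\xi_1]=-\xi_1$. VI: $[\xi_1,\xi_2]=0$, $[\xi_2,\xi_3]=q\,\xi_2$, $[\xi_3,\xi_1]=-\xi_1$, $q\neq1$; it is type VI$_0$ if $q=-1$ and type VI$_h$ if $q\neq-1$, with $h=-(q+1)^2/(q-1)^2$; the case $h=-1$ ($q=0$) is type III. VII: $[\xi_1,\xi_2]=0$, $[\xi_2,\xi_3]=-\xi_1+q\xi_2$, $[\xi_3,\xi_1]=-\xi_2$, $q^2<4$; it is type VII$_0$ if $q=0$ and type VII$_h$ if $q\neq0$, with $h=q^2/(4-q^2)$. VIII: $[\xi_1,\xi_2]=\xi_1$, $[\xi_2,\xi_3]=\xi_3$, $[\xi_3,\xi_1]=-2\xi_2$. IX: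 $[\xi_1,\xi_2]=\xi_3$, $[\xi_2,\xi_3]=\xi_1$, $[\xi_3,\xi_1]=\xi_2$.
   Formalization: Part (v) is proved as: type VIII if and only if ν₃≠0 and (ν₂≤0 or νν₃≤0); without ν₃≠0 it fails, since types IV, VI and VII have ν₃=0, hence νν₃≤0, but are not of type VIII. *)

theory Defs
  imports "HOL-Analysis.Analysis"
begin

fun Ck_on :: "nat \<Rightarrow> (real^3) set \<Rightarrow> (real^3 \<Rightarrow> real) \<Rightarrow> bool" where
  "Ck_on 0 U f \<longleftrightarrow> continuous_on U f"
| "Ck_on (Suc k) U f \<longleftrightarrow> f differentiable_on U \<and>
     (\<forall>i. Ck_on k U (\<lambda>x. frechet_derivative f (at x) (axis i 1)))"

definition smooth_on :: "(real^3) set \<Rightarrow> (real^3 \<Rightarrow> real) \<Rightarrow> bool" where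
  "smooth_on U f \<longleftrightarrow> (\<forall>k. Ck_on k U f)"

text \<open>
  The underlying set of the manifold is the whole type \<open>'a\<close>. A chart is a pair of its domain and
  its coordinate map; only the values of the coordinate map on the domain matter.
\<close>

type_synonym 'a chart = "'a set \<times> ('a \<Rightarrow> real^3)"

definition cdom :: "'a chart \<Rightarrow> 'a set" where
  "cdom c = fst c"

definition coord :: "'a chart \<Rightarrow> 'a \<Rightarrow> real^3" where
  "coord c = snd c"

definition cinv :: "'a chart \<Rightarrow> real^3 \<Rightarrow> 'a" where
  "cinv c = inv_into (cdom c) (coord c)"

definition is_chart :: "'a::topological_space chart \<Rightarrow> bool" where
  "is_chart c \<longleftrightarrow> open (cdom c) \<and> open (coord c ` cdom c) \<and>
     homeomorphism (cdom c) (coord c ` cdom c) (coord c) (cinv c)"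

definition transition_jacobian :: "'a chart \<Rightarrow> 'a chart \<Rightarrow> 'a \<Rightarrow> real^3^3" where
  "transition_jacobian c d p = jacobian (coord d \<circ> cinv c) (at (coord c p))"

definition oriented_atlas :: "'a::topological_space chart set \<Rightarrow> bool" where
  "oriented_atlas \<A> \<longleftrightarrow>
     (\<forall>c\<in>\<A>. is_chart c) \<and> (\<Union>c\<in>\<A>. cdom c) = UNIV \<and>
     (\<forall>c\<in>\<A>. \<forall>d\<in>\<A>.
        (\<forall>i. smooth_on (coord c ` (cdom c \<inter> cdom d)) (\<lambda>x. coord d (cinv c x) $ i)) \<and>
        (\<forall>p\<in>cdom c \<inter> cdom d. det (transition_jacobian c d p) > 0))"

text \<open>
  A tensor field is given by its components: \<open>T c p\<close> is the array of components at the point \<open>p\<close>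
  with respect to the coordinate basis of the chart \<open>c\<close>. Only charts of the atlas and points of
  their domains matter.
\<close>

type_synonym 'a vfield = "'a chart \<Rightarrow> 'a \<Rightarrow> real^3"
type_synonym 'a tensor2 = "'a chart \<Rightarrow> 'a \<Rightarrow> real^3^3"

definition smooth_in_chart :: "'a chart \<Rightarrow> 'a set \<Rightarrow> ('a \<Rightarrow> real) \<Rightarrow> bool" where
  "smooth_in_chart c U f \<longleftrightarrow> smooth_on (coord c ` (cdom c \<inter> U)) (f \<circ> cinv c)"

definition partial :: "'a chart \<Rightarrow> 3 \<Rightarrow> ('a \<Rightarrow> real) \<Rightarrow> 'a \<Rightarrow> real" where
  "partial c i f p = frechet_derivative (f \<circ> cinv c) (at (coord c p)) (axis i 1)"

definition riemannian_metric :: "'a chart set \<Rightarrow> 'a tensor2 \<Rightarrow> bool" where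
  "riemannian_metric \<A> g \<longleftrightarrow>
     (\<forall>c\<in>\<A>. \<forall>i j. smooth_in_chart c UNIV (\<lambda>p. g c p $ i $ j)) \<and>
     (\<forall>c\<in>\<A>. \<forall>p\<in>cdom c. transpose (g c p) = g c p \<and> (\<forall>v. v \<noteq> 0 \<longrightarrow> v \<bullet> (g c p *v v) > 0)) \<and>
     (\<forall>c\<in>\<A>. \<forall>d\<in>\<A>. \<forall>p\<in>cdom c \<inter> cdom d.
        g c p = transpose (transition_jacobian c d p) ** g d p ** transition_jacobian c d p)"

definition vector_field :: "'a chart set \<Rightarrow> 'a set \<Rightarrow> 'a vfield \<Rightarrow> bool" where
  "vector_field \<A> U X \<longleftrightarrow>
     (\<forall>c\<in>\<A>. \<forall>i. smooth_in_chart c U (\<lambda>p. X c p $ i)) \<and>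
     (\<forall>c\<in>\<A>. \<forall>d\<in>\<A>. \<forall>p\<in>cdom c \<inter> cdom d \<inter> U. X d p = transition_jacobian c d p *v X c p)"

definition vf_eq :: "'a chart set \<Rightarrow> 'a set \<Rightarrow> 'a vfield \<Rightarrow> 'a vfield \<Rightarrow> bool" where
  "vf_eq \<A> U X Y \<longleftrightarrow> (\<forall>c\<in>\<A>. \<forall>p\<in>cdom c \<inter> U. X c p = Y c p)"

definition lie_bracket :: "'a vfield \<Rightarrow> 'a vfield \<Rightarrow> 'a vfield" where
  "lie_bracket X Y = (\<lambda>c p. \<chi> k. \<Sum>i\<in>UNIV.
     X c p $ i * partial c i (\<lambda>q. Y c q $ k) p - Y c p $ i * partial c i (\<lambda>q. X c q $ k) p)"

definition lin_comb :: "real^3 \<Rightarrow> (3 \<Rightarrow> 'a vfield) \<Rightarrow> 'a vfield" where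
  "lin_comb a \<xi> = (\<lambda>c p. \<Sum>i\<in>UNIV. (a $ i) *\<^sub>R \<xi> i c p)"

text \<open>The Lie derivative of \<open>g\<close> along \<open>X\<close> vanishes on \<open>U\<close>.\<close>

definition killing_field :: "'a chart set \<Rightarrow> 'a tensor2 \<Rightarrow> 'a set \<Rightarrow> 'a vfield \<Rightarrow> bool" where
  "killing_field \<A> g U X \<longleftrightarrow> vector_field \<A> U X \<and>
     (\<forall>c\<in>\<A>. \<forall>p\<in>cdom c \<inter> U. \<forall>i j. (\<Sum>k\<in>UNIV.
        X c p $ k * partial c k (\<lambda>q. g c q $ i $ j) p
        + g c p $ k $ j * partial c i (\<lambda>q. X c q $ k) p
        + g c p $ i $ k * partial c j (\<lambda>q. X c q $ k) p) = 0)"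

text \<open>\<open>\<xi> 1, \<xi> 2, \<xi> 3\<close> is a basis of a three-dimensional Lie algebra of Killing fields on \<open>U\<close>.\<close>

definition G3_basis ::
  "'a chart set \<Rightarrow> 'a tensor2 \<Rightarrow> 'a set \<Rightarrow> (3 \<Rightarrow> 'a vfield) \<Rightarrow> bool" where
  "G3_basis \<A> g U \<xi> \<longleftrightarrow>
     (\<forall>i. killing_field \<A> g U (\<xi> i)) \<and>
     (\<forall>a. vf_eq \<A> U (lin_comb a \<xi>) (\<lambda>_ _. 0) \<longrightarrow> a = 0) \<and>
     (\<forall>i j. \<exists>a. vf_eq \<A> U (lie_bracket (\<xi> i) (\<xi> j)) (lin_comb a \<xi>))"

definition transitive_on :: "'a chart set \<Rightarrow> 'a set \<Rightarrow> (3 \<Rightarrow> 'a vfield) \<Rightarrow> bool" where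
  "transitive_on \<A> U \<xi> \<longleftrightarrow> (\<forall>c\<in>\<A>. \<forall>p\<in>cdom c \<inter> U. span (range (\<lambda>i. \<xi> i c p)) = UNIV)"

text \<open>Every germ of a Killing field at a point of \<open>U\<close> belongs to the span of \<open>\<xi>\<close>.\<close>

definition maximal_on ::
  "'a::topological_space chart set \<Rightarrow> 'a tensor2 \<Rightarrow> 'a set \<Rightarrow> (3 \<Rightarrow> 'a vfield) \<Rightarrow> bool" where
  "maximal_on \<A> g U \<xi> \<longleftrightarrow>
     (\<forall>p\<in>U. \<forall>V X. open V \<and> p \<in> V \<and> killing_field \<A> g V X \<longrightarrow>
        (\<exists>W a. open W \<and> p \<in> W \<and> W \<subseteq> U \<inter> V \<and> vf_eq \<A> W X (lin_comb a \<xi>)))"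

definition maximal_transitive_G3_basis ::
  "'a::topological_space chart set \<Rightarrow> 'a tensor2 \<Rightarrow> 'a set \<Rightarrow> (3 \<Rightarrow> 'a vfield) \<Rightarrow> bool" where
  "maximal_transitive_G3_basis \<A> g U \<xi> \<longleftrightarrow>
     G3_basis \<A> g U \<xi> \<and> transitive_on \<A> U \<xi> \<and> maximal_on \<A> g U \<xi>"

definition admits_maximal_transitive_G3 ::
  "'a::topological_space chart set \<Rightarrow> 'a tensor2 \<Rightarrow> bool" where
  "admits_maximal_transitive_G3 \<A> g \<longleftrightarrow>
     (\<forall>p. \<exists>U \<xi>. open U \<and> p \<in> U \<and> maximal_transitive_G3_basis \<A> g U \<xi>)"

text \<open>
  Near each point, the Lie algebra of the local Killing fields has a basis with the brackets
  \<open>[\<xi> 1, \<xi> 2]\<close>, \<open>[\<xi> 2, \<xi> 3]\<close>, \<open>[\<xi> 3, \<xi> 1]\<close> having components \<open>u\<close>, \<open>v\<close>, \<open>w\<close>, respectively.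
\<close>

definition group_brackets ::
  "'a::topological_space chart set \<Rightarrow> 'a tensor2 \<Rightarrow> real^3 \<Rightarrow> real^3 \<Rightarrow> real^3 \<Rightarrow> bool" where
  "group_brackets \<A> g u v w \<longleftrightarrow>
     (\<forall>p. \<exists>U \<xi>. open U \<and> p \<in> U \<and> maximal_transitive_G3_basis \<A> g U \<xi> \<and>
        vf_eq \<A> U (lie_bracket (\<xi> 1) (\<xi> 2)) (lin_comb u \<xi>) \<and>
        vf_eq \<A> U (lie_bracket (\<xi> 2) (\<xi> 3)) (lin_comb v \<xi>) \<and>
        vf_eq \<A> U (lie_bracket (\<xi> 3) (\<xi> 1)) (lin_comb w \<xi>))"

definition type_IV :: "'a::topological_space chart set \<Rightarrow> 'a tensor2 \<Rightarrow> bool" where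
  "type_IV \<A> g \<longleftrightarrow>
     group_brackets \<A> g (vector [0, 0, 0]) (vector [1, 1, 0]) (vector [-1, 0, 0])"

definition type_VI :: "'a::topological_space chart set \<Rightarrow> 'a tensor2 \<Rightarrow> real \<Rightarrow> bool" where
  "type_VI \<A> g q \<longleftrightarrow> q \<noteq> 1 \<and>
     group_brackets \<A> g (vector [0, 0, 0]) (vector [0, q, 0]) (vector [-1, 0, 0])"

definition type_VI0 :: "'a::topological_space chart set \<Rightarrow> 'a tensor2 \<Rightarrow> bool" where
  "type_VI0 \<A> g \<longleftrightarrow> type_VI \<A> g (-1)"

definition type_VIh :: "'a::topological_space chart set \<Rightarrow> 'a tensor2 \<Rightarrow> real \<Rightarrow> bool" where
  "type_VIh \<A> g h \<longleftrightarrow>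
     (\<exists>q. q \<noteq> -1 \<and> h = - ((q + 1)\<^sup>2 / (q - 1)\<^sup>2) \<and> type_VI \<A> g q)"

definition type_VII :: "'a::topological_space chart set \<Rightarrow> 'a tensor2 \<Rightarrow> real \<Rightarrow> bool" where
  "type_VII \<A> g q \<longleftrightarrow> q\<^sup>2 < 4 \<and>
     group_brackets \<A> g (vector [0, 0, 0]) (vector [-1, q, 0]) (vector [0, -1, 0])"

definition type_VII0 :: "'a::topological_space chart set \<Rightarrow> 'a tensor2 \<Rightarrow> bool" where
  "type_VII0 \<A> g \<longleftrightarrow> type_VII \<A> g 0"

definition type_VIIh :: "'a::topological_space chart set \<Rightarrow> 'a tensor2 \<Rightarrow> real \<Rightarrow> bool" where
  "type_VIIh \<A> g h \<longleftrightarrow> (\<exists>q. q \<noteq> 0 \<and> h = q\<^sup>2 / (4 - q\<^sup>2) \<and> type_VII \<A> g q)"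

definition type_VIII :: "'a::topological_space chart set \<Rightarrow> 'a tensor2 \<Rightarrow> bool" where
  "type_VIII \<A> g \<longleftrightarrow>
     group_brackets \<A> g (vector [1, 0, 0]) (vector [0, 0, 1]) (vector [0, -2, 0])"

definition type_IX :: "'a::topological_space chart set \<Rightarrow> 'a tensor2 \<Rightarrow> bool" where
  "type_IX \<A> g \<longleftrightarrow>
     group_brackets \<A> g (vector [0, 0, 1]) (vector [1, 0, 0]) (vector [0, 1, 0])"

definition christoffel :: "'a tensor2 \<Rightarrow> 'a chart \<Rightarrow> 3 \<Rightarrow> 3 \<Rightarrow> 3 \<Rightarrow> 'a \<Rightarrow> real" where
  "christoffel g c k i j p = (\<Sum>l\<in>UNIV. 1/2 * matrix_inv (g c p) $ k $ l *
     (partial c i (\<lambda>q. g c q $ j $ l) p + partial c j (\<lambda>q. g c q $ i $ l) p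
      - partial c l (\<lambda>q. g c q $ i $ j) p))"

definition ricci :: "'a tensor2 \<Rightarrow> 'a tensor2" where
  "ricci g = (\<lambda>c p. \<chi> i j. \<Sum>k\<in>UNIV.
     partial c k (christoffel g c k i j) p - partial c j (christoffel g c k i k) p
     + (\<Sum>l\<in>UNIV. christoffel g c k k l p * christoffel g c l i j p
                  - christoffel g c k j l p * christoffel g c l i k p))"

text \<open>The component \<open>\<nabla>\<^sub>k T\<^sub>i\<^sub>j\<close>; the differentiation index comes first.\<close>

definition cov_deriv :: "'a tensor2 \<Rightarrow> 'a tensor2 \<Rightarrow> 'a chart \<Rightarrow> 'a \<Rightarrow> 3 \<Rightarrow> 3 \<Rightarrow> 3 \<Rightarrow> real" where
  "cov_deriv g T c p k i j = partial c k (\<lambda>q. T c q $ i $ j) p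
     - (\<Sum>l\<in>UNIV. christoffel g c l k i p * T c p $ l $ j + christoffel g c l k j p * T c p $ i $ l)"

text \<open>
  \<open>G\<close> is the matrix of the metric at a point; the other arguments are 2-tensors with both indices
  lowered.
\<close>

definition tdot :: "real^3^3 \<Rightarrow> real^3^3 \<Rightarrow> real^3^3 \<Rightarrow> real^3^3" where
  "tdot G A B = A ** matrix_inv G ** B"

definition ttr :: "real^3^3 \<Rightarrow> real^3^3 \<Rightarrow> real" where
  "ttr G A = trace (matrix_inv G ** A)"

definition tsquare :: "real^3^3 \<Rightarrow> real^3^3 \<Rightarrow> real^3^3" where
  "tsquare G A = tdot G A A"

definition tcube :: "real^3^3 \<Rightarrow> real^3^3 \<Rightarrow> real^3^3" where
  "tcube G A = tdot G (tsquare G A) A"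

definition levi_civita :: "3 \<Rightarrow> 3 \<Rightarrow> 3 \<Rightarrow> real" where
  "levi_civita i j k = det (vector [axis i 1, axis j 1, axis k 1] :: real^3^3)"

definition volume_form :: "real^3^3 \<Rightarrow> 3 \<Rightarrow> 3 \<Rightarrow> 3 \<Rightarrow> real" where
  "volume_form G i j k = sqrt (det G) * levi_civita i j k"

definition volume_form_raised :: "real^3^3 \<Rightarrow> 3 \<Rightarrow> 3 \<Rightarrow> 3 \<Rightarrow> real" where
  "volume_form_raised G i j k = (\<Sum>l\<in>UNIV. \<Sum>m\<in>UNIV. \<Sum>n\<in>UNIV.
     matrix_inv G $ i $ l * matrix_inv G $ j $ m * matrix_inv G $ k $ n * volume_form G l m n)"

definition algebraically_general :: "'a chart set \<Rightarrow> 'a tensor2 \<Rightarrow> 'a tensor2 \<Rightarrow> bool" where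
  "algebraically_general \<A> g T \<longleftrightarrow>
     (\<forall>c\<in>\<A>. \<forall>p\<in>cdom c. card {\<mu>. \<exists>v. v \<noteq> 0 \<and> T c p *v v = \<mu> *\<^sub>R (g c p *v v)} = 3)"

definition traceless_ricci :: "'a tensor2 \<Rightarrow> 'a tensor2" where
  "traceless_ricci g = (\<lambda>c p. ricci g c p - (1/3 * ttr (g c p) (ricci g c p)) *\<^sub>R g c p)"

definition inv_s :: "'a tensor2 \<Rightarrow> 'a chart \<Rightarrow> 'a \<Rightarrow> real" where
  "inv_s g c p = ttr (g c p) (tsquare (g c p) (traceless_ricci g c p))"

definition inv_t :: "'a tensor2 \<Rightarrow> 'a chart \<Rightarrow> 'a \<Rightarrow> real" where
  "inv_t g c p = ttr (g c p) (tcube (g c p) (traceless_ricci g c p))"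

definition inv_e :: "'a tensor2 \<Rightarrow> 'a chart \<Rightarrow> 'a \<Rightarrow> real" where
  "inv_e g c p = inv_s g c p ^ 3 - 6 * (inv_t g c p)\<^sup>2"

text \<open>\<open>nabla_S_dot_S g c p k l m\<close> is \<open>(\<nabla>\<^sub>k S\<^sub>l\<^sup>n) S\<^sub>n\<^sub>m\<close>.\<close>

definition nabla_S_dot_S :: "'a tensor2 \<Rightarrow> 'a chart \<Rightarrow> 'a \<Rightarrow> 3 \<Rightarrow> 3 \<Rightarrow> 3 \<Rightarrow> real" where
  "nabla_S_dot_S g c p k l m = (\<Sum>n\<in>UNIV. \<Sum>b\<in>UNIV.
     cov_deriv g (traceless_ricci g) c p k l b * matrix_inv (g c p) $ b $ n
     * traceless_ricci g c p $ n $ m)"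

text \<open>The mixed components \<open>K\<^sub>i\<^sup>j\<close>, with \<open>i\<close> as row index.\<close>

definition K_mixed :: "'a tensor2 \<Rightarrow> 'a chart \<Rightarrow> 'a \<Rightarrow> real^3^3" where
  "K_mixed g c p = (\<chi> i j. \<Sum>k\<in>UNIV. \<Sum>l\<in>UNIV.
     nabla_S_dot_S g c p i k l * volume_form_raised (g c p) l k j)"

definition Z_tensor :: "'a tensor2 \<Rightarrow> 'a tensor2" where
  "Z_tensor g = (\<lambda>c p. (1 / inv_e g c p) *\<^sub>R (K_mixed g c p **
     ((3 * inv_s g c p) *\<^sub>R tsquare (g c p) (traceless_ricci g c p)
      + (6 * inv_t g c p) *\<^sub>R traceless_ricci g c p
      + (1/2 * (inv_s g c p)\<^sup>2) *\<^sub>R g c p)))"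

definition N_tensor :: "'a tensor2 \<Rightarrow> 'a tensor2" where
  "N_tensor g = (\<lambda>c p. (1/2) *\<^sub>R (Z_tensor g c p + transpose (Z_tensor g c p))
     - ttr (g c p) (Z_tensor g c p) *\<^sub>R g c p)"

definition a_form :: "'a tensor2 \<Rightarrow> 'a chart \<Rightarrow> 'a \<Rightarrow> real^3" where
  "a_form g c p = (\<chi> i. - 1/2 * (\<Sum>j\<in>UNIV. \<Sum>k\<in>UNIV. volume_form (g c p) i j k *
     (\<Sum>l\<in>UNIV. \<Sum>m\<in>UNIV. matrix_inv (g c p) $ j $ l * matrix_inv (g c p) $ k $ m
       * Z_tensor g c p $ l $ m)))"

definition nu1 :: "'a tensor2 \<Rightarrow> 'a chart \<Rightarrow> 'a \<Rightarrow> real" where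
  "nu1 g c p = ttr (g c p) (N_tensor g c p)"

definition nu2 :: "'a tensor2 \<Rightarrow> 'a chart \<Rightarrow> 'a \<Rightarrow> real" where
  "nu2 g c p = 1/2 * ((nu1 g c p)\<^sup>2 - ttr (g c p) (tsquare (g c p) (N_tensor g c p)))"

definition nu3 :: "'a tensor2 \<Rightarrow> 'a chart \<Rightarrow> 'a \<Rightarrow> real" where
  "nu3 g c p = 1/3 * ttr (g c p) (tcube (g c p) (N_tensor g c p))
     - 1/2 * nu1 g c p * ttr (g c p) (tsquare (g c p) (N_tensor g c p))
     + 1/6 * nu1 g c p ^ 3"

end

theory Submission
  imports Defs
begin

text \<open>
  Near a point take a basis \<open>\<xi>\<close> of the Killing fields that is orthonormal at the point. The Killing
  equation expresses the derivatives along \<open>\<xi>\<close> of the inner products, hence of the connection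
  coefficients and of the Ricci tensor, by the structure constants; so the curvature and \<open>\<nabla>S\<close> at
  the point are polynomials in them. In particular \<open>\<nabla>S\<close> is the commutator of \<open>S\<close> with the connection
  matrices, and \<open>Z\<close> is built so as to recover these from \<open>\<nabla>S\<close>. Consequently \<open>N\<close> and \<open>a\<close> are the
  symmetric and skew parts of the structure constants, written
  \<open>[\<xi> i, \<xi> j] = \<epsilon> i j l * m l k * \<xi> k\<close>.

  A change of basis by \<open>P\<close> turns \<open>m\<close> into \<open>m'\<close> with \<open>P m' P\<^sup>T = det P m\<close>, so the type of the algebra is
  read off the signs of the invariants of \<open>N\<close> and the vanishing of \<open>a\<close>. The algebras absent from the
  list, types I, II, V and III (type VI with \<open>q = 0\<close>), have a repeated Ricci eigenvalue. Since the brackets of \<open>\<xi>\<close> are constant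
  and germs of Killing fields extend linearly, connectedness makes the type the same everywhere.
\<close>

section \<open>Partial derivatives of smooth functions\<close>

text \<open>The usual treatment works in a frame of fields invariant under the group, where the
  metric has constant components. Here the Killing fields themselves serve as the frame: they are
  the data at hand, and no flow has to be integrated. The price is that their inner products vary,
  and a constant change of basis can make them orthonormal at one point only. Every derivative is
  therefore computed nearby for a general Gram matrix, and only the final expressions are
  specialised to the point.

  The invariants are numbers at a point, whereas the type is a property of germs of Killing fields;
  a constant linear relation between two bases links the two. The condition
  \<open>nu3 \<noteq> 0\<close> in the criterion for type VIII separates it from the solvable types:
  those have \<open>nu3 = 0\<close>, and then \<open>nu1 * nu3 \<le> 0\<close> holds for all of
  them.\<close>

definition pd :: "3 \<Rightarrow> (real^3 \<Rightarrow> real) \<Rightarrow> real^3 \<Rightarrow> real" where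
  "pd i f x = frechet_derivative f (at x) (axis i 1)"

lemma pd_unique: "(f has_derivative f') (at x) \<Longrightarrow> pd i f x = f' (axis i 1)"
  unfolding pd_def using frechet_derivative_at by metis

text \<open>The two functions have the same derivatives at \<open>x\<close>, so the choice behind
  \<open>frechet_derivative\<close> returns the same value for both, even at points where neither is
  differentiable.\<close>

lemma pd_cong:
  assumes "open V" "x \<in> V" "\<And>y. y \<in> V \<Longrightarrow> f y = g y"
  shows "pd i f x = pd i g x"
proof -
  have "(f has_derivative D) (at x) \<longleftrightarrow> (g has_derivative D) (at x)" for D
    using has_derivative_transform_within_open[OF _ assms(1,2), of f D UNIV g]
      has_derivative_transform_within_open[OF _ assms(1,2), of g D UNIV f] assms(3)
    by auto
  then show ?thesis unfolding pd_def frechet_derivative_def by simp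
qed

lemma Ck_on_cong:
  assumes "open V"
  shows "(\<And>x. x \<in> V \<Longrightarrow> f x = g x) \<Longrightarrow> Ck_on k V f \<longleftrightarrow> Ck_on k V g"
proof (induction k arbitrary: f g)
  case 0
  then show ?case by (auto intro: continuous_on_cong)
next
  case (Suc k)
  have *: "pd i f x = pd i g x" if "x \<in> V" for i x
    using pd_cong[OF assms that Suc.prems] by auto
  have "Ck_on k V (pd i f) \<longleftrightarrow> Ck_on k V (pd i g)" for i
    using * by (intro Suc.IH) auto
  moreover have "f differentiable_on V \<longleftrightarrow> g differentiable_on V"
    unfolding differentiable_on_def
    using Suc.prems by (metis differentiable_transform_within zero_less_one)
  ultimately show ?case by (simp add: pd_def[abs_def])
qed

lemma Ck_on_Suc: "Ck_on (Suc k) V f \<longleftrightarrow> f differentiable_on V \<and> (\<forall>i. Ck_on k V (pd i f))"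
  by (simp add: pd_def[abs_def])

lemma Ck_on_SucD: "Ck_on (Suc k) V f \<Longrightarrow> Ck_on k V f"
proof (induction k arbitrary: f)
  case 0
  then show ?case by (auto intro: differentiable_imp_continuous_on)
next
  case (Suc k)
  then show ?case by (subst Ck_on_Suc) (use Ck_on_Suc in blast)
qed

lemma pd_const [simp]: "pd i (\<lambda>x. c) x = 0"
  by (simp add: pd_def)

lemma differentiable_derivative:
  "open V \<Longrightarrow> x \<in> V \<Longrightarrow> f differentiable_on V \<Longrightarrow> (f has_derivative frechet_derivative f (at x)) (at x)"
  by (metis differentiable_on_eq_differentiable_at frechet_derivative_works)

section \<open>Calculus of \<open>pd\<close> on an open set and symmetry of second
  derivatives\<close>

context
  fixes V :: "(real^3) set"
  assumes V: "open V"
begin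

lemma pd_add':
  assumes "x \<in> V" "f differentiable_on V" "g differentiable_on V"
  shows "pd i (\<lambda>y. f y + g y) x = pd i f x + pd i g x"
proof -
  note [derivative_intros] = assms(2,3)[THEN differentiable_derivative[OF V assms(1)]]
  have "((\<lambda>y. f y + g y) has_derivative (\<lambda>h. frechet_derivative f (at x) h + frechet_derivative g (at x) h)) (at x)"
    by (auto intro!: derivative_eq_intros)
  from pd_unique[OF this] show ?thesis by (simp add: pd_def)
qed

lemma pd_mult':
  assumes "x \<in> V" "f differentiable_on V" "g differentiable_on V"
  shows "pd i (\<lambda>y. f y * g y) x = pd i f x * g x + f x * pd i g x"
proof -
  note [derivative_intros] = assms(2,3)[THEN differentiable_derivative[OF V assms(1)]]
  have "((\<lambda>y. f y * g y) has_derivative (\<lambda>h. f x * frechet_derivative g (at x) h + frechet_derivative f (at x) h * g x)) (at x)"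
    by (auto intro!: derivative_eq_intros)
  from pd_unique[OF this] show ?thesis by (simp add: pd_def)
qed

lemma pd_inverse':
  assumes "x \<in> V" "f differentiable_on V" "f x \<noteq> 0"
  shows "pd i (\<lambda>y. inverse (f y)) x = - (inverse (f x) * pd i f x * inverse (f x))"
proof -
  note [derivative_intros] = assms(2)[THEN differentiable_derivative[OF V assms(1)]]
  have "((\<lambda>y. inverse (f y)) has_derivative (\<lambda>h. - (inverse (f x) * frechet_derivative f (at x) h * inverse (f x)))) (at x)"
    using assms by (auto intro!: derivative_eq_intros)
  from pd_unique[OF this] show ?thesis by (simp add: pd_def)
qed

lemma Ck_on_const: "Ck_on k V (\<lambda>x. c)"
proof (induction k arbitrary: c)
  case (Suc k)
  then show ?case by simp
qed simp

lemma Ck_on_add: "Ck_on k V f \<Longrightarrow> Ck_on k V g \<Longrightarrow> Ck_on k V (\<lambda>x. f x + g x)"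
proof (induction k arbitrary: f g)
  case 0
  then show ?case by (auto intro: continuous_intros)
next
  case (Suc k)
  have "Ck_on k V (pd i (\<lambda>y. f y + g y)) \<longleftrightarrow> Ck_on k V (\<lambda>x. pd i f x + pd i g x)" for i
    using Suc.prems by (intro Ck_on_cong V pd_add') (auto simp: Ck_on_Suc)
  then show ?case using Suc by (auto simp: Ck_on_Suc simp del: Ck_on.simps)
qed

lemma Ck_on_mult: "Ck_on k V f \<Longrightarrow> Ck_on k V g \<Longrightarrow> Ck_on k V (\<lambda>x. f x * g x)"
proof (induction k arbitrary: f g)
  case 0
  then show ?case by (auto intro: continuous_intros)
next
  case (Suc k)
  have "Ck_on k V (pd i (\<lambda>y. f y * g y)) \<longleftrightarrow> Ck_on k V (\<lambda>x. pd i f x * g x + f x * pd i g x)" for i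
    using Suc.prems by (intro Ck_on_cong V pd_mult') (auto simp: Ck_on_Suc)
  moreover have "Ck_on k V f" "Ck_on k V g" using Suc.prems Ck_on_SucD by blast+
  ultimately show ?case using Suc 
    by (auto simp: Ck_on_Suc simp del: Ck_on.simps intro!: Ck_on_add)
qed

text \<open>The derivative of \<open>1/f\<close> contains \<open>1/f\<close> undifferentiated, so
  order \<open>k\<close> of \<open>1/f\<close> itself is enough to reach order
  \<open>k + 1\<close>.\<close>

lemma Ck_on_inverse: "Ck_on k V f \<Longrightarrow> (\<And>x. x \<in> V \<Longrightarrow> f x \<noteq> 0) \<Longrightarrow> Ck_on k V (\<lambda>x. inverse (f x))"
proof (induction k arbitrary: f)
  case 0
  then show ?case by (auto intro: continuous_intros)
next
  case (Suc k)
  have "Ck_on k V (pd i (\<lambda>y. inverse (f y))) \<longleftrightarrow>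
      Ck_on k V (\<lambda>x. - 1 * (inverse (f x) * pd i f x * inverse (f x)))" for i
    using Suc.prems pd_inverse' by (intro Ck_on_cong V) (auto simp: Ck_on_Suc)
  moreover have "Ck_on k V (\<lambda>x. - 1 * (inverse (f x) * pd i f x * inverse (f x)))" for i
    using Suc.prems Ck_on_SucD[OF Suc.prems(1)]
    by (intro Ck_on_mult Ck_on_const Suc.IH) (auto simp: Ck_on_Suc simp del: Ck_on.simps)
  moreover have "(\<lambda>y. inverse (f y)) differentiable_on V"
    using Suc.prems by (auto simp: Ck_on_Suc differentiable_on_def intro!: differentiable_inverse simp del: Ck_on.simps)
  ultimately show ?case by (auto simp: Ck_on_Suc simp del: Ck_on.simps)
qed

lemma smooth_on_differentiable: "smooth_on V f \<Longrightarrow> f differentiable_on V"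
  unfolding smooth_on_def using Ck_on_Suc by blast

lemma smooth_on_const [simp]: "smooth_on V (\<lambda>x. c)"
  unfolding smooth_on_def using Ck_on_const by auto

lemma smooth_on_pd: "smooth_on V f \<Longrightarrow> smooth_on V (\<lambda>x. pd i f x)"
  unfolding smooth_on_def using Ck_on_Suc by blast

lemma smooth_on_add: "smooth_on V f \<Longrightarrow> smooth_on V g \<Longrightarrow> smooth_on V (\<lambda>x. f x + g x)"
  unfolding smooth_on_def using Ck_on_add by blast

lemma smooth_on_mult: "smooth_on V f \<Longrightarrow> smooth_on V g \<Longrightarrow> smooth_on V (\<lambda>x. f x * g x)"
  unfolding smooth_on_def using Ck_on_mult by blast

lemma smooth_on_minus: "smooth_on V f \<Longrightarrow> smooth_on V (\<lambda>x. - f x)"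
  using smooth_on_mult[of "\<lambda>x. -1" f] by simp

lemma smooth_on_diff: "smooth_on V f \<Longrightarrow> smooth_on V g \<Longrightarrow> smooth_on V (\<lambda>x. f x - g x)"
  using smooth_on_add[of f "\<lambda>x. - g x"] smooth_on_minus by simp

lemma smooth_on_inverse:
  "smooth_on V f \<Longrightarrow> (\<And>x. x \<in> V \<Longrightarrow> f x \<noteq> 0) \<Longrightarrow> smooth_on V (\<lambda>x. inverse (f x))"
  unfolding smooth_on_def using Ck_on_inverse by blast

lemma smooth_on_sum:
  "(\<And>i. i \<in> I \<Longrightarrow> smooth_on V (f i)) \<Longrightarrow> smooth_on V (\<lambda>x. \<Sum>i\<in>I. f i x)"
  by (induction I rule: infinite_finite_induct) (auto intro: smooth_on_add)

lemma smooth_on_cong: "(\<And>x. x \<in> V \<Longrightarrow> f x = g x) \<Longrightarrow> smooth_on V f \<longleftrightarrow> smooth_on V g"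
  unfolding smooth_on_def using Ck_on_cong[OF V] by blast

lemmas smooth_on_intros = smooth_on_const smooth_on_add smooth_on_mult smooth_on_minus
  smooth_on_diff smooth_on_sum smooth_on_pd

lemma pd_add: "x \<in> V \<Longrightarrow> smooth_on V f \<Longrightarrow> smooth_on V g \<Longrightarrow>
    pd i (\<lambda>y. f y + g y) x = pd i f x + pd i g x"
  using pd_add' smooth_on_differentiable by blast

lemma pd_mult: "x \<in> V \<Longrightarrow> smooth_on V f \<Longrightarrow> smooth_on V g \<Longrightarrow>
    pd i (\<lambda>y. f y * g y) x = pd i f x * g x + f x * pd i g x"
  using pd_mult' smooth_on_differentiable by blast

lemma pd_minus: "x \<in> V \<Longrightarrow> smooth_on V f \<Longrightarrow> pd i (\<lambda>y. - f y) x = - pd i f x"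
  using pd_mult[of x "\<lambda>x. -1" f i] by simp

lemma pd_diff: "x \<in> V \<Longrightarrow> smooth_on V f \<Longrightarrow> smooth_on V g \<Longrightarrow>
    pd i (\<lambda>y. f y - g y) x = pd i f x - pd i g x"
  using pd_add[of x f "\<lambda>x. - g x" i] smooth_on_minus pd_minus by simp

lemma pd_sum: "x \<in> V \<Longrightarrow> (\<And>j. j \<in> I \<Longrightarrow> smooth_on V (f j)) \<Longrightarrow>
    pd i (\<lambda>y. \<Sum>j\<in>I. f j y) x = (\<Sum>j\<in>I. pd i (f j) x)"
  by (induction I rule: infinite_finite_induct) (auto simp: pd_add smooth_on_sum)

text \<open>Both mixed second derivatives equal the limit of the second difference quotient over a small square.\<close>

lemma second_difference:
  assumes f: "smooth_on V f" and x: "x \<in> V" and "0 < e"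
  obtains t where "0 < t" "t < e"
    and "\<And>i j. \<exists>y\<in>V. dist y x < e \<and>
      f (x + t *\<^sub>R axis i 1 + t *\<^sub>R axis j 1) - f (x + t *\<^sub>R axis i 1) - f (x + t *\<^sub>R axis j 1) + f x
        = t\<^sup>2 * pd j (pd i f) y"
proof -
  obtain d where d: "d > 0" "ball x d \<subseteq> V" using V x openE by blast
  \<comment> \<open>All points used lie within \<open>2 * t\<close> of \<open>x\<close>, so a
    quarter of \<open>min d e\<close> keeps the whole square in \<open>V\<close> and within distance
    \<open>e\<close>.\<close>
  define t where "t = min d e / 4"
  have t: "0 < t" "t < e" "2 * t < d" "2 * t < e" using d assms by (auto simp: t_def)
  have near: "x + a *\<^sub>R axis i 1 + b *\<^sub>R axis j 1 \<in> V \<and> dist (x + a *\<^sub>R axis i 1 + b *\<^sub>R axis j 1) x < e"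
    if "0 \<le> a" "a \<le> t" "0 \<le> b" "b \<le> t" for a b :: real and i j :: 3
  proof -
    have "norm (a *\<^sub>R axis i 1 + b *\<^sub>R axis j 1 :: real^3) \<le> a + b"
      using that by (auto intro: norm_triangle_le)
    then have "dist (x + a *\<^sub>R axis i 1 + b *\<^sub>R axis j 1) x \<le> 2 * t"
      using that by (simp add: dist_norm add.assoc)
    then show ?thesis using d t by (auto simp: dist_commute subset_iff)
  qed
  have path: "((\<lambda>s. F (y + s *\<^sub>R axis i 1)) has_real_derivative pd i F (y + s *\<^sub>R axis i 1)) (at s)"
    if "smooth_on V F" "y + s *\<^sub>R axis i 1 \<in> V" for F y s i
  proof -
    let ?D = "frechet_derivative F (at (y + s *\<^sub>R axis i 1))"
    have D: "(F has_derivative ?D) (at (y + s *\<^sub>R axis i 1))"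
      using that V differentiable_derivative smooth_on_differentiable by blast
    have L: "((\<lambda>s. y + s *\<^sub>R axis i 1) has_derivative (\<lambda>h. h *\<^sub>R axis i 1)) (at s)"
      by (rule derivative_eq_intros refl | simp)+
    have "((\<lambda>s. F (y + s *\<^sub>R axis i 1)) has_derivative (\<lambda>h. ?D (h *\<^sub>R axis i 1))) (at s)"
      using has_derivative_compose[OF L D] .
    moreover have "?D (h *\<^sub>R axis i 1) = pd i F (y + s *\<^sub>R axis i 1) * h" for h
      using has_derivative_linear[OF D] by (simp add: linear_cmul pd_def)
    ultimately have "((\<lambda>s. F (y + s *\<^sub>R axis i 1)) has_derivative (\<lambda>h. pd i F (y + s *\<^sub>R axis i 1) * h)) (at s)"
      by simp
    then show ?thesis by (simp add: has_field_derivative_def)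
  qed
  have "\<exists>y\<in>V. dist y x < e \<and>
      f (x + t *\<^sub>R axis i 1 + t *\<^sub>R axis j 1) - f (x + t *\<^sub>R axis i 1) - f (x + t *\<^sub>R axis j 1) + f x
        = t\<^sup>2 * pd j (pd i f) y" for i j
  proof -
    \<comment> \<open>The second difference is the increment of \<phi> from 0 to \<open>t\<close>;
      the mean value theorem in \<open>a\<close>, then in \<open>b\<close>, turns it into a second
      derivative at a point of the square.\<close>
    define \<phi> where "\<phi> a = f (x + t *\<^sub>R axis j 1 + a *\<^sub>R axis i 1) - f (x + a *\<^sub>R axis i 1)" for a
    have n1: "x + t *\<^sub>R axis j 1 + a *\<^sub>R axis i 1 \<in> V" "x + a *\<^sub>R axis i 1 \<in> V" if "0 \<le> a" "a \<le> t" for a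
      using near[of t a j i] near[of 0 a j i] that t by auto
    have "(\<phi> has_real_derivative pd i f (x + t *\<^sub>R axis j 1 + a *\<^sub>R axis i 1) - pd i f (x + a *\<^sub>R axis i 1)) (at a)"
      if "0 \<le> a" "a \<le> t" for a
      unfolding \<phi>_def using that by (intro DERIV_diff path f n1)
    from MVT2[OF t(1), of \<phi>, OF this] obtain a where a: "0 < a" "a < t"
      and 1: "\<phi> t - \<phi> 0 = (t - 0) * (pd i f (x + t *\<^sub>R axis j 1 + a *\<^sub>R axis i 1) - pd i f (x + a *\<^sub>R axis i 1))"
      by blast
    define \<psi> where "\<psi> b = pd i f (x + a *\<^sub>R axis i 1 + b *\<^sub>R axis j 1)" for b
    have "(\<psi> has_real_derivative pd j (pd i f) (x + a *\<^sub>R axis i 1 + b *\<^sub>R axis j 1)) (at b)"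
      if "0 \<le> b" "b \<le> t" for b
      unfolding \<psi>_def using that a near[of a b i j] by (intro path smooth_on_pd f) auto
    from MVT2[OF t(1), of \<psi>, OF this] obtain b where b: "0 < b" "b < t"
      and 2: "\<psi> t - \<psi> 0 = (t - 0) * pd j (pd i f) (x + a *\<^sub>R axis i 1 + b *\<^sub>R axis j 1)"
      by blast
    have swap: "x + t *\<^sub>R axis j 1 + s *\<^sub>R axis i 1 = x + s *\<^sub>R axis i 1 + t *\<^sub>R axis j 1" for s
      by (simp add: algebra_simps)
    have "f (x + t *\<^sub>R axis i 1 + t *\<^sub>R axis j 1) - f (x + t *\<^sub>R axis i 1) - f (x + t *\<^sub>R axis j 1) + f x
        = t * (\<psi> t - \<psi> 0)"
      using 1 unfolding \<phi>_def \<psi>_def swap by simp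
    also have "\<dots> = t\<^sup>2 * pd j (pd i f) (x + a *\<^sub>R axis i 1 + b *\<^sub>R axis j 1)"
      by (simp add: 2 power2_eq_square)
    finally show ?thesis using near[of a b i j] a b by auto
  qed
  with that t show ?thesis by blast
qed

lemma pd_commute:
  assumes f: "smooth_on V f" and x: "x \<in> V"
  shows "pd i (pd j f) x = pd j (pd i f) x"
proof (rule ccontr)
  define e where "e = dist (pd i (pd j f) x) (pd j (pd i f) x)"
  assume "\<not> ?thesis"
  then have e: "e / 2 > 0" by (simp add: e_def)
  have cont: "continuous_on V (pd a (pd b f))" for a b
    using f smooth_on_pd smooth_on_differentiable differentiable_imp_continuous_on by blast
  from cont[of i j] x e obtain d1 where d1: "d1 > 0"
    "\<And>y. y \<in> V \<Longrightarrow> dist y x < d1 \<Longrightarrow> dist (pd i (pd j f) y) (pd i (pd j f) x) < e / 2"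
    unfolding continuous_on_iff by blast
  from cont[of j i] x e obtain d2 where d2: "d2 > 0"
    "\<And>y. y \<in> V \<Longrightarrow> dist y x < d2 \<Longrightarrow> dist (pd j (pd i f) y) (pd j (pd i f) x) < e / 2"
    unfolding continuous_on_iff by blast
  obtain t where t: "0 < t"
    and *: "\<And>i j. \<exists>y\<in>V. dist y x < min d1 d2 \<and>
      f (x + t *\<^sub>R axis i 1 + t *\<^sub>R axis j 1) - f (x + t *\<^sub>R axis i 1) - f (x + t *\<^sub>R axis j 1) + f x
        = t\<^sup>2 * pd j (pd i f) y"
    using second_difference[OF f x, of "min d1 d2"] d1 d2 by (metis min_less_iff_conj)
  \<comment> \<open>The second difference is symmetric in \<open>i\<close> and \<open>j\<close>, so
    the same \<open>t\<close> yields both mixed derivatives, taken at two points close to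
    \<open>x\<close>.\<close>
  obtain y z where y: "y \<in> V" "dist y x < d1" and z: "z \<in> V" "dist z x < d2"
    and "t\<^sup>2 * pd i (pd j f) y = t\<^sup>2 * pd j (pd i f) z"
    using *[of i j] *[of j i] by (smt (verit) add.commute add.left_commute min_less_iff_conj)
  then have "pd i (pd j f) y = pd j (pd i f) z" using t by simp
  then show False
    using dist_triangle_half_r[OF d1(2)[OF y], of "pd j (pd i f) x"] d2(2)[OF z]
    by (simp add: e_def)
qed

end

section \<open>Covariant derivatives in a frame of Killing fields\<close>

lemma sum_delta_mult:
  fixes f :: "3 \<Rightarrow> real"
  shows "(\<Sum>j\<in>UNIV. (if i = j then 1 else 0) * f j) = f i"
    "(\<Sum>j\<in>UNIV. (if j = i then 1 else 0) * f j) = f i"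
    "(\<Sum>j\<in>UNIV. f j * (if i = j then 1 else 0)) = f i"
    "(\<Sum>j\<in>UNIV. f j * (if j = i then 1 else 0)) = f i"
  by (simp_all add: if_distrib[of "\<lambda>z. z * f _"] if_distrib[of "\<lambda>z. f _ * z"] cong: if_cong)

text \<open>Coordinate expressions in one chart: \<open>X m a\<close> is component \<open>a\<close>
  of the Killing field \<open>m\<close>, \<open>gi\<close> the inverse metric, and \<open>Xi\<close>
  the dual coframe, whose existence expresses transitivity. The inverses are carried as smooth data
  so that differentiation only meets sums and products.\<close>

locale killing_frame =
  fixes V :: "(real^3) set"
    and g gi :: "3 \<Rightarrow> 3 \<Rightarrow> real^3 \<Rightarrow> real"
    and X Xi :: "3 \<Rightarrow> 3 \<Rightarrow> real^3 \<Rightarrow> real"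
    and c :: "3 \<Rightarrow> 3 \<Rightarrow> 3 \<Rightarrow> real"
  assumes V: "open V"
    and g_smooth: "\<And>i j. smooth_on V (g i j)"
    and gi_smooth: "\<And>i j. smooth_on V (gi i j)"
    and X_smooth: "\<And>m a. smooth_on V (X m a)"
    and Xi_smooth: "\<And>m a. smooth_on V (Xi m a)"
    and g_sym: "\<And>x i j. x \<in> V \<Longrightarrow> g i j x = g j i x"
    and gi_sym: "\<And>x i j. x \<in> V \<Longrightarrow> gi i j x = gi j i x"
    and g_gi: "\<And>x i j. x \<in> V \<Longrightarrow> (\<Sum>k\<in>UNIV. g i k x * gi k j x) = (if i = j then 1 else 0)"
    and X_Xi: "\<And>x a b. x \<in> V \<Longrightarrow> (\<Sum>m\<in>UNIV. X m a x * Xi m b x) = (if a = b then 1 else 0)"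
    and Xi_X: "\<And>x m n. x \<in> V \<Longrightarrow> (\<Sum>a\<in>UNIV. Xi m a x * X n a x) = (if m = n then 1 else 0)"
    and killing: "\<And>x m i j. x \<in> V \<Longrightarrow>
      (\<Sum>k\<in>UNIV. X m k x * pd k (g i j) x + g k j x * pd i (X m k) x + g i k x * pd j (X m k) x) = 0"
    and bracket: "\<And>x i j k. x \<in> V \<Longrightarrow>
      (\<Sum>a\<in>UNIV. X i a x * pd a (X j k) x - X j a x * pd a (X i k) x) = (\<Sum>l\<in>UNIV. c i j l * X l k x)"
begin

lemmas smooth_intros = smooth_on_const[OF V] smooth_on_add[OF V] smooth_on_mult[OF V]
  smooth_on_minus[OF V] smooth_on_diff[OF V] smooth_on_sum[OF V] smooth_on_pd[OF V]
  g_smooth gi_smooth X_smooth Xi_smooth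

section \<open>Differentiation along the frame and the Jacobi identity\<close>

definition D :: "3 \<Rightarrow> (real^3 \<Rightarrow> real) \<Rightarrow> real^3 \<Rightarrow> real" where
  "D m f x = (\<Sum>a\<in>UNIV. X m a x * pd a f x)"

lemma D_smooth: "smooth_on V f \<Longrightarrow> smooth_on V (D m f)"
  unfolding D_def[abs_def] by (intro smooth_intros)

lemma D_cong: "x \<in> V \<Longrightarrow> (\<And>y. y \<in> V \<Longrightarrow> f y = f' y) \<Longrightarrow> D m f x = D m f' x"
  unfolding D_def using pd_cong[OF V, of x f f'] by simp

lemma D_const: "D m (\<lambda>x. k) x = 0"
  unfolding D_def by simp

lemma D_add: "x \<in> V \<Longrightarrow> smooth_on V f \<Longrightarrow> smooth_on V h \<Longrightarrow> D m (\<lambda>y. f y + h y) x = D m f x + D m h x"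
  unfolding D_def by (simp add: pd_add[OF V] sum.distrib algebra_simps)

lemma D_diff: "x \<in> V \<Longrightarrow> smooth_on V f \<Longrightarrow> smooth_on V h \<Longrightarrow> D m (\<lambda>y. f y - h y) x = D m f x - D m h x"
  unfolding D_def by (simp add: pd_diff[OF V] sum_subtractf algebra_simps)

lemma D_mult: "x \<in> V \<Longrightarrow> smooth_on V f \<Longrightarrow> smooth_on V h \<Longrightarrow>
    D m (\<lambda>y. f y * h y) x = D m f x * h x + f x * D m h x"
  unfolding D_def by (simp add: pd_mult[OF V] sum.distrib algebra_simps sum_distrib_left)

lemma D_cmult: "x \<in> V \<Longrightarrow> smooth_on V f \<Longrightarrow> D m (\<lambda>y. k * f y) x = k * D m f x"
  using D_mult[of x "\<lambda>_. k" f m] smooth_on_const[OF V] by (simp add: D_const)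

lemma D_sum: "x \<in> V \<Longrightarrow> (\<And>j. j \<in> I \<Longrightarrow> smooth_on V (f j)) \<Longrightarrow>
    D m (\<lambda>y. \<Sum>j\<in>I. f j y) x = (\<Sum>j\<in>I. D m (f j) x)"
  by (induction I rule: infinite_finite_induct) (auto simp: D_add D_const smooth_on_sum[OF V])

lemma bracket_D: "x \<in> V \<Longrightarrow> D i (X j k) x - D j (X i k) x = (\<Sum>l\<in>UNIV. c i j l * X l k x)"
  using bracket[of x i j k] by (simp add: D_def sum_subtractf)

text \<open>The second-order terms cancel by symmetry of the mixed partial derivatives; what remains
  is the bracket applied to \<open>f\<close>.\<close>

lemma D_commutator:
  assumes x: "x \<in> V" and f: "smooth_on V f"
  shows "D i (D j f) x - D j (D i f) x = (\<Sum>l\<in>UNIV. c i j l * D l f x)"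
proof -
  have 1: "D i (D j f) x = (\<Sum>b\<in>UNIV. D i (X j b) x * pd b f x) + (\<Sum>a\<in>UNIV. \<Sum>b\<in>UNIV. X i a x * X j b x * pd a (pd b f) x)" for i j
  proof -
    have "D i (D j f) x = (\<Sum>b\<in>UNIV. D i (X j b) x * pd b f x + X j b x * D i (pd b f) x)"
      unfolding D_def[of j, abs_def] using x f by (simp add: D_sum D_mult smooth_intros)
    then show ?thesis by (simp add: D_def sum_3 algebra_simps)
  qed
  have "D i (D j f) x - D j (D i f) x = (\<Sum>b\<in>UNIV. (D i (X j b) x - D j (X i b) x) * pd b f x)"
    unfolding 1 using pd_commute[OF V f x] by (simp add: sum_3 algebra_simps)
  also have "\<dots> = (\<Sum>l\<in>UNIV. c i j l * D l f x)"
    by (simp add: bracket_D x) (simp add: D_def sum_3 algebra_simps)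
  finally show ?thesis .
qed

lemma frame_eq_0:
  assumes "x \<in> V" "\<And>b. (\<Sum>r\<in>UNIV. w r * X r b x) = 0"
  shows "w s = 0"
proof -
  have "(\<Sum>b\<in>UNIV. Xi s b x * (\<Sum>r\<in>UNIV. w r * X r b x)) = (\<Sum>r\<in>UNIV. w r * (\<Sum>b\<in>UNIV. Xi s b x * X r b x))"
    by (simp add: sum_3 algebra_simps)
  then show ?thesis using assms by (simp add: Xi_X sum_delta_mult)
qed

text \<open>The constants inherit the identity from the fields: on the components
  \<open>X k b\<close> the commutators of \<open>D\<close> cancel in cyclic sum, and the frame is
  linearly independent.\<close>

lemma jacobi:
  assumes x: "x \<in> V"
  shows "(\<Sum>l\<in>UNIV. c i j l * c l k r + c j k l * c l i r + c k i l * c l j r) = 0"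
proof (rule frame_eq_0[OF x])
  fix b
  have 1: "(\<Sum>l\<in>UNIV. c i j l * (D l (X k b) x - D k (X l b) x))
      = D i (D j (X k b)) x - D j (D i (X k b)) x - D k (D i (X j b)) x + D k (D j (X i b)) x" for i j k
  proof -
    have "D k (D i (X j b)) x - D k (D j (X i b)) x = D k (\<lambda>x. D i (X j b) x - D j (X i b) x) x"
      using x by (simp add: D_diff D_smooth X_smooth)
    also have "\<dots> = D k (\<lambda>x. \<Sum>l\<in>UNIV. c i j l * X l b x) x"
      using x bracket_D by (intro D_cong) auto
    also have "\<dots> = (\<Sum>l\<in>UNIV. c i j l * D k (X l b) x)"
      using x by (simp add: D_sum D_cmult smooth_intros)
    finally show ?thesis using D_commutator[OF x X_smooth, of i j k b]
      by (simp add: sum_subtractf right_diff_distrib)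
  qed
  have "(\<Sum>l\<in>UNIV. c i j l * (\<Sum>r\<in>UNIV. c l k r * X r b x))
     + (\<Sum>l\<in>UNIV. c j k l * (\<Sum>r\<in>UNIV. c l i r * X r b x))
     + (\<Sum>l\<in>UNIV. c k i l * (\<Sum>r\<in>UNIV. c l j r * X r b x)) = 0"
    using 1[of i j k] 1[of j k i] 1[of k i j] by (simp add: bracket_D x)
  then show "(\<Sum>r\<in>UNIV. (\<Sum>l\<in>UNIV. c i j l * c l k r + c j k l * c l i r + c k i l * c l j r) * X r b x) = 0"
    by (simp add: sum_3 algebra_simps)
qed

section \<open>The Levi-Civita connection and the covariant derivatives of Killing fields\<close>

definition \<Gamma> :: "3 \<Rightarrow> 3 \<Rightarrow> 3 \<Rightarrow> real^3 \<Rightarrow> real" where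
  "\<Gamma> k i j x = (\<Sum>l\<in>UNIV. 1/2 * gi k l x * (pd i (g j l) x + pd j (g i l) x - pd l (g i j) x))"

lemma \<Gamma>_smooth: "smooth_on V (\<Gamma> k i j)"
  unfolding \<Gamma>_def[abs_def] by (intro smooth_intros)

lemma pd_g_sym: "x \<in> V \<Longrightarrow> pd k (g i j) x = pd k (g j i) x"
  by (rule pd_cong[OF V]) (auto intro: g_sym)

lemma \<Gamma>_sym: "x \<in> V \<Longrightarrow> \<Gamma> k i j x = \<Gamma> k j i x"
  unfolding \<Gamma>_def using pd_g_sym[of x _ i j] by (simp add: add.commute)

lemma lower_\<Gamma>: "x \<in> V \<Longrightarrow>
    (\<Sum>k\<in>UNIV. g n k x * \<Gamma> k i j x) = (pd i (g j n) x + pd j (g i n) x - pd n (g i j) x) / 2"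
proof -
  assume x: "x \<in> V"
  define T where "T l = (pd i (g j l) x + pd j (g i l) x - pd l (g i j) x) / 2" for l
  have "\<Gamma> k i j x = (\<Sum>l\<in>UNIV. gi k l x * T l)" for k
    by (simp add: \<Gamma>_def T_def)
  then have "(\<Sum>k\<in>UNIV. g n k x * \<Gamma> k i j x) = (\<Sum>l\<in>UNIV. (\<Sum>k\<in>UNIV. g n k x * gi k l x) * T l)"
    by (simp add: sum_3 algebra_simps)
  also have "\<dots> = T n" using x by (simp add: g_gi sum_delta_mult)
  finally show ?thesis by (simp add: T_def)
qed

definition A :: "3 \<Rightarrow> 3 \<Rightarrow> 3 \<Rightarrow> real^3 \<Rightarrow> real" where
  "A m i k x = pd i (X m k) x + (\<Sum>l\<in>UNIV. \<Gamma> k i l x * X m l x)"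

lemma A_smooth: "smooth_on V (A m i k)"
  unfolding A_def[abs_def] by (intro smooth_intros \<Gamma>_smooth)

definition W :: "3 \<Rightarrow> 3 \<Rightarrow> 3 \<Rightarrow> real^3 \<Rightarrow> real" where
  "W m i j x = (\<Sum>k\<in>UNIV. g j k x * A m i k x)"

text \<open>With the derivatives of \<open>g\<close> absorbed into \<Gamma>, the vanishing Lie
  derivative says that the lowered covariant derivative of a Killing field is skew.\<close>

lemma W_antisym: "x \<in> V \<Longrightarrow> W m i j x = - W m j i x"
proof -
  assume x: "x \<in> V"
  have 1: "W m i j x = (\<Sum>k\<in>UNIV. g j k x * pd i (X m k) x)
      + (\<Sum>l\<in>UNIV. X m l x * ((pd i (g l j) x + pd l (g i j) x - pd j (g i l) x) / 2))" for i j
    unfolding W_def A_def lower_\<Gamma>[OF x, symmetric] by (simp add: sum_3 algebra_simps)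
  have "pd l (g i j) x = pd l (g j i) x" "pd i (g l j) x = pd i (g j l) x" "pd j (g l i) x = pd j (g i l) x"
     "g l j x = g j l x" for l
    using x pd_g_sym g_sym by auto
  then show ?thesis unfolding 1 using killing[OF x, of m i j]
    by (simp add: sum_3 field_simps)
qed

lemma A_via_W: "x \<in> V \<Longrightarrow> A m i n x = (\<Sum>j\<in>UNIV. gi n j x * W m i j x)"
proof -
  assume x: "x \<in> V"
  have "(\<Sum>j\<in>UNIV. gi n j x * W m i j x) = (\<Sum>k\<in>UNIV. (\<Sum>j\<in>UNIV. g k j x * gi j n x) * A m i k x)"
    unfolding W_def using x by (simp add: sum_3 algebra_simps g_sym[of x 2 1] g_sym[of x 3 1] g_sym[of x 3 2]
       gi_sym[of x n])
  then show ?thesis using x by (simp add: g_gi sum_delta_mult)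
qed

lemma killing_div: "x \<in> V \<Longrightarrow> (\<Sum>i\<in>UNIV. A m i i x) = 0"
  using W_antisym[of x m 1 2] W_antisym[of x m 1 3] W_antisym[of x m 2 3]
    W_antisym[of x m 1 1] W_antisym[of x m 2 2] W_antisym[of x m 3 3]
    gi_sym[of x 1 2] gi_sym[of x 1 3] gi_sym[of x 2 3]
  by (simp add: A_via_W sum_3)

text \<open>\<open>\<gamma> n m k\<close> is the component along \<open>X k\<close> of the covariant derivative of \<open>X m\<close> in the direction \<open>X n\<close>.\<close>

definition Y :: "3 \<Rightarrow> 3 \<Rightarrow> 3 \<Rightarrow> real^3 \<Rightarrow> real" where
  "Y n m k x = (\<Sum>j\<in>UNIV. X n j x * A m j k x)"

definition \<gamma> :: "3 \<Rightarrow> 3 \<Rightarrow> 3 \<Rightarrow> real^3 \<Rightarrow> real" where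
  "\<gamma> n m k x = (\<Sum>i\<in>UNIV. Xi k i x * Y n m i x)"

lemma Y_smooth: "smooth_on V (Y n m k)"
  unfolding Y_def[abs_def] by (intro smooth_intros A_smooth)

lemma \<gamma>_smooth: "smooth_on V (\<gamma> n m k)"
  unfolding \<gamma>_def[abs_def] by (intro smooth_intros Y_smooth)

lemma Y_via_\<gamma>: "x \<in> V \<Longrightarrow> Y n m i x = (\<Sum>k\<in>UNIV. \<gamma> n m k x * X k i x)"
proof -
  assume x: "x \<in> V"
  have "(\<Sum>k\<in>UNIV. \<gamma> n m k x * X k i x) = (\<Sum>b\<in>UNIV. (\<Sum>k\<in>UNIV. X k i x * Xi k b x) * Y n m b x)"
    by (simp add: \<gamma>_def sum_3 algebra_simps)
  then show ?thesis by (simp add: X_Xi x sum_delta_mult)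
qed

lemma Y_eq: "x \<in> V \<Longrightarrow> Y i m a x = D i (X m a) x + (\<Sum>k\<in>UNIV. \<Sum>l\<in>UNIV. \<Gamma> a k l x * X i k x * X m l x)"
  by (simp add: Y_def A_def D_def sum_3 algebra_simps)

lemma torsion: "x \<in> V \<Longrightarrow> \<gamma> n m k x - \<gamma> m n k x = c n m k"
proof -
  assume x: "x \<in> V"
  have "\<gamma> n m k x - \<gamma> m n k x - c n m k = 0"
  proof (rule frame_eq_0[OF x, where w = "\<lambda>k. \<gamma> n m k x - \<gamma> m n k x - c n m k"])
    fix b
    have "Y n m b x - Y m n b x = D n (X m b) x - D m (X n b) x"
      using x \<Gamma>_sym[of x b 1 2] \<Gamma>_sym[of x b 1 3] \<Gamma>_sym[of x b 2 3]
      by (simp add: Y_eq sum_3 algebra_simps)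
    then show "(\<Sum>r\<in>UNIV. (\<gamma> n m r x - \<gamma> m n r x - c n m r) * X r b x) = 0"
      using bracket_D[OF x, of n m b] x by (simp add: Y_via_\<gamma> left_diff_distrib sum_subtractf)
  qed
  then show ?thesis by simp
qed

section \<open>The Gram matrix of the frame and the connection coefficients\<close>

definition h :: "3 \<Rightarrow> 3 \<Rightarrow> real^3 \<Rightarrow> real" where
  "h m n x = (\<Sum>a\<in>UNIV. \<Sum>b\<in>UNIV. g a b x * (X m a x * X n b x))"

definition hi :: "3 \<Rightarrow> 3 \<Rightarrow> real^3 \<Rightarrow> real" where
  "hi m n x = (\<Sum>a\<in>UNIV. \<Sum>b\<in>UNIV. gi a b x * (Xi m a x * Xi n b x))"

lemma h_smooth: "smooth_on V (h m n)"
  unfolding h_def[abs_def] by (intro smooth_intros)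

lemma hi_smooth: "smooth_on V (hi m n)"
  unfolding hi_def[abs_def] by (intro smooth_intros)

lemma h_sym: "x \<in> V \<Longrightarrow> h m n x = h n m x"
  unfolding h_def by (subst sum.swap) (simp add: g_sym mult.commute cong: sum.cong)

lemma h_hi: "x \<in> V \<Longrightarrow> (\<Sum>l\<in>UNIV. h k l x * hi l n x) = (if k = n then 1 else 0)"
proof -
  assume x: "x \<in> V"
  define u where "u b = (\<Sum>a\<in>UNIV. g a b x * X k a x)" for b
  define v where "v b = (\<Sum>a\<in>UNIV. gi b a x * Xi n a x)" for b
  have hk: "h k l x = (\<Sum>b\<in>UNIV. u b * X l b x)" for l
    unfolding h_def u_def by (simp add: sum_3 algebra_simps)
  have hin: "hi l n x = (\<Sum>c\<in>UNIV. Xi l c x * v c)" for l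
    unfolding hi_def v_def by (simp add: sum_3 algebra_simps)
  have "(\<Sum>l\<in>UNIV. h k l x * hi l n x) = (\<Sum>l\<in>UNIV. (\<Sum>b\<in>UNIV. u b * X l b x) * (\<Sum>c\<in>UNIV. Xi l c x * v c))"
    by (simp add: hk hin)
  also have "\<dots> = (\<Sum>b\<in>UNIV. \<Sum>c\<in>UNIV. u b * ((\<Sum>l\<in>UNIV. X l b x * Xi l c x) * v c))"
    by (simp add: sum_3 algebra_simps)
  also have "\<dots> = (\<Sum>b\<in>UNIV. u b * v b)"
    using x by (simp add: X_Xi sum_distrib_left[symmetric] sum_delta_mult)
  also have "\<dots> = (\<Sum>a\<in>UNIV. X k a x * (\<Sum>d\<in>UNIV. (\<Sum>b\<in>UNIV. g a b x * gi b d x) * Xi n d x))"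
    unfolding u_def v_def by (simp add: sum_3 algebra_simps)
  also have "\<dots> = (if k = n then 1 else 0)"
    using x Xi_X[OF x, of n k] by (simp add: g_gi sum_delta_mult mult.commute eq_commute)
  finally show ?thesis .
qed

lemma h_eq_0:
  assumes "x \<in> V" "\<And>k. (\<Sum>l\<in>UNIV. w l * h l k x) = 0"
  shows "w s = 0"
proof -
  have "(\<Sum>k\<in>UNIV. (\<Sum>l\<in>UNIV. w l * h l k x) * hi k s x) = (\<Sum>l\<in>UNIV. w l * (\<Sum>k\<in>UNIV. h l k x * hi k s x))"
    by (simp add: sum_3 algebra_simps)
  then show ?thesis using assms by (simp add: h_hi sum_delta_mult)
qed

lemma D_g: "x \<in> V \<Longrightarrow> D i (g a b) x =
    - (\<Sum>k\<in>UNIV. g k b x * pd a (X i k) x + g a k x * pd b (X i k) x)"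
  using killing[of x i a b] by (simp add: D_def sum.distrib)

text \<open>The Lie derivative of \<open>g\<close> along a Killing field vanishes, so
  \<open>X i\<close> differentiates an inner product only through the brackets with its two
  arguments.\<close>

lemma D_h:
  assumes x: "x \<in> V"
  shows "D i (h j k) x = (\<Sum>l\<in>UNIV. c i j l * h l k x + c i k l * h j l x)"
proof -
  have "D i (h j k) x = (\<Sum>a\<in>UNIV. \<Sum>b\<in>UNIV. D i (g a b) x * (X j a x * X k b x)
      + g a b x * (D i (X j a) x * X k b x + X j a x * D i (X k b) x))"
    unfolding h_def[abs_def] using x by (simp add: D_sum D_mult smooth_intros)
  also have "\<dots> = (\<Sum>a\<in>UNIV. \<Sum>b\<in>UNIV. g a b x *
      ((D i (X j a) x - D j (X i a) x) * X k b x + X j a x * (D i (X k b) x - D k (X i b) x)))"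
    unfolding D_g[OF x] unfolding D_def by (simp add: sum_3 algebra_simps)
  also have "\<dots> = (\<Sum>l\<in>UNIV. c i j l * h l k x + c i k l * h j l x)"
    unfolding bracket_D[OF x] h_def by (simp add: sum_3 algebra_simps)
  finally show ?thesis .
qed

text \<open>The lowered coefficients \<open>G n m k\<close> are skew in \<open>n\<close> and
  \<open>k\<close> by the Killing equation, and their skew part in \<open>n\<close> and
  \<open>m\<close> is given by the bracket, the connection being torsion-free. These two symmetries
  determine them, and no derivative of \<open>h\<close> appears.\<close>

lemma lower_\<gamma>:
  assumes x: "x \<in> V"
  shows "(\<Sum>l\<in>UNIV. \<gamma> n m l x * h l k x)
    = (\<Sum>l\<in>UNIV. c n m l * h l k x + c n k l * h l m x + c m k l * h l n x) / 2"
proof -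
  define G where "G n m k = (\<Sum>l\<in>UNIV. \<gamma> n m l x * h l k x)" for n m k
  have 1: "G n m k = (\<Sum>j\<in>UNIV. \<Sum>b\<in>UNIV. X n j x * X k b x * W m j b x)" for n m k
  proof -
    have "G n m k = (\<Sum>a\<in>UNIV. \<Sum>b\<in>UNIV. g b a x * ((\<Sum>l\<in>UNIV. \<gamma> n m l x * X l a x) * X k b x))"
      unfolding G_def h_def using x by (simp add: g_sym[of x 2 1] g_sym[of x 3 1] g_sym[of x 3 2] sum_3 algebra_simps)
    also have "\<dots> = (\<Sum>j\<in>UNIV. \<Sum>b\<in>UNIV. X n j x * X k b x * W m j b x)"
      unfolding Y_via_\<gamma>[OF x, symmetric] Y_def W_def by (simp add: sum_3 algebra_simps)
    finally show ?thesis .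
  qed
  have anti: "G n m k = - G k m n" for n m k
    unfolding 1 using W_antisym[OF x, of m 1 2] W_antisym[OF x, of m 1 3] W_antisym[OF x, of m 2 3]
    W_antisym[OF x, of m 1 1] W_antisym[OF x, of m 2 2] W_antisym[OF x, of m 3 3]
    by (simp add: sum_3 algebra_simps)
  have tors: "G n m k - G m n k = (\<Sum>l\<in>UNIV. c n m l * h l k x)" for n m k
    unfolding G_def torsion[OF x, symmetric] by (simp add: sum_subtractf left_diff_distrib)
  show ?thesis unfolding sum.distrib tors[symmetric] G_def[symmetric]
    using anti[of n m k] anti[of m n k] anti[of n k m] anti[of m k n] anti[of k n m] by simp
qed

lemma D_sum_cmult3:
  assumes "x \<in> V" "\<And>l. smooth_on V (f1 l)" "\<And>l. smooth_on V (f2 l)" "\<And>l. smooth_on V (f3 l)"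
  shows "D i (\<lambda>x. \<Sum>l\<in>UNIV. k1 l * f1 l x + k2 l * f2 l x + k3 l * f3 l x) x
    = (\<Sum>l\<in>UNIV. k1 l * D i (f1 l) x + k2 l * D i (f2 l) x + k3 l * D i (f3 l) x)"
  using assms by (simp add: D_sum D_add D_cmult smooth_intros)

text \<open>A Killing field preserves the connection, so differentiating \<gamma> along
  \<open>X i\<close> acts on its three slots through the brackets. After lowering the last index,
  \<open>lower_\<gamma>\<close> and \<open>D_h\<close> make both sides polynomials in
  \<open>c\<close> and \<open>h\<close>, which agree by the Jacobi identity.\<close>

lemma D_\<gamma>:
  assumes x: "x \<in> V"
  shows "D i (\<gamma> j m k) x = (\<Sum>l\<in>UNIV. c i j l * \<gamma> l m k x + c i m l * \<gamma> j l k x - \<gamma> j m l x * c i l k)"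
proof -
  define R where "R k = (\<Sum>l\<in>UNIV. c i j l * \<gamma> l m k x + c i m l * \<gamma> j l k x - \<gamma> j m l x * c i l k)" for k
  have "D i (\<gamma> j m k) x - R k = 0"
  proof (rule h_eq_0[OF x, where w = "\<lambda>k. D i (\<gamma> j m k) x - R k"])
    fix k
    define low where "low n m k = (\<Sum>l\<in>UNIV. c n m l * h l k x + c n k l * h l m x + c m k l * h l n x) / 2" for n m k
    have "(\<Sum>l\<in>UNIV. D i (\<gamma> j m l) x * h l k x + \<gamma> j m l x * D i (h l k) x)
        = D i (\<lambda>x. \<Sum>l\<in>UNIV. \<gamma> j m l x * h l k x) x"
      using x by (simp add: D_sum D_mult smooth_intros \<gamma>_smooth h_smooth)
    also have "\<dots> = D i (\<lambda>x. \<Sum>l\<in>UNIV. (c j m l / 2) * h l k x + (c j k l / 2) * h l m x + (c m k l / 2) * h l j x) x"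
    proof (rule D_cong[OF x])
      fix y assume y: "y \<in> V"
      show "(\<Sum>l\<in>UNIV. \<gamma> j m l y * h l k y) = (\<Sum>l\<in>UNIV. (c j m l / 2) * h l k y + (c j k l / 2) * h l m y + (c m k l / 2) * h l j y)"
        unfolding lower_\<gamma>[OF y] by (simp add: sum_3 field_simps)
    qed
    also have "\<dots> = (\<Sum>l\<in>UNIV. c j m l * D i (h l k) x + c j k l * D i (h l m) x + c m k l * D i (h l j) x) / 2"
      using x by (subst D_sum_cmult3) (simp_all add: h_smooth sum.distrib sum_divide_distrib add_divide_distrib)
    finally have 1: "(\<Sum>l\<in>UNIV. D i (\<gamma> j m l) x * h l k x)
      = (\<Sum>l\<in>UNIV. c j m l * D i (h l k) x + c j k l * D i (h l m) x + c m k l * D i (h l j) x) / 2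
        - (\<Sum>l\<in>UNIV. \<gamma> j m l x * D i (h l k) x)"
      by (simp add: sum.distrib) (simp add: field_simps)
    have 2: "(\<Sum>l\<in>UNIV. \<gamma> j m l x * D i (h l k) x)
      = (\<Sum>l\<in>UNIV. \<gamma> j m l x * (\<Sum>p\<in>UNIV. c i l p * h p k x)) + (\<Sum>p\<in>UNIV. c i k p * low j m p)"
      unfolding D_h[OF x] low_def lower_\<gamma>[OF x, symmetric] by (simp add: h_sym[OF x] sum_3 algebra_simps)
    have 3: "(\<Sum>k'\<in>UNIV. R k' * h k' k x) = (\<Sum>l\<in>UNIV. c i j l * low l m k + c i m l * low j l k)
       - (\<Sum>l\<in>UNIV. \<gamma> j m l x * (\<Sum>p\<in>UNIV. c i l p * h p k x))"
      unfolding R_def low_def lower_\<gamma>[OF x, symmetric] by (simp add: sum_3 algebra_simps)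
    \<comment> \<open>\<open>cl\<close> is the bracket with its upper index lowered by
      \<open>h\<close>. The fact \<open>E\<close> below says that it too is carried along by
      \<open>X i\<close>; this is where the Jacobi identity enters.\<close>
    define cl where "cl n m k = (\<Sum>l\<in>UNIV. c n m l * h l k x)" for n m k
    have E: "(\<Sum>l\<in>UNIV. c a b l * D i (h l r) x)
        = (\<Sum>l\<in>UNIV. c i a l * cl l b r + c i b l * cl a l r + c i r l * cl a b l)" for a b r
    proof -
      have anti: "c a b l = - c b a l" for a b l
        using torsion[OF x, of a b l] torsion[OF x, of b a l] by simp
      have J: "(\<Sum>l\<in>UNIV. c a b l * c i l p) = (\<Sum>l\<in>UNIV. c i a l * c l b p + c i b l * c a l p)" for p
        using jacobi[OF x, of i a b p] anti[of 1 i p] anti[of 2 i p] anti[of 3 i p]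
          anti[of 1 a p] anti[of 2 a p] anti[of 3 a p] anti[of b i 1] anti[of b i 2] anti[of b i 3]
        by (simp add: sum_3 algebra_simps)
      have "(\<Sum>l\<in>UNIV. c a b l * D i (h l r) x)
        = (\<Sum>p\<in>UNIV. (\<Sum>l\<in>UNIV. c a b l * c i l p) * h p r x) + (\<Sum>p\<in>UNIV. c i r p * (\<Sum>l\<in>UNIV. c a b l * h l p x))"
        unfolding D_h[OF x] by (simp add: sum_3 algebra_simps)
      also have "\<dots> = (\<Sum>l\<in>UNIV. c i a l * cl l b r + c i b l * cl a l r + c i r l * cl a b l)"
        unfolding J cl_def by (simp add: sum_3 algebra_simps)
      finally show ?thesis .
    qed
    have low: "low n m k = (cl n m k + cl n k m + cl m k n) / 2" for n m k
      by (simp add: low_def cl_def sum.distrib)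
    have "(\<Sum>l\<in>UNIV. (D i (\<gamma> j m l) x - R l) * h l k x)
      = (\<Sum>l\<in>UNIV. c j m l * D i (h l k) x + c j k l * D i (h l m) x + c m k l * D i (h l j) x) / 2
        - (\<Sum>p\<in>UNIV. c i k p * low j m p) - (\<Sum>l\<in>UNIV. c i j l * low l m k + c i m l * low j l k)"
      using 1 2 3 by (simp add: left_diff_distrib sum_subtractf)
    also have "\<dots> = 0"
      unfolding sum.distrib E low by (simp add: sum_3 field_simps)
    finally show "(\<Sum>l\<in>UNIV. (D i (\<gamma> j m l) x - R l) * h l k x) = 0" .
  qed
  then show ?thesis by (simp add: R_def)
qed

text \<open>Moving \<open>D i\<close> past \<open>D k\<close> costs a bracket term on the index
  \<open>k\<close>. It cancels the term that \<open>D_\<gamma>\<close> produces for the contracted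
  upper index, so only the free indices are acted on.\<close>

lemma D_rotate: 
  assumes x: "x \<in> V"
  shows "(\<Sum>k\<in>UNIV. D i (D k (\<gamma> n m k)) x)
    = (\<Sum>l\<in>UNIV. c i n l * (\<Sum>k\<in>UNIV. D k (\<gamma> l m k) x) + c i m l * (\<Sum>k\<in>UNIV. D k (\<gamma> n l k) x))"
proof -
  have "(\<Sum>k\<in>UNIV. D i (D k (\<gamma> n m k)) x)
    = (\<Sum>k\<in>UNIV. D k (D i (\<gamma> n m k)) x + (\<Sum>l\<in>UNIV. c i k l * D l (\<gamma> n m k) x))"
  proof (rule sum.cong[OF refl])
    fix k
    show "D i (D k (\<gamma> n m k)) x = D k (D i (\<gamma> n m k)) x + (\<Sum>l\<in>UNIV. c i k l * D l (\<gamma> n m k) x)"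
      using D_commutator[OF x \<gamma>_smooth[of n m k], of i k] by linarith
  qed
  also have "\<dots> = (\<Sum>k\<in>UNIV. (\<Sum>l\<in>UNIV. c i n l * D k (\<gamma> l m k) x + c i m l * D k (\<gamma> n l k) x - c i l k * D k (\<gamma> n m l) x)
     + (\<Sum>l\<in>UNIV. c i k l * D l (\<gamma> n m k) x))"
  proof (intro sum.cong refl arg_cong2[where f = "(+)"])
    fix k
    have "D k (D i (\<gamma> n m k)) x = D k (\<lambda>x. \<Sum>l\<in>UNIV. c i n l * \<gamma> l m k x + c i m l * \<gamma> n l k x - c i l k * \<gamma> n m l x) x"
      using x D_\<gamma> by (intro D_cong) (auto simp: mult.commute)
    then show "D k (D i (\<gamma> n m k)) x = (\<Sum>l\<in>UNIV. c i n l * D k (\<gamma> l m k) x + c i m l * D k (\<gamma> n l k) x - c i l k * D k (\<gamma> n m l) x)"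
      using x by (simp add: D_sum D_add D_diff D_cmult smooth_intros \<gamma>_smooth)
  qed
  finally show ?thesis by (simp add: sum_3 algebra_simps)
qed

section \<open>Ricci tensor and scalar curvature in the frame\<close>

definition Ric :: "3 \<Rightarrow> 3 \<Rightarrow> real^3 \<Rightarrow> real" where
  "Ric i j x = (\<Sum>k\<in>UNIV. pd k (\<Gamma> k i j) x - pd j (\<Gamma> k i k) x
     + (\<Sum>l\<in>UNIV. \<Gamma> k k l x * \<Gamma> l i j x - \<Gamma> k j l x * \<Gamma> l i k x))"

lemma Ric_smooth: "smooth_on V (Ric i j)"
  unfolding Ric_def[abs_def] by (intro smooth_intros \<Gamma>_smooth)

definition \<rho> :: "3 \<Rightarrow> 3 \<Rightarrow> real^3 \<Rightarrow> real" where
  "\<rho> m n x = (\<Sum>a\<in>UNIV. \<Sum>b\<in>UNIV. Ric a b x * (X m a x * X n b x))"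

lemma \<rho>_smooth: "smooth_on V (\<rho> i j)"
  unfolding \<rho>_def[abs_def] by (intro smooth_intros Ric_smooth)

lemma pd_A: "x \<in> V \<Longrightarrow> pd i (A m j k) x = pd i (pd j (X m k)) x
    + (\<Sum>l\<in>UNIV. pd i (\<Gamma> k j l) x * X m l x + \<Gamma> k j l x * pd i (X m l) x)"
  unfolding A_def[abs_def] by (simp add: pd_add[OF V] pd_sum[OF V] pd_mult[OF V] smooth_intros \<Gamma>_smooth)

lemma pd_\<Gamma>_sym: "x \<in> V \<Longrightarrow> pd a (\<Gamma> k i j) x = pd a (\<Gamma> k j i) x"
  by (rule pd_cong[OF V]) (auto intro: \<Gamma>_sym)

text \<open>The contracted Ricci identity; the divergence of a Killing field vanishes.\<close>

lemma Ric_killing: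
  assumes x: "x \<in> V"
  shows "(\<Sum>l\<in>UNIV. Ric l j x * X m l x) = (\<Sum>i\<in>UNIV. pd i (A m j i) x
     + (\<Sum>l\<in>UNIV. \<Gamma> i i l x * A m j l x - \<Gamma> l i j x * A m l i x))"
proof -
  have "(\<Sum>i\<in>UNIV. pd j (A m i i) x) = pd j (\<lambda>x. \<Sum>i\<in>UNIV. A m i i x) x"
    using x by (simp add: pd_sum[OF V] A_smooth)
  also have "\<dots> = pd j (\<lambda>x. 0) x"
    using x killing_div by (intro pd_cong[OF V]) auto
  finally have 0: "(\<Sum>i\<in>UNIV. pd j (A m i i) x) = 0" by simp
  have "(\<Sum>l\<in>UNIV. Ric l j x * X m l x) = (\<Sum>i\<in>UNIV. pd i (A m j i) x) - (\<Sum>i\<in>UNIV. pd j (A m i i) x)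
     + (\<Sum>i\<in>UNIV. \<Sum>l\<in>UNIV. \<Gamma> i i l x * A m j l x - \<Gamma> l i j x * A m l i x)"
    unfolding pd_A[OF x] Ric_def A_def
    by (simp add: pd_commute[OF V X_smooth x] pd_\<Gamma>_sym[OF x] \<Gamma>_sym[OF x] sum_3 algebra_simps)
  then show ?thesis by (simp add: 0 sum.distrib)
qed

text \<open>By the contracted Ricci identity and the product rule, this is the divergence of the
  covariant derivative of \<open>X m\<close> along \<open>X n\<close>, minus the trace of the
  product of the endomorphisms \<open>A n\<close> and \<open>A m\<close>. Expanded in the frame, the
  divergence only differentiates the coefficients, because each \<open>X k\<close> is
  divergence-free.\<close>

lemma \<rho>_eq':
  assumes x: "x \<in> V"
  shows "\<rho> m n x = (\<Sum>k\<in>UNIV. D k (\<gamma> n m k) x) - (\<Sum>k\<in>UNIV. \<Sum>l\<in>UNIV. \<gamma> k m l x * \<gamma> l n k x)"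
proof -
  have 1: "(\<Sum>i\<in>UNIV. pd i (Y n m i) x) = (\<Sum>i\<in>UNIV. \<Sum>j\<in>UNIV. pd i (X n j) x * A m j i x + X n j x * pd i (A m j i) x)"
    unfolding Y_def[abs_def] using x by (simp add: pd_sum[OF V] pd_mult[OF V] smooth_intros A_smooth)
  have 2: "pd i (Y n m i) x = (\<Sum>k\<in>UNIV. pd i (\<gamma> n m k) x * X k i x + \<gamma> n m k x * pd i (X k i) x)" for i
  proof -
    have "pd i (Y n m i) x = pd i (\<lambda>x. \<Sum>k\<in>UNIV. \<gamma> n m k x * X k i x) x"
      using x Y_via_\<gamma> by (intro pd_cong[OF V]) auto
    then show ?thesis using x by (simp add: pd_sum[OF V] pd_mult[OF V] smooth_intros \<gamma>_smooth)
  qed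
  have 3: "(\<Sum>i\<in>UNIV. \<Sum>l\<in>UNIV. A n i l x * A m l i x) = (\<Sum>k\<in>UNIV. \<Sum>l\<in>UNIV. \<gamma> k m l x * \<gamma> l n k x)"
  proof -
    have A_frame: "A n i l x = (\<Sum>p\<in>UNIV. Xi p i x * Y p n l x)" for i l
    proof -
      have "(\<Sum>p\<in>UNIV. Xi p i x * Y p n l x) = (\<Sum>j\<in>UNIV. (\<Sum>p\<in>UNIV. X p j x * Xi p i x) * A n j l x)"
        by (simp add: Y_def sum_3 algebra_simps)
      then show ?thesis using x by (simp add: X_Xi sum_delta_mult)
    qed
    have "(\<Sum>i\<in>UNIV. \<Sum>l\<in>UNIV. A n i l x * A m l i x)
      = (\<Sum>i\<in>UNIV. \<Sum>p\<in>UNIV. Xi p i x * (\<Sum>q\<in>UNIV. \<gamma> p n q x * (\<Sum>l\<in>UNIV. X q l x * A m l i x)))"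
      unfolding A_frame Y_via_\<gamma>[OF x] by (simp add: sum_3 algebra_simps)
    also have "\<dots> = (\<Sum>p\<in>UNIV. \<Sum>q\<in>UNIV. \<gamma> p n q x * (\<Sum>s\<in>UNIV. \<gamma> q m s x * (\<Sum>i\<in>UNIV. Xi p i x * X s i x)))"
      unfolding Y_def[symmetric] Y_via_\<gamma>[OF x] by (simp add: sum_3 algebra_simps)
    also have "\<dots> = (\<Sum>p\<in>UNIV. \<Sum>q\<in>UNIV. \<gamma> p n q x * \<gamma> q m p x)"
      using x by (simp add: Xi_X sum_delta_mult)
    finally show ?thesis by (simp add: sum_3 algebra_simps)
  qed
  have "\<rho> m n x = (\<Sum>j\<in>UNIV. X n j x * (\<Sum>l\<in>UNIV. Ric l j x * X m l x))"
    unfolding \<rho>_def by (simp add: sum_3 algebra_simps)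
  also have "\<dots> = (\<Sum>i\<in>UNIV. pd i (Y n m i) x) + (\<Sum>i\<in>UNIV. \<Sum>l\<in>UNIV. \<Gamma> i i l x * Y n m l x)
     - (\<Sum>i\<in>UNIV. \<Sum>l\<in>UNIV. A n i l x * A m l i x)"
    unfolding 1 Ric_killing[OF x] unfolding Y_def A_def[of n] by (simp add: sum_3 algebra_simps)
  also have "(\<Sum>i\<in>UNIV. pd i (Y n m i) x) + (\<Sum>i\<in>UNIV. \<Sum>l\<in>UNIV. \<Gamma> i i l x * Y n m l x)
     = (\<Sum>k\<in>UNIV. D k (\<gamma> n m k) x) + (\<Sum>k\<in>UNIV. \<gamma> n m k x * (\<Sum>i\<in>UNIV. A k i i x))"
    unfolding 2 Y_via_\<gamma>[OF x] A_def D_def by (simp add: sum_3 algebra_simps)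
  finally show ?thesis unfolding 3 using killing_div[OF x] by simp
qed

text \<open>By \<open>\<rho>_eq'\<close> the Ricci tensor is built from \<gamma> and its derivatives
  along the frame, so its invariance under \<open>X i\<close> follows from that of \<gamma>.\<close>

lemma D_\<rho>:
  assumes x: "x \<in> V"
  shows "D i (\<rho> m n) x = (\<Sum>l\<in>UNIV. c i m l * \<rho> l n x + c i n l * \<rho> m l x)"
proof -
  have "D i (\<rho> m n) x = D i (\<lambda>x. (\<Sum>k\<in>UNIV. D k (\<gamma> n m k) x) - (\<Sum>k\<in>UNIV. \<Sum>l\<in>UNIV. \<gamma> k m l x * \<gamma> l n k x)) x"
    using x \<rho>_eq' by (intro D_cong) auto
  also have "\<dots> = (\<Sum>k\<in>UNIV. D i (D k (\<gamma> n m k)) x) - (\<Sum>k\<in>UNIV. \<Sum>l\<in>UNIV. D i (\<gamma> k m l) x * \<gamma> l n k x + \<gamma> k m l x * D i (\<gamma> l n k) x)"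
    using x by (simp add: D_sum D_mult D_diff smooth_intros \<gamma>_smooth D_smooth)
  also have "(\<Sum>k\<in>UNIV. \<Sum>l\<in>UNIV. D i (\<gamma> k m l) x * \<gamma> l n k x + \<gamma> k m l x * D i (\<gamma> l n k) x)
    = (\<Sum>p\<in>UNIV. c i m p * (\<Sum>k\<in>UNIV. \<Sum>l\<in>UNIV. \<gamma> k p l x * \<gamma> l n k x) + c i n p * (\<Sum>k\<in>UNIV. \<Sum>l\<in>UNIV. \<gamma> k m l x * \<gamma> l p k x))"
    unfolding D_\<gamma>[OF x] by (simp add: sum_3 algebra_simps)
  finally show ?thesis unfolding D_rotate[OF x] \<rho>_eq'[OF x] by (simp add: sum_3 algebra_simps)
qed

lemma D_hi:
  assumes x: "x \<in> V"
  shows "D i (hi m n) x = - (\<Sum>l\<in>UNIV. hi m l x * c i l n + c i l m * hi l n x)"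
proof -
  have hi_sym: "hi k l x = hi l k x" for k l
    unfolding hi_def by (subst sum.swap) (simp add: gi_sym x mult.commute cong: sum.cong)
  have 1: "(\<Sum>l\<in>UNIV. h k l x * D i (hi l n) x) = - (\<Sum>l\<in>UNIV. D i (h k l) x * hi l n x)" for k
  proof -
    have "D i (\<lambda>x. \<Sum>l\<in>UNIV. h k l x * hi l n x) x = D i (\<lambda>x. if k = n then 1 else 0) x"
      using x h_hi by (intro D_cong) auto
    then show ?thesis using x by (simp add: D_const D_sum D_mult smooth_intros h_smooth hi_smooth sum.distrib)
  qed
  have "D i (hi m n) x = (\<Sum>l\<in>UNIV. (\<Sum>k\<in>UNIV. h l k x * hi k m x) * D i (hi l n) x)"
    using x by (simp add: h_hi sum_delta_mult)
  also have "\<dots> = (\<Sum>k\<in>UNIV. hi k m x * (\<Sum>l\<in>UNIV. h k l x * D i (hi l n) x))"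
    by (simp add: h_sym[OF x] sum_3 algebra_simps)
  also have "\<dots> = - (\<Sum>k\<in>UNIV. hi k m x * (\<Sum>l\<in>UNIV. D i (h k l) x * hi l n x))"
    by (simp add: 1 sum_negf)
  also have "\<dots> = - ((\<Sum>k\<in>UNIV. hi k m x * (\<Sum>p\<in>UNIV. c i k p * (\<Sum>l\<in>UNIV. h p l x * hi l n x)))
     + (\<Sum>l\<in>UNIV. (\<Sum>p\<in>UNIV. c i l p * (\<Sum>k\<in>UNIV. h p k x * hi k m x)) * hi l n x))"
    unfolding D_h[OF x] by (simp add: h_sym[OF x] sum_3 algebra_simps)
  also have "\<dots> = - ((\<Sum>k\<in>UNIV. hi k m x * c i k n) + (\<Sum>l\<in>UNIV. c i l m * hi l n x))"
    using x by (simp add: h_hi sum_delta_mult)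
  finally show ?thesis by (simp add: hi_sym[of _ m] sum.distrib)
qed

definition scal :: "real^3 \<Rightarrow> real" where
  "scal x = (\<Sum>a\<in>UNIV. \<Sum>b\<in>UNIV. gi a b x * Ric b a x)"

lemma scal_smooth: "smooth_on V scal"
  unfolding scal_def[abs_def] by (intro smooth_intros Ric_smooth)

lemma scal_eq: 
  assumes x: "x \<in> V"
  shows "scal x = (\<Sum>m\<in>UNIV. \<Sum>n\<in>UNIV. hi m n x * \<rho> n m x)"
proof -
  define u where "u a b = (\<Sum>m\<in>UNIV. X m a x * Xi m b x)" for a b
  define w where "w b m = (\<Sum>a\<in>UNIV. gi a b x * Xi m a x)" for b m
  define q where "q d m = (\<Sum>e\<in>UNIV. Ric d e x * X m e x)" for d m
  have u: "u a b = (if a = b then 1 else 0)" for a b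
    using x by (simp add: u_def X_Xi)
  have hi: "hi m n x = (\<Sum>b\<in>UNIV. w b m * Xi n b x)" for m n
    by (simp add: hi_def w_def sum_3 algebra_simps)
  have \<rho>: "\<rho> n m x = (\<Sum>d\<in>UNIV. X n d x * q d m)" for m n
    by (simp add: \<rho>_def q_def sum_3 algebra_simps)
  have "(\<Sum>n\<in>UNIV. hi m n x * \<rho> n m x) = (\<Sum>b\<in>UNIV. w b m * (\<Sum>d\<in>UNIV. u d b * q d m))" for m
    unfolding hi \<rho> u_def by (simp add: sum_3 algebra_simps)
  then have "(\<Sum>m\<in>UNIV. \<Sum>n\<in>UNIV. hi m n x * \<rho> n m x) = (\<Sum>m\<in>UNIV. \<Sum>b\<in>UNIV. w b m * q b m)"
    by (simp add: u sum_delta_mult)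
  also have "\<dots> = (\<Sum>a\<in>UNIV. \<Sum>b\<in>UNIV. gi a b x * (\<Sum>e\<in>UNIV. u e a * Ric b e x))"
    unfolding w_def q_def u_def by (simp add: sum_3 algebra_simps)
  also have "\<dots> = scal x" by (simp add: u sum_delta_mult scal_def)
  finally show ?thesis by simp
qed

text \<open>Lower and upper indices are acted on with opposite signs, so a full contraction is
  constant along the frame. Hence removing the trace preserves the invariance of the Ricci
  tensor.\<close>

lemma D_scal:
  assumes x: "x \<in> V"
  shows "D i scal x = 0"
proof -
  have "D i scal x = D i (\<lambda>x. \<Sum>m\<in>UNIV. \<Sum>n\<in>UNIV. hi m n x * \<rho> n m x) x"
    using x scal_eq by (intro D_cong) auto
  also have "\<dots> = (\<Sum>m\<in>UNIV. \<Sum>n\<in>UNIV. D i (hi m n) x * \<rho> n m x + hi m n x * D i (\<rho> n m) x)"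
    using x by (simp add: D_sum D_mult smooth_intros hi_smooth \<rho>_smooth)
  also have "\<dots> = 0"
    unfolding D_hi[OF x] D_\<rho>[OF x] by (simp add: sum_3 algebra_simps)
  finally show ?thesis .
qed

section \<open>The trace-free Ricci tensor and its covariant derivative\<close>

definition S :: "3 \<Rightarrow> 3 \<Rightarrow> real^3 \<Rightarrow> real" where
  "S a b x = Ric a b x - 1/3 * scal x * g a b x"

definition \<sigma> :: "3 \<Rightarrow> 3 \<Rightarrow> real^3 \<Rightarrow> real" where
  "\<sigma> m n x = (\<Sum>a\<in>UNIV. \<Sum>b\<in>UNIV. S a b x * (X m a x * X n b x))"

lemma S_smooth: "smooth_on V (S a b)"
  unfolding S_def[abs_def] by (intro smooth_intros Ric_smooth scal_smooth)

lemma \<sigma>_eq: "\<sigma> m n x = \<rho> m n x - 1/3 * scal x * h m n x"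
  by (simp add: \<sigma>_def S_def \<rho>_def h_def sum_3 field_simps)

lemma D_\<sigma>:
  assumes x: "x \<in> V"
  shows "D i (\<sigma> m n) x = (\<Sum>l\<in>UNIV. c i m l * \<sigma> l n x + c i n l * \<sigma> m l x)"
proof -
  have "D i (\<lambda>x. 1/3 * scal x) x = 0"
    using D_cmult[OF x scal_smooth, of i "1/3"] D_scal[OF x] by simp
  then have "D i (\<lambda>x. 1/3 * scal x * h m n x) x = 1/3 * scal x * D i (h m n) x"
    using D_mult[OF x, of "\<lambda>x. 1/3 * scal x" "h m n" i] smooth_intros(3)[OF smooth_intros(1)[of "1/3"] scal_smooth] h_smooth
    by simp
  moreover have "D i (\<sigma> m n) x = D i (\<rho> m n) x - D i (\<lambda>x. 1/3 * scal x * h m n x) x"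
    unfolding \<sigma>_eq[abs_def] using x by (intro D_diff smooth_intros \<rho>_smooth scal_smooth h_smooth)
  ultimately have "D i (\<sigma> m n) x = D i (\<rho> m n) x - 1/3 * scal x * D i (h m n) x"
    by simp
  then show ?thesis unfolding D_\<rho>[OF x] D_h[OF x] \<sigma>_eq by (simp add: sum_3 algebra_simps)
qed

definition nabS :: "3 \<Rightarrow> 3 \<Rightarrow> 3 \<Rightarrow> real^3 \<Rightarrow> real" where
  "nabS k i j x = pd k (S i j) x - (\<Sum>l\<in>UNIV. \<Gamma> l k i x * S l j x + \<Gamma> l k j x * S i l x)"

text \<open>Invariance gives the derivative of \<sigma> along \<open>X i\<close> through brackets.
  Writing a bracket as a difference of covariant derivatives cancels the terms with
  \<open>\<gamma> i m\<close> that the covariant derivative subtracts; what is left has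
  \<open>X i\<close> as the field being differentiated.\<close>

lemma nabS_frame:
  assumes x: "x \<in> V"
  shows "(\<Sum>k\<in>UNIV. \<Sum>a\<in>UNIV. \<Sum>b\<in>UNIV. X i k x * X m a x * X n b x * nabS k a b x)
    = - (\<Sum>l\<in>UNIV. \<gamma> m i l x * \<sigma> l n x + \<gamma> n i l x * \<sigma> m l x)"
proof -
  have "D i (\<sigma> m n) x = (\<Sum>a\<in>UNIV. \<Sum>b\<in>UNIV. D i (S a b) x * (X m a x * X n b x)
      + S a b x * (D i (X m a) x * X n b x + X m a x * D i (X n b) x))"
    unfolding \<sigma>_def[abs_def] using x by (simp add: D_sum D_mult smooth_intros S_smooth)
  then have "(\<Sum>k\<in>UNIV. \<Sum>a\<in>UNIV. \<Sum>b\<in>UNIV. X i k x * X m a x * X n b x * nabS k a b x)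
    = D i (\<sigma> m n) x - (\<Sum>a\<in>UNIV. \<Sum>b\<in>UNIV. S a b x * (Y i m a x * X n b x + X m a x * Y i n b x))"
    unfolding nabS_def Y_eq[OF x] by (simp add: D_def[of i "S _ _"] sum_3 algebra_simps)
  also have "\<dots> = D i (\<sigma> m n) x - (\<Sum>l\<in>UNIV. \<gamma> i m l x * \<sigma> l n x + \<gamma> i n l x * \<sigma> m l x)"
    unfolding Y_via_\<gamma>[OF x] \<sigma>_def by (simp add: sum_3 algebra_simps)
  finally show ?thesis unfolding D_\<sigma>[OF x] torsion[OF x, symmetric] by (simp add: sum_3 algebra_simps)
qed

end

section \<open>The invariants in an orthonormal frame\<close>

lemma matrix_ring_simps:
  fixes A B C :: "real^'n^'n"
  shows "A ** (B + C) = A ** B + A ** C" "(A + B) ** C = A ** C + B ** C"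
    "A ** (B - C) = A ** B - A ** C" "(A - B) ** C = A ** C - B ** C"
    "(k *\<^sub>R A) ** B = k *\<^sub>R (A ** B)" "A ** (k *\<^sub>R B) = k *\<^sub>R (A ** B)"
    "(- A) ** B = - (A ** B)" "A ** (- B) = - (A ** B)"
  by (simp_all add: vec_eq_iff matrix_matrix_mult_def sum.distrib sum_subtractf sum_negf sum_distrib_left
      sum_distrib_right algebra_simps)

lemma levi_civita_simps [simp]:
  "levi_civita 1 2 3 = 1" "levi_civita 2 3 1 = 1" "levi_civita 3 1 2 = 1"
  "levi_civita 1 3 2 = -1" "levi_civita 3 2 1 = -1" "levi_civita 2 1 3 = -1"
  "levi_civita i i j = 0" "levi_civita i j i = 0" "levi_civita j i i = 0"
  by (simp_all add: levi_civita_def det_3 axis_def)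

text \<open>
  The rows of \<open>m\<close> are the components of \<open>[\<xi> 2, \<xi> 3]\<close>, \<open>[\<xi> 3, \<xi> 1]\<close>, \<open>[\<xi> 1, \<xi> 2]\<close>, in this order.
\<close>

definition structure_const :: "real^3^3 \<Rightarrow> 3 \<Rightarrow> 3 \<Rightarrow> 3 \<Rightarrow> real" where
  "structure_const m i j k = (\<Sum>l\<in>UNIV. levi_civita i j l * m $ l $ k)"

text \<open>
  The Koszul formula for Killing fields that are orthonormal at the point: their inner products are
  not constant nearby, but their derivatives are given by the brackets.
\<close>

definition conn :: "(3 \<Rightarrow> 3 \<Rightarrow> 3 \<Rightarrow> real) \<Rightarrow> 3 \<Rightarrow> 3 \<Rightarrow> 3 \<Rightarrow> real" where
  "conn c n m k = (c n m k + c n k m + c m k n) / 2"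

definition frame_ricci :: "(3 \<Rightarrow> 3 \<Rightarrow> 3 \<Rightarrow> real) \<Rightarrow> real^3^3" where
  "frame_ricci c = (\<chi> m n. (\<Sum>k\<in>UNIV. \<Sum>l\<in>UNIV. c k n l * conn c l m k + c k m l * conn c n l k
      - conn c n m l * c k l k) - (\<Sum>k\<in>UNIV. \<Sum>l\<in>UNIV. conn c k m l * conn c l n k))"

text \<open>
  The symmetric part is \<open>diag(n1, n2, n3)\<close> and the skew part corresponds to a vector along the
  first axis; the Jacobi identity reduces to \<open>a * n1 = 0\<close>.
\<close>

definition bianchi_matrix :: "real \<Rightarrow> real \<Rightarrow> real \<Rightarrow> real \<Rightarrow> real^3^3" where
  "bianchi_matrix a n1 n2 n3 = vector [vector [n1, 0, 0], vector [0, n2, -a], vector [0, a, n3]]"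

text \<open>For \<open>a = 0\<close> this is Milnor's formula for a unimodular group. In general the
  first axis is still an eigenvector, and only the entry \<open>a * (n2 - n3)\<close> keeps the
  frame from being principal.\<close>

lemma frame_ricci_bianchi:
  assumes "a * n1 = 0"
  shows "frame_ricci (structure_const (bianchi_matrix a n1 n2 n3)) = vector [
    vector [(n1\<^sup>2 - (n2 - n3)\<^sup>2) / 2 - 2 * a\<^sup>2, 0, 0],
    vector [0, (n2\<^sup>2 - (n1 - n3)\<^sup>2) / 2 - 2 * a\<^sup>2, a * (n2 - n3)],
    vector [0, a * (n2 - n3), (n3\<^sup>2 - (n1 - n2)\<^sup>2) / 2 - 2 * a\<^sup>2]]"
proof -
  let ?c = "structure_const (bianchi_matrix a n1 n2 n3)"
  have c: "?c 1 2 1 = 0" "?c 1 2 2 = a" "?c 1 2 3 = n3" "?c 2 3 1 = n1" "?c 2 3 2 = 0" "?c 2 3 3 = 0"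
    "?c 3 1 1 = 0" "?c 3 1 2 = n2" "?c 3 1 3 = -a"
    "?c 2 1 1 = 0" "?c 2 1 2 = -a" "?c 2 1 3 = -n3" "?c 3 2 1 = -n1" "?c 3 2 2 = 0" "?c 3 2 3 = 0"
    "?c 1 3 1 = 0" "?c 1 3 2 = -n2" "?c 1 3 3 = a" "?c i i k = 0" for i k
    by (simp_all add: structure_const_def bianchi_matrix_def sum_3)
  define C where "C = ?c"
  note c = c[folded C_def]
  show ?thesis using assms
    apply (auto simp: frame_ricci_def C_def[symmetric] vec_eq_iff forall_3 conn_def c sum_3)
    by (simp_all add: power2_eq_square field_simps)
qed

text \<open>
  On an eigenvector of \<open>\<sigma>\<close> the last factor is the square of the difference of the other two
  eigenvalues. By the Cayley-Hamilton theorem the bracket in the definition of \<open>Z\<close> is its inverse,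
  up to the factor \<open>e\<close>, which is twice the discriminant.
\<close>

lemma frame_nabla:
  fixes \<sigma> z :: "real^3^3"
  assumes sym: "\<And>k l. \<sigma> $ k $ l = \<sigma> $ l $ k" and tr: "trace \<sigma> = 0"
    and B: "\<And>i k l. B i $ k $ l = (\<Sum>q\<in>UNIV. levi_civita k l q * z $ i $ q)"
  shows "(\<chi> i j. \<Sum>k\<in>UNIV. \<Sum>l\<in>UNIV. ((\<sigma> ** B i - B i ** \<sigma>) ** \<sigma>) $ k $ l * levi_civita l k j)
    = z ** ((2 * trace (\<sigma> ** \<sigma>)) *\<^sub>R mat 1 - 3 *\<^sub>R (\<sigma> ** \<sigma>))"
proof -
  have s3: "\<sigma> $ 3 $ 3 = - \<sigma> $ 1 $ 1 - \<sigma> $ 2 $ 2"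
    using tr by (simp add: trace_def sum_3)
  show ?thesis
    by (simp add: vec_eq_iff forall_3 matrix_matrix_mult_def sum_3 B s3 sym[of 2 1] sym[of 3 1] sym[of 3 2] trace_def mat_def)
      (simp add: algebra_simps)
qed

text \<open>Cayley-Hamilton for a trace-free 3 by 3 matrix reads
  \<open>\<sigma>^3 = (s/2) * \<sigma> + t/3\<close>. It reduces the product in the first part to a
  multiple of the identity. The second part is the characteristic polynomial, whose discriminant is
  half of \<open>s^3 - 6 * t^2\<close>.\<close>

lemma traceless_identity:
  fixes \<sigma> :: "real^3^3"
  assumes tr: "trace \<sigma> = 0"
  defines "s \<equiv> trace (\<sigma> ** \<sigma>)" and "t \<equiv> trace (\<sigma> ** \<sigma> ** \<sigma>)"
  shows "((2 * s) *\<^sub>R mat 1 - 3 *\<^sub>R (\<sigma> ** \<sigma>)) ** ((3 * s) *\<^sub>R (\<sigma> ** \<sigma>) + (6 * t) *\<^sub>R \<sigma> + (1/2 * s\<^sup>2) *\<^sub>R mat 1)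
    = (s^3 - 6 * t\<^sup>2) *\<^sub>R mat 1"
    and "det (\<sigma> - \<mu> *\<^sub>R mat 1) = - (\<mu>^3) + s/2 * \<mu> + t/3"
proof -
  have s3: "\<sigma> $ 3 $ 3 = - \<sigma> $ 1 $ 1 - \<sigma> $ 2 $ 2"
    using tr by (simp add: trace_def sum_3)
  have cayley: "\<sigma> ** \<sigma> ** \<sigma> = (s/2) *\<^sub>R \<sigma> + (t/3) *\<^sub>R mat 1"
    unfolding s_def t_def
    by (simp add: vec_eq_iff forall_3 matrix_matrix_mult_def sum_3 s3 trace_def mat_def field_simps)
  define s2 where "s2 = \<sigma> ** \<sigma>"
  have 1: "s2 ** \<sigma> = (s/2) *\<^sub>R \<sigma> + (t/3) *\<^sub>R mat 1" using cayley by (simp add: s2_def)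
  have 2: "s2 ** s2 = (s/2) *\<^sub>R s2 + (t/3) *\<^sub>R \<sigma>"
    unfolding s2_def matrix_mul_assoc cayley
    by (simp add: matrix_ring_simps s2_def)
  show "((2 * s) *\<^sub>R mat 1 - 3 *\<^sub>R (\<sigma> ** \<sigma>)) ** ((3 * s) *\<^sub>R (\<sigma> ** \<sigma>) + (6 * t) *\<^sub>R \<sigma> + (1/2 * s\<^sup>2) *\<^sub>R mat 1)
    = (s^3 - 6 * t\<^sup>2) *\<^sub>R mat 1"
    unfolding s2_def[symmetric]
    by (simp add: matrix_ring_simps 1 2 matrix_mul_assoc[symmetric])
     (simp add: algebra_simps vec_eq_iff power2_eq_square power3_eq_cube)
  show "det (\<sigma> - \<mu> *\<^sub>R mat 1) = - (\<mu>^3) + s/2 * \<mu> + t/3"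
    unfolding s_def t_def
    by (simp add: det_3 matrix_matrix_mult_def sum_3 s3 trace_def mat_def power2_eq_square power3_eq_cube field_simps)
qed


text \<open>Each connection matrix is skew, hence dual to a vector. These vectors are the rows of
  \<open>M\<close> transposed minus half its trace, the matrix that \<open>Z\<close>
  recovers.\<close>

lemma conn_bianchi:
  "conn (structure_const M) m i l = (\<Sum>q\<in>UNIV. levi_civita m l q * (transpose M - (trace M / 2) *\<^sub>R mat 1) $ i $ q)"
proof -
  have "\<forall>m i l. conn (structure_const M) m i l = (\<Sum>q\<in>UNIV. levi_civita m l q * (transpose M - (trace M / 2) *\<^sub>R mat 1) $ i $ q)"
    by (simp add: forall_3 sum_3 conn_def structure_const_def trace_def transpose_def mat_def field_simps)
  then show ?thesis by blast
qed

lemma levi_civita_det: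
  fixes X :: "real^3^3"
  shows "(\<Sum>l\<in>UNIV. \<Sum>m\<in>UNIV. \<Sum>n\<in>UNIV. X $ l $ p * X $ m $ q * X $ n $ r * levi_civita l m n)
    = det X * levi_civita p q r"
proof -
  have "\<forall>p q r. (\<Sum>l\<in>UNIV. \<Sum>m\<in>UNIV. \<Sum>n\<in>UNIV. X $ l $ p * X $ m $ q * X $ n $ r * levi_civita l m n)
    = det X * levi_civita p q r"
    by (simp add: forall_3 sum_3 det_3 algebra_simps)
  then show ?thesis by blast
qed

lemma matrix_inv_unique:
  fixes A B :: "real^'n^'n"
  assumes "A ** B = mat 1" "B ** A = mat 1"
  shows "matrix_inv A = B"
proof -
  have "\<exists>C. A ** C = mat 1 \<and> C ** A = mat 1" using assms by blast
  then have 1: "A ** matrix_inv A = mat 1" unfolding matrix_inv_def by (rule someI2_ex) blast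
  have "matrix_inv A = B ** A ** matrix_inv A" using assms by simp
  also have "\<dots> = B" unfolding matrix_mul_assoc[symmetric] 1 by simp
  finally show ?thesis .
qed

section \<open>From chart components to components in an oriented orthonormal frame\<close>

locale on_frame =
  fixes G X :: "real^3^3"
  assumes ON: "transpose X ** G ** X = mat 1" and det_X: "det X > 0"
begin

text \<open>Components of a covariant 2-tensor in the frame formed by the columns of
  \<open>X\<close>. Since the inverse metric is \<open>X ** transpose X\<close>, contraction with it
  becomes the matrix product, and \<open>ttr\<close> the ordinary trace.\<close>

definition F :: "real^3^3 \<Rightarrow> real^3^3" where "F A = transpose X ** A ** X"

lemma inverse_frame: "X ** (transpose X ** G) = mat 1" "G ** (X ** transpose X) = mat 1"
  "X ** transpose X ** G = mat 1" "(G ** X) ** transpose X = mat 1" "transpose X ** (G ** X) = mat 1"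
proof -
  show 1: "transpose X ** (G ** X) = mat 1" using ON by (simp add: matrix_mul_assoc)
  show 2: "X ** (transpose X ** G) = mat 1" using ON matrix_left_right_inverse by metis
  then show "X ** transpose X ** G = mat 1" by (simp add: matrix_mul_assoc)
  then show "G ** (X ** transpose X) = mat 1" using matrix_left_right_inverse by metis
  then show "(G ** X) ** transpose X = mat 1" by (simp add: matrix_mul_assoc)
qed

lemma inv_G: "matrix_inv G = X ** transpose X"
  using inverse_frame by (intro matrix_inv_unique) auto

lemma F_linear: "F (A + B) = F A + F B" "F (A - B) = F A - F B" "F (k *\<^sub>R A) = k *\<^sub>R F A"
  "F (transpose A) = transpose (F A)" "F G = mat 1"
  using ON by (simp_all add: F_def matrix_ring_simps matrix_transpose_mul matrix_mul_assoc transpose_transpose)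

lemma ttr_F: "ttr G A = trace (F A)"
  unfolding ttr_def inv_G F_def by (metis matrix_mul_assoc trace_mul_sym)

lemma tdot_F: "F (tdot G A B) = F A ** F B"
  by (simp add: tdot_def inv_G F_def matrix_mul_assoc)

lemma tsquare_F: "F (tsquare G A) = F A ** F A"
  by (simp add: tsquare_def tdot_F)

lemma tcube_F: "F (tcube G A) = F A ** F A ** F A"
  by (simp add: tcube_def tdot_F tsquare_F)

lemma F_eq_0: "transpose X *v a = 0 \<longleftrightarrow> a = 0"
proof
  assume "transpose X *v a = 0"
  then have "((G ** X) ** transpose X) *v a = 0" by (simp flip: matrix_vector_mul_assoc)
  then show "a = 0" unfolding inverse_frame by simp
qed simp

text \<open>Positivity of \<open>det X\<close> fixes the sign of the root: the frame agrees with the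
  orientation, so the volume form has the components \<open>levi_civita\<close> in it.\<close>

lemma sqrt_det_G: "sqrt (det G) * det X = 1"
proof -
  have "(det X)\<^sup>2 * det G = 1"
    using arg_cong[OF ON, of det] by (simp add: det_mul power2_eq_square mult_ac)
  then have "det G = (1 / det X)\<^sup>2" using det_X by (simp add: field_simps)
  then show ?thesis using det_X by (simp add: real_sqrt_divide)
qed

lemma volume_form_raised_frame:
  "volume_form_raised G i j k = (\<Sum>p\<in>UNIV. \<Sum>q\<in>UNIV. \<Sum>r\<in>UNIV. X $ i $ p * X $ j $ q * X $ k $ r * levi_civita p q r)"
proof -
  have inv: "matrix_inv G $ a $ b = (\<Sum>p\<in>UNIV. X $ a $ p * X $ b $ p)" for a b
    by (simp add: inv_G matrix_matrix_mult_def transpose_def)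
  have "volume_form_raised G i j k = sqrt (det G) * (\<Sum>p\<in>UNIV. \<Sum>q\<in>UNIV. \<Sum>r\<in>UNIV. X $ i $ p * X $ j $ q * X $ k $ r *
      (\<Sum>l\<in>UNIV. \<Sum>m\<in>UNIV. \<Sum>n\<in>UNIV. X $ l $ p * X $ m $ q * X $ n $ r * levi_civita l m n))"
    unfolding volume_form_raised_def volume_form_def inv
    by (simp add: sum_3) (simp add: algebra_simps)
  also have "\<dots> = (sqrt (det G) * det X) * (\<Sum>p\<in>UNIV. \<Sum>q\<in>UNIV. \<Sum>r\<in>UNIV. X $ i $ p * X $ j $ q * X $ k $ r * levi_civita p q r)"
    unfolding levi_civita_det by (simp add: sum_distrib_left mult_ac)
  finally show ?thesis unfolding sqrt_det_G by simp
qed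

lemma a_form_frame:
  assumes "g c p = G"
  shows "(transpose X *v a_form g c p) $ i = - 1/2 * (\<Sum>q\<in>UNIV. \<Sum>r\<in>UNIV. levi_civita i q r * F (Z_tensor g c p) $ q $ r)"
proof -
  let ?Z = "Z_tensor g c p"
  have up: "(\<Sum>l\<in>UNIV. \<Sum>m\<in>UNIV. matrix_inv G $ j $ l * matrix_inv G $ k $ m * ?Z $ l $ m)
      = (\<Sum>q\<in>UNIV. \<Sum>r\<in>UNIV. X $ j $ q * X $ k $ r * F ?Z $ q $ r)" for j k
  proof -
    have tr: "transpose (matrix_inv G) = matrix_inv G"
      by (simp add: inv_G matrix_transpose_mul transpose_transpose)
    have "(\<Sum>l\<in>UNIV. \<Sum>m\<in>UNIV. matrix_inv G $ j $ l * matrix_inv G $ k $ m * ?Z $ l $ m)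
      = (matrix_inv G ** ?Z ** transpose (matrix_inv G)) $ j $ k"
      by (simp add: matrix_matrix_mult_def transpose_def sum_3 algebra_simps)
    also have "matrix_inv G ** ?Z ** transpose (matrix_inv G) = X ** F ?Z ** transpose X"
      unfolding tr by (simp add: inv_G F_def matrix_mul_assoc)
    finally show ?thesis by (simp add: matrix_matrix_mult_def transpose_def sum_3 algebra_simps)
  qed
  define k :: real where "k = - 1/2"
  have "(transpose X *v a_form g c p) $ i = k * sqrt (det G) * (\<Sum>q\<in>UNIV. \<Sum>r\<in>UNIV. F ?Z $ q $ r *
      (\<Sum>l\<in>UNIV. \<Sum>j\<in>UNIV. \<Sum>k\<in>UNIV. X $ l $ i * X $ j $ q * X $ k $ r * levi_civita l j k))"
    unfolding a_form_def assms up volume_form_def k_def[symmetric]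
    by (simp add: matrix_vector_mult_def transpose_def sum_3) (simp add: algebra_simps)
  also have "\<dots> = k * (sqrt (det G) * det X) * (\<Sum>q\<in>UNIV. \<Sum>r\<in>UNIV. levi_civita i q r * F ?Z $ q $ r)"
    unfolding levi_civita_det by (simp add: sum_distrib_left mult_ac)
  finally show ?thesis unfolding sqrt_det_G k_def by simp
qed

text \<open>The lower index of \<open>K\<close> passes to the frame by \<open>transpose X\<close>,
  the upper one by its inverse; moving the inverse to the other side gives the equation.
  \<open>That i\<close> is the frame matrix of the derivative of \<open>S\<close> in the direction
  of the frame vector \<open>i\<close>.\<close>

lemma K_frame:
  assumes "g c p = G" and "F (traceless_ricci g c p) = \<sigma>"
    and T: "\<And>i. That i = (\<Sum>a\<in>UNIV. X $ a $ i *\<^sub>R F (\<chi> k b. cov_deriv g (traceless_ricci g) c p a k b))"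
  shows "transpose X ** K_mixed g c p
    = (\<chi> i j. \<Sum>k\<in>UNIV. \<Sum>l\<in>UNIV. (That i ** \<sigma>) $ k $ l * levi_civita l k j) ** transpose X"
proof -
  define nS where "nS a = (\<chi> k l. nabla_S_dot_S g c p a k l)" for a
  have nS: "nS a = (\<chi> k b. cov_deriv g (traceless_ricci g) c p a k b) ** matrix_inv G ** traceless_ricci g c p" for a
    by (simp add: nS_def nabla_S_dot_S_def assms vec_eq_iff matrix_matrix_mult_def sum_distrib_right)
  have "F (nS a) = F (\<chi> k b. cov_deriv g (traceless_ricci g) c p a k b) ** \<sigma>" for a
    unfolding assms(2)[symmetric] by (simp add: nS inv_G F_def matrix_mul_assoc)
  then have *: "That i ** \<sigma> = (\<Sum>a\<in>UNIV. X $ a $ i *\<^sub>R F (nS a))" for i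
    by (simp add: T sum_3 matrix_ring_simps)
  have K: "K_mixed g c p $ i $ j = (\<Sum>r\<in>UNIV. (\<Sum>k\<in>UNIV. \<Sum>l\<in>UNIV. F (nS i) $ k $ l * levi_civita l k r) * X $ j $ r)" for i j
  proof -
    have FnS: "(\<Sum>k\<in>UNIV. \<Sum>l\<in>UNIV. X $ k $ q * nS i $ k $ l * X $ l $ s) = F (nS i) $ q $ s" for q s
      by (simp add: F_def matrix_matrix_mult_def transpose_def sum_3 algebra_simps)
    have "K_mixed g c p $ i $ j = (\<Sum>k\<in>UNIV. \<Sum>l\<in>UNIV. nS i $ k $ l * volume_form_raised G l k j)"
      by (simp add: K_mixed_def nS_def assms)
    also have "\<dots> = (\<Sum>r\<in>UNIV. (\<Sum>q\<in>UNIV. \<Sum>s\<in>UNIV. (\<Sum>k\<in>UNIV. \<Sum>l\<in>UNIV. X $ k $ q * nS i $ k $ l * X $ l $ s) * levi_civita s q r) * X $ j $ r)"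
      unfolding volume_form_raised_frame by (simp add: sum_3) (simp add: algebra_simps)
    finally show ?thesis unfolding FnS .
  qed
  show ?thesis unfolding vec_eq_iff * 
    by (simp add: matrix_matrix_mult_def transpose_def K sum_3) (simp add: algebra_simps)
qed

text \<open>The Ricci eigenvalues, shifted by a third of the trace, are three distinct roots of the
  characteristic polynomial of \<sigma>, and \<open>e\<close> is twice its discriminant.\<close>

lemma e_nonzero:
  assumes g: "g c p = G"
    and gen: "card {\<mu>. \<exists>v. v \<noteq> 0 \<and> ricci g c p *v v = \<mu> *\<^sub>R (g c p *v v)} = 3"
  shows "inv_e g c p \<noteq> 0"
proof -
  define \<sigma> where "\<sigma> = F (traceless_ricci g c p)"
  define r where "r = ttr G (ricci g c p)"
  have \<sigma>: "\<sigma> = F (ricci g c p) - (1/3 * r) *\<^sub>R mat 1"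
    by (simp add: \<sigma>_def traceless_ricci_def g F_linear r_def)
  have tr: "trace \<sigma> = 0"
    by (simp add: \<sigma> r_def ttr_F trace_def mat_def sum_3 field_simps)
  define s where "s = trace (\<sigma> ** \<sigma>)"
  define t where "t = trace (\<sigma> ** \<sigma> ** \<sigma>)"
  have e: "inv_e g c p = s^3 - 6 * t\<^sup>2"
    by (simp add: inv_e_def inv_s_def inv_t_def g ttr_F tsquare_F tcube_F s_def t_def \<sigma>_def)
  have root: "(\<mu> - r/3)^3 = s/2 * (\<mu> - r/3) + t/3"
    if v: "v \<noteq> 0" "ricci g c p *v v = \<mu> *\<^sub>R (g c p *v v)" for \<mu> v
  proof -
    define w where "w = (transpose X ** G) *v v"
    have w: "v = X *v w"
      using arg_cong[OF inverse_frame(1), of "\<lambda>M. M *v v"] by (simp add: w_def matrix_vector_mul_assoc)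
    have "transpose X *v (ricci g c p *v v) = \<mu> *\<^sub>R (transpose X *v (G *v v))"
      by (simp add: v g matrix_vector_mult_scaleR)
    then have "F (ricci g c p) *v w = \<mu> *\<^sub>R w"
      by (simp add: w F_def matrix_vector_mul_assoc matrix_mul_assoc ON)
    then have "(\<sigma> - (\<mu> - r/3) *\<^sub>R mat 1) *v w = 0"
      by (simp add: \<sigma> matrix_vector_mult_diff_rdistrib scaleR_matrix_vector_assoc[symmetric] algebra_simps)
    moreover have "w \<noteq> 0" using v w by auto
    ultimately have "det (\<sigma> - (\<mu> - r/3) *\<^sub>R mat 1) = 0"
      by (metis invertible_det_nz invertible_def matrix_vector_mul_assoc matrix_vector_mul_lid matrix_vector_mult_0_right)
    then show ?thesis
      using traceless_identity(2)[OF tr, of "\<mu> - r/3"] by (simp add: s_def t_def)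
  qed
  obtain x y z where "{\<mu>. \<exists>v. v \<noteq> 0 \<and> ricci g c p *v v = \<mu> *\<^sub>R (g c p *v v)} = {x, y, z}"
    and d: "x \<noteq> y" "x \<noteq> z" "y \<noteq> z"
    using gen unfolding card_3_iff by blast
  then have "\<exists>v. v \<noteq> 0 \<and> ricci g c p *v v = \<mu> *\<^sub>R (g c p *v v)" if "\<mu> \<in> {x, y, z}" for \<mu>
    using that by auto
  then have roots: "(\<mu> - r/3)^3 = s/2 * (\<mu> - r/3) + t/3" if "\<mu> \<in> {x, y, z}" for \<mu>
    using root that by meson
  define a where "a = x - r/3"
  define b where "b = y - r/3"
  define d where "d = z - r/3"
  have abd: "a^3 = s/2 * a + t/3" "b^3 = s/2 * b + t/3" "d^3 = s/2 * d + t/3"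
    using roots by (auto simp: a_def b_def d_def)
  have ne: "a \<noteq> b" "a \<noteq> d" "b \<noteq> d" using d by (auto simp: a_def b_def d_def)
  \<comment> \<open>Subtracting the equations of two distinct roots and dividing by their difference
    gives a quadratic relation; two such relations show that the roots sum to zero.\<close>
  have "(a - b) * (a\<^sup>2 + a * b + b\<^sup>2 - s/2) = 0"
    using abd by (simp add: power2_eq_square power3_eq_cube field_simps)
  then have ab: "s = 2 * (a\<^sup>2 + a * b + b\<^sup>2)" using ne by simp
  have "(a - d) * (a\<^sup>2 + a * d + d\<^sup>2 - s/2) = 0"
    using abd by (simp add: power2_eq_square power3_eq_cube field_simps)
  then have ad: "s = 2 * (a\<^sup>2 + a * d + d\<^sup>2)" using ne by simp
  have "(b - d) * (a + b + d) = 0"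
    using ab ad by (simp add: power2_eq_square algebra_simps)
  then have dd: "d = - a - b" using ne by simp
  have t: "t = - 3 * a * b * (a + b)"
    using abd(1) unfolding ab by (simp add: power2_eq_square power3_eq_cube field_simps)
  have "s^3 - 6 * t\<^sup>2 = 2 * ((a - b) * (a - d) * (b - d))\<^sup>2"
    unfolding t ab dd by (simp add: power2_eq_square power3_eq_cube algebra_simps)
  then show ?thesis using ne e by simp
qed

text \<open>The hypothesis \<open>nabla\<close> makes each frame matrix of the derivative of
  \<open>S\<close> the commutator of \<sigma> with a connection matrix \<open>B i\<close>.
  Multiplying by \<sigma> and contracting with the volume form leaves \<open>z\<close> times
  \<open>2 * s - 3 * \<sigma>^2\<close>; the polynomial in the definition of \<open>Z\<close>,
  divided by \<open>e\<close>, inverts this factor.\<close>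

lemma N_frame:
  assumes g: "g c p = G"
    and e: "inv_e g c p \<noteq> 0"
    and sym: "transpose (F (ricci g c p)) = F (ricci g c p)"
    and nabla: "\<And>i m n. (\<Sum>k\<in>UNIV. \<Sum>a\<in>UNIV. \<Sum>b\<in>UNIV. X $ k $ i * X $ a $ m * X $ b $ n
          * cov_deriv g (traceless_ricci g) c p k a b)
      = - (\<Sum>l\<in>UNIV. conn (structure_const M) m i l * F (traceless_ricci g c p) $ l $ n
           + conn (structure_const M) n i l * F (traceless_ricci g c p) $ m $ l)"
  shows "F (N_tensor g c p) = (1/2) *\<^sub>R (M + transpose M)"
    and "(transpose X *v a_form g c p) $ i = 1/2 * (\<Sum>q\<in>UNIV. \<Sum>r\<in>UNIV. levi_civita i q r * M $ q $ r)"
proof -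
  define \<sigma> where "\<sigma> = F (traceless_ricci g c p)"
  define z where "z = transpose M - (trace M / 2) *\<^sub>R mat 1"
  define B :: "3 \<Rightarrow> real^3^3" where "B i = (\<chi> k l. \<Sum>q\<in>UNIV. levi_civita k l q * z $ i $ q)" for i
  have \<sigma>: "\<sigma> = F (ricci g c p) - (1/3 * ttr G (ricci g c p)) *\<^sub>R mat 1"
    by (simp add: \<sigma>_def traceless_ricci_def g F_linear)
  have tr: "trace \<sigma> = 0"
    by (simp add: \<sigma> ttr_F trace_def mat_def sum_3 field_simps)
  have \<sigma>_sym: "\<sigma> $ k $ l = \<sigma> $ l $ k" for k l
  proof -
    have "transpose (F (ricci g c p)) $ k $ l = F (ricci g c p) $ k $ l" using sym by simp
    then show ?thesis by (simp add: \<sigma> transpose_def mat_def)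
  qed
  have B: "conn (structure_const M) m i l = B i $ m $ l" for m i l
    unfolding conn_bianchi B_def z_def by simp
  have B_anti: "B i $ m $ l = - B i $ l $ m" for i m l
  proof -
    have "\<forall>i m l. B i $ m $ l = - B i $ l $ m"
      by (simp add: B_def forall_3 sum_3)
    then show ?thesis by blast
  qed
  define That where "That i = \<sigma> ** B i - B i ** \<sigma>" for i
  have T: "That i = (\<Sum>a\<in>UNIV. X $ a $ i *\<^sub>R F (\<chi> k b. cov_deriv g (traceless_ricci g) c p a k b))" for i
  proof -
    have "That i $ m $ n = (\<Sum>a\<in>UNIV. X $ a $ i *\<^sub>R F (\<chi> k b. cov_deriv g (traceless_ricci g) c p a k b)) $ m $ n" for m n
    proof -
      have "(\<Sum>a\<in>UNIV. X $ a $ i *\<^sub>R F (\<chi> k b. cov_deriv g (traceless_ricci g) c p a k b)) $ m $ n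
         = (\<Sum>k\<in>UNIV. \<Sum>a\<in>UNIV. \<Sum>b\<in>UNIV. X $ k $ i * X $ a $ m * X $ b $ n
          * cov_deriv g (traceless_ricci g) c p k a b)"
        by (simp add: F_def matrix_matrix_mult_def transpose_def sum_3) (simp add: algebra_simps)
      also have "\<dots> = - (\<Sum>l\<in>UNIV. B i $ m $ l * \<sigma> $ l $ n + B i $ n $ l * \<sigma> $ m $ l)"
        unfolding nabla B \<sigma>_def ..
      also have "\<dots> = That i $ m $ n"
        unfolding That_def by (simp add: matrix_matrix_mult_def sum.distrib sum_negf sum_subtractf B_anti[of i n] mult.commute[of _ "\<sigma> $ m $ _"])
      finally show ?thesis by simp
    qed
    then show ?thesis by (simp add: vec_eq_iff)
  qed
  define s where "s = trace (\<sigma> ** \<sigma>)"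
  define t where "t = trace (\<sigma> ** \<sigma> ** \<sigma>)"
  have st: "inv_s g c p = s" "inv_t g c p = t"
    by (simp_all add: inv_s_def inv_t_def g ttr_F tsquare_F tcube_F s_def t_def \<sigma>_def)
  then have e': "s^3 - 6 * t\<^sup>2 = inv_e g c p" by (simp add: inv_e_def)
  define W where "W = (3 * s) *\<^sub>R tsquare G (traceless_ricci g c p) + (6 * t) *\<^sub>R traceless_ricci g c p
      + (1/2 * s\<^sup>2) *\<^sub>R G"
  have W: "F W = (3 * s) *\<^sub>R (\<sigma> ** \<sigma>) + (6 * t) *\<^sub>R \<sigma> + (1/2 * s\<^sup>2) *\<^sub>R mat 1"
    by (simp add: W_def F_linear tsquare_F \<sigma>_def)
  have "F (Z_tensor g c p) = (1 / inv_e g c p) *\<^sub>R ((transpose X ** K_mixed g c p) ** W ** X)"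
    by (simp add: Z_tensor_def st g W_def F_linear F_def[of "K_mixed g c p ** _"] matrix_mul_assoc matrix_ring_simps)
  also have "(transpose X ** K_mixed g c p) ** W ** X
    = z ** (((2 * s) *\<^sub>R mat 1 - 3 *\<^sub>R (\<sigma> ** \<sigma>)) ** F W)"
    unfolding K_frame[where g = g and c = c and p = p, OF g \<sigma>_def[symmetric] T] That_def
    by (subst frame_nabla[OF \<sigma>_sym tr, of B z]) (simp_all add: B_def s_def F_def matrix_mul_assoc)
  also have "\<dots> = inv_e g c p *\<^sub>R z"
    unfolding W s_def t_def traceless_identity(1)[OF tr]
    by (simp add: matrix_ring_simps e'[unfolded s_def t_def])
  finally have Z: "F (Z_tensor g c p) = z" using e by simp
  \<comment> \<open>The trace term in \<open>N\<close> undoes the shift of \<open>z\<close> by half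
    the trace of \<open>M\<close>: symmetrizing \<open>z\<close> and subtracting its trace leaves
    exactly the symmetric part of \<open>M\<close>.\<close>
  have trz: "trace z = - trace M / 2"
    by (simp add: z_def trace_def transpose_def mat_def sum_3 field_simps)
  show "F (N_tensor g c p) = (1/2) *\<^sub>R (M + transpose M)"
    unfolding N_tensor_def g F_linear ttr_F Z trz
    by (simp add: z_def vec_eq_iff transpose_def mat_def field_simps)
  \<comment> \<open>\<open>z\<close> contains \<open>M\<close> transposed, which reverses the skew
    part and so absorbs the minus sign in \<open>a_form\<close>.\<close>
  have *: "(\<Sum>q\<in>UNIV. \<Sum>r\<in>UNIV. levi_civita i q r * z $ q $ r) = - (\<Sum>q\<in>UNIV. \<Sum>r\<in>UNIV. levi_civita i q r * M $ q $ r)"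
  proof -
    have "\<forall>i. (\<Sum>q\<in>UNIV. \<Sum>r\<in>UNIV. levi_civita i q r * z $ q $ r) = - (\<Sum>q\<in>UNIV. \<Sum>r\<in>UNIV. levi_civita i q r * M $ q $ r)"
      by (simp add: z_def forall_3 sum_3 transpose_def mat_def)
    then show ?thesis by blast
  qed
  show "(transpose X *v a_form g c p) $ i = 1/2 * (\<Sum>q\<in>UNIV. \<Sum>r\<in>UNIV. levi_civita i q r * M $ q $ r)"
    unfolding a_form_frame[where g = g and c = c and p = p, OF g] Z * by simp
qed

text \<open>Newton's identities: the trace expressions are the elementary symmetric polynomials in
  the eigenvalues of \<open>N\<close>.\<close>

lemma nu_frame:
  assumes g: "g c p = G" and N: "F (N_tensor g c p) = vector [vector [n1, 0, 0], vector [0, n2, 0], vector [0, 0, n3]]"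
  shows "nu1 g c p = n1 + n2 + n3" "nu2 g c p = n1 * n2 + n1 * n3 + n2 * n3" "nu3 g c p = n1 * n2 * n3"
  by (simp_all add: nu1_def nu2_def nu3_def g ttr_F tsquare_F tcube_F N trace_def sum_3 matrix_matrix_mult_def
      power2_eq_square power3_eq_cube field_simps)

text \<open>Twice the product of the squared eigenvalue differences: the factor
  \<open>(\<beta> - \<epsilon>)^2 + 4 * \<delta>^2\<close> is the discriminant of the lower block,
  and \<open>(\<alpha> - \<beta>) * (\<alpha> - \<epsilon>) - \<delta>^2\<close> its characteristic
  polynomial at \<alpha>.\<close>

lemma inv_e_block:
  assumes g: "g c p = G"
    and R: "F (ricci g c p) = vector [vector [\<alpha>, 0, 0], vector [0, \<beta>, \<delta>], vector [0, \<delta>, \<epsilon>]]"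
  shows "inv_e g c p = 2 * ((\<beta> - \<epsilon>)\<^sup>2 + 4 * \<delta>\<^sup>2) * ((\<alpha> - \<beta>) * (\<alpha> - \<epsilon>) - \<delta>\<^sup>2)\<^sup>2"
proof -
  define r where "r = (\<alpha> + \<beta> + \<epsilon>) / 3"
  define x where "x = \<alpha> - r"
  define y where "y = \<beta> - r"
  have eq: "\<alpha> = x + r" "\<beta> = y + r" "\<epsilon> = - x - y + r"
    by (simp_all add: x_def y_def r_def field_simps)
  have "F (traceless_ricci g c p) = vector [vector [x, 0, 0], vector [0, y, \<delta>], vector [0, \<delta>, - x - y]]"
    unfolding traceless_ricci_def g F_linear ttr_F R
    by (simp add: trace_def sum_3 vec_eq_iff forall_3 mat_def eq field_simps)
  then have st: "inv_s g c p = 2 * (x\<^sup>2 + y\<^sup>2 + x * y + \<delta>\<^sup>2)" "inv_t g c p = 3 * x * (- \<delta>\<^sup>2 - x * y - y\<^sup>2)"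
    by (simp_all add: inv_s_def inv_t_def g ttr_F tsquare_F tcube_F trace_def sum_3 matrix_matrix_mult_def
      power2_eq_square algebra_simps)
  show ?thesis unfolding inv_e_def eq st
    by (simp add: power2_eq_square power3_eq_cube algebra_simps)
qed

text \<open>For these Lie algebras two Ricci eigenvalues coincide.\<close>

lemma bianchi_degenerate:
  assumes g: "g c p = G" and e: "inv_e g c p \<noteq> 0"
    and R: "F (ricci g c p) = frame_ricci (structure_const (bianchi_matrix a n1 n2 n3))" and a: "a * n1 = 0"
  shows "\<not> (n1 = 0 \<and> n2 * n3 = - a\<^sup>2)" "\<not> (n1 = 0 \<and> n2 = 0 \<and> n3 = 0)"
    "a = 0 \<Longrightarrow> \<not> (n1 = 0 \<and> n2 = 0)" "a = 0 \<Longrightarrow> \<not> (n1 = 0 \<and> n3 = 0)" "a = 0 \<Longrightarrow> \<not> (n2 = 0 \<and> n3 = 0)"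
proof -
  note R = R[unfolded frame_ricci_bianchi[OF a]]
  note E = inv_e_block[where g = g and c = c and p = p, OF g R]
  show "\<not> (n1 = 0 \<and> n2 * n3 = - a\<^sup>2)"
  proof
    assume *: "n1 = 0 \<and> n2 * n3 = - a\<^sup>2"
    \<comment> \<open>The off-diagonal Ricci entry is \<open>a * (n2 - n3)\<close>, so the second
      factor of \<open>E\<close> becomes \<open>- ((n2 - n3)^2 * (n2 * n3 + a^2))\<close>, which
      vanishes.\<close>
    have "((n1\<^sup>2 - (n2 - n3)\<^sup>2) / 2 - 2 * a\<^sup>2 - ((n2\<^sup>2 - (n1 - n3)\<^sup>2) / 2 - 2 * a\<^sup>2)) *
        ((n1\<^sup>2 - (n2 - n3)\<^sup>2) / 2 - 2 * a\<^sup>2 - ((n3\<^sup>2 - (n1 - n2)\<^sup>2) / 2 - 2 * a\<^sup>2))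
      = - ((n2 - n3)\<^sup>2 * (n2 * n3))"
      using conjunct1[OF *] by (simp add: power2_eq_square field_simps)
    then show False using E e * by (simp add: power_mult_distrib mult.commute)
  qed
  show "\<not> (n1 = 0 \<and> n2 = 0 \<and> n3 = 0)" "a = 0 \<Longrightarrow> \<not> (n1 = 0 \<and> n2 = 0)"
    "a = 0 \<Longrightarrow> \<not> (n1 = 0 \<and> n3 = 0)" "a = 0 \<Longrightarrow> \<not> (n2 = 0 \<and> n3 = 0)"
    using E e by auto
qed

end

section \<open>Charts and changes of basis\<close>

lemma Ck_on_subset: "Ck_on k V f \<Longrightarrow> W \<subseteq> V \<Longrightarrow> Ck_on k W f"
  by (induction k arbitrary: f) (auto intro: continuous_on_subset differentiable_on_subset)

lemma smooth_on_subset: "smooth_on V f \<Longrightarrow> W \<subseteq> V \<Longrightarrow> smooth_on W f"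
  unfolding smooth_on_def using Ck_on_subset by blast

lemma partial_pd: "partial c i f p = pd i (\<lambda>x. f (cinv c x)) (coord c p)"
  by (simp add: partial_def pd_def o_def)

lemma lie_bracket_anti: "lie_bracket X Y c p = - lie_bracket Y X c p"
  by (simp add: lie_bracket_def vec_eq_iff sum_3)

lemma lin_comb_nth: "lin_comb a \<xi> c p $ k = (\<Sum>i\<in>UNIV. a $ i * \<xi> i c p $ k)"
  by (simp add: lin_comb_def)

section \<open>Structure constants and frame matrix of a basis of fields\<close>

definition has_brackets :: "'a chart set \<Rightarrow> 'a set \<Rightarrow> (3 \<Rightarrow> 'a vfield) \<Rightarrow> real^3^3 \<Rightarrow> bool" where
  "has_brackets \<A> U \<xi> m \<longleftrightarrow>
     vf_eq \<A> U (lie_bracket (\<xi> 1) (\<xi> 2)) (lin_comb (m $ 3) \<xi>) \<and>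
     vf_eq \<A> U (lie_bracket (\<xi> 2) (\<xi> 3)) (lin_comb (m $ 1) \<xi>) \<and>
     vf_eq \<A> U (lie_bracket (\<xi> 3) (\<xi> 1)) (lin_comb (m $ 2) \<xi>)"

lemma G3_basis_has_brackets:
  assumes "G3_basis \<A> g U \<xi>"
  obtains m where "has_brackets \<A> U \<xi> m"
proof -
  obtain a where a: "\<And>i j. vf_eq \<A> U (lie_bracket (\<xi> i) (\<xi> j)) (lin_comb (a i j) \<xi>)"
    using assms unfolding G3_basis_def by metis
  have "has_brackets \<A> U \<xi> (vector [a 2 3, a 3 1, a 1 2])"
    unfolding has_brackets_def using a by simp
  then show ?thesis using that by blast
qed

lemma has_brackets_structure_const:
  assumes "has_brackets \<A> U \<xi> m" "c \<in> \<A>" "p \<in> cdom c \<inter> U"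
  shows "lie_bracket (\<xi> i) (\<xi> j) c p = (\<Sum>k\<in>UNIV. structure_const m i j k *\<^sub>R \<xi> k c p)"
proof -
  have b: "lie_bracket (\<xi> 1) (\<xi> 2) c p = lin_comb (m $ 3) \<xi> c p"
    "lie_bracket (\<xi> 2) (\<xi> 3) c p = lin_comb (m $ 1) \<xi> c p"
    "lie_bracket (\<xi> 3) (\<xi> 1) c p = lin_comb (m $ 2) \<xi> c p"
    using assms unfolding has_brackets_def vf_eq_def by blast+
  have "lie_bracket (\<xi> i) (\<xi> i) c p = 0" for i
    by (simp add: lie_bracket_def vec_eq_iff)
  moreover have "lie_bracket (\<xi> 2) (\<xi> 1) c p = - lin_comb (m $ 3) \<xi> c p"
    "lie_bracket (\<xi> 3) (\<xi> 2) c p = - lin_comb (m $ 1) \<xi> c p"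
    "lie_bracket (\<xi> 1) (\<xi> 3) c p = - lin_comb (m $ 2) \<xi> c p"
    unfolding b[symmetric] by (rule lie_bracket_anti)+
  ultimately have "\<forall>i j. lie_bracket (\<xi> i) (\<xi> j) c p = (\<Sum>k\<in>UNIV. structure_const m i j k *\<^sub>R \<xi> k c p)"
    using b by (simp add: forall_3 lin_comb_def structure_const_def sum_3 algebra_simps)
  then show ?thesis by blast
qed

definition frame_matrix :: "(3 \<Rightarrow> 'a vfield) \<Rightarrow> 'a chart \<Rightarrow> 'a \<Rightarrow> real^3^3" where
  "frame_matrix \<xi> c p = (\<chi> a m. \<xi> m c p $ a)"

lemma frame_matrix_det:
  assumes "transitive_on \<A> U \<xi>" "c \<in> \<A>" "p \<in> cdom c \<inter> U"
  shows "det (frame_matrix \<xi> c p) \<noteq> 0"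
proof -
  have "column i (frame_matrix \<xi> c p) = \<xi> i c p" for i
    by (simp add: column_def frame_matrix_def vec_eq_iff)
  then have "columns (frame_matrix \<xi> c p) = range (\<lambda>i. \<xi> i c p)"
    by (simp add: columns_def full_SetCompr_eq)
  moreover have "span (range (\<lambda>i. \<xi> i c p)) = UNIV"
    using assms unfolding transitive_on_def by blast
  ultimately have "span (columns (frame_matrix \<xi> c p)) = UNIV" by simp
  then have "\<exists>B. frame_matrix \<xi> c p ** B = mat 1"
    by (simp add: matrix_right_invertible_span_columns span_vec_eq)
  then obtain B where "frame_matrix \<xi> c p ** B = mat 1" ..
  then have "det (frame_matrix \<xi> c p) * det B = 1"
    using det_mul[of "frame_matrix \<xi> c p" B] by simp
  then show ?thesis by auto
qed

lemma matrix_inv_works: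
  fixes A :: "real^'n^'n"
  assumes "det A \<noteq> 0"
  shows "A ** matrix_inv A = mat 1" "matrix_inv A ** A = mat 1"
proof -
  have "invertible A" using assms by (simp add: invertible_det_nz)
  then have "\<exists>C. A ** C = mat 1 \<and> C ** A = mat 1"
    by (simp only: invertible_def)
  from someI_ex[OF this] show "A ** matrix_inv A = mat 1" "matrix_inv A ** A = mat 1"
    unfolding matrix_inv_def by simp_all
qed

lemma det_smooth:
  assumes "open V" "\<And>i j. smooth_on V (\<lambda>x. A x $ i $ j)"
  shows "smooth_on V (\<lambda>x. det (A x :: real^3^3))"
  unfolding det_3 by (intro smooth_on_intros assms)

text \<open>Cramer's rule writes each entry of the inverse as a determinant times the inverse of a
  nonvanishing smooth function.\<close>

lemma matrix_inv_smooth: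
  fixes A :: "real^3 \<Rightarrow> real^3^3"
  assumes V: "open V" and A: "\<And>i j. smooth_on V (\<lambda>x. A x $ i $ j)" and "\<And>x. x \<in> V \<Longrightarrow> det (A x) \<noteq> 0"
  shows "smooth_on V (\<lambda>x. matrix_inv (A x) $ k $ j)"
proof -
  define N where "N x = (\<chi> i l. if l = k then axis j 1 $ i else A x $ i $ l)" for x
  have *: "matrix_inv (A x) $ k $ j = det (N x) * inverse (det (A x))" if "x \<in> V" for x
  proof -
    have "A x *v (matrix_inv (A x) *v axis j 1) = axis j 1"
      using matrix_inv_works(1)[OF assms(3)[OF that]] by (simp add: matrix_vector_mul_assoc)
    then have "matrix_inv (A x) *v axis j 1 = (\<chi> k. det (\<chi> i l. if l = k then axis j 1 $ i else A x $ i $ l) / det (A x))"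
      by (rule iffD1[OF cramer[OF assms(3)[OF that]]])
    then have "(matrix_inv (A x) *v axis j 1) $ k = det (N x) / det (A x)"
      by (simp add: N_def)
    then show ?thesis
      by (simp add: matrix_vector_mul_component inner_axis divide_inverse)
  qed
  have "smooth_on V (\<lambda>x. N x $ i $ l)" for i l
    using A by (cases "l = k") (simp_all add: N_def smooth_on_const[OF V])
  then have "smooth_on V (\<lambda>x. det (N x) * inverse (det (A x)))"
    using assms(3) by (intro smooth_on_mult[OF V] smooth_on_inverse[OF V] det_smooth[OF V] A) simp_all
  then show ?thesis by (rule iffD2[OF smooth_on_cong[OF V *], rotated])
qed

section \<open>From a chart to the calculus in a Killing frame\<close>

lemma chart_inverse:
  assumes "is_chart c"
  shows "p \<in> cdom c \<Longrightarrow> cinv c (coord c p) = p"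
    "open U \<Longrightarrow> open (coord c ` (cdom c \<inter> U))"
proof -
  have h: "homeomorphism (cdom c) (coord c ` cdom c) (coord c) (cinv c)"
    and o: "open (coord c ` cdom c)"
    using assms by (auto simp: is_chart_def)
  show "p \<in> cdom c \<Longrightarrow> cinv c (coord c p) = p" using h by (simp add: homeomorphism_def)
  assume "open U"
  then have "openin (top_of_set (cdom c)) (cdom c \<inter> U)" by auto
  then have "openin (top_of_set (coord c ` cdom c)) (coord c ` (cdom c \<inter> U))"
    using homeomorphism_imp_open_map[OF h] by blast
  then show "open (coord c ` (cdom c \<inter> U))" using o openin_open_eq by blast
qed

text \<open>Positivity of the metric and transitivity make the two coefficient matrices invertible;
  Cramer's rule then supplies the smooth inverses that \<open>killing_frame\<close> asks
  for.\<close>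

lemma chart_killing_frame:
  assumes atlas: "oriented_atlas \<A>" and metric: "riemannian_metric \<A> g" and U: "open U"
    and basis: "G3_basis \<A> g U \<xi>" "transitive_on \<A> U \<xi>" and m: "has_brackets \<A> U \<xi> m" and c: "c \<in> \<A>"
  shows "killing_frame (coord c ` (cdom c \<inter> U)) (\<lambda>i j x. g c (cinv c x) $ i $ j)
    (\<lambda>i j x. matrix_inv (g c (cinv c x)) $ i $ j) (\<lambda>m a x. \<xi> m c (cinv c x) $ a)
    (\<lambda>m a x. matrix_inv (frame_matrix \<xi> c (cinv c x)) $ m $ a) (structure_const m)"
proof -
  define V where "V = coord c ` (cdom c \<inter> U)"
  have chart: "is_chart c" using atlas c by (simp add: oriented_atlas_def)
  have V: "open V" unfolding V_def by (rule chart_inverse(2)[OF chart U])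
  have V_cinv: "cinv c x \<in> cdom c \<inter> U" "coord c (cinv c x) = x" if "x \<in> V" for x
    using that chart_inverse(1)[OF chart] unfolding V_def by auto
  have kill: "killing_field \<A> g U (\<xi> m)" for m using basis by (simp add: G3_basis_def)
  have g_smooth: "smooth_on V (\<lambda>x. g c (cinv c x) $ i $ j)" for i j
  proof -
    have "smooth_on (coord c ` cdom c) (\<lambda>x. g c (cinv c x) $ i $ j)"
      using conjunct1[OF metric[unfolded riemannian_metric_def], rule_format, OF c, of i j]
      by (simp add: smooth_in_chart_def o_def)
    then show ?thesis by (rule smooth_on_subset) (auto simp: V_def)
  qed
  have X_smooth: "smooth_on V (\<lambda>x. \<xi> m c (cinv c x) $ a)" for m a
    using conjunct1[OF conjunct1[OF kill[of m, unfolded killing_field_def vector_field_def]], rule_format, OF c, of a]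
    by (simp add: smooth_in_chart_def o_def V_def)
  have g_pos: "transpose (g c p) = g c p \<and> (\<forall>v. v \<noteq> 0 \<longrightarrow> v \<bullet> (g c p *v v) > 0)" if "p \<in> cdom c" for p
    by (rule conjunct1[OF conjunct2[OF metric[unfolded riemannian_metric_def]], rule_format, OF c that])
  have g_det: "det (g c p) \<noteq> 0" if "p \<in> cdom c" for p
  proof -
    have "\<forall>v. g c p *v v = 0 \<longrightarrow> v = 0" using g_pos[OF that] by fastforce
    then have "invertible (g c p)" by (simp add: invertible_left_inverse matrix_left_invertible_ker)
    then show ?thesis by (simp add: invertible_det_nz)
  qed
  have g_sym: "g c p $ i $ j = g c p $ j $ i" if "p \<in> cdom c" for p i j
  proof -
    have "transpose (g c p) $ i $ j = g c p $ i $ j" using g_pos[OF that] by simp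
    then show ?thesis by (simp add: transpose_def)
  qed
  have gi_sym: "transpose (matrix_inv (g c p)) = matrix_inv (g c p)" if "p \<in> cdom c" for p
  proof (rule matrix_inv_unique[symmetric])
    show "g c p ** transpose (matrix_inv (g c p)) = mat 1" "transpose (matrix_inv (g c p)) ** g c p = mat 1"
      using arg_cong[OF matrix_inv_works(2)[OF g_det[OF that]], of transpose]
        arg_cong[OF matrix_inv_works(1)[OF g_det[OF that]], of transpose] g_pos[OF that]
      by (simp_all add: matrix_transpose_mul transpose_mat)
  qed
  have X_det: "det (frame_matrix \<xi> c (cinv c x)) \<noteq> 0" if "x \<in> V" for x
    by (rule frame_matrix_det[OF basis(2) c V_cinv(1)[OF that]])
  have X_inv: "frame_matrix \<xi> c (cinv c x) ** matrix_inv (frame_matrix \<xi> c (cinv c x)) = mat 1"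
    "matrix_inv (frame_matrix \<xi> c (cinv c x)) ** frame_matrix \<xi> c (cinv c x) = mat 1" if "x \<in> V" for x
    by (rule matrix_inv_works[OF X_det[OF that]])+
  have "killing_frame V (\<lambda>i j x. g c (cinv c x) $ i $ j)
    (\<lambda>i j x. matrix_inv (g c (cinv c x)) $ i $ j) (\<lambda>m a x. \<xi> m c (cinv c x) $ a)
    (\<lambda>m a x. matrix_inv (frame_matrix \<xi> c (cinv c x)) $ m $ a) (structure_const m)"
  proof
    show "open V" by (rule V)
    show "smooth_on V (\<lambda>x. matrix_inv (g c (cinv c x)) $ i $ j)" for i j
      using V_cinv g_det by (intro matrix_inv_smooth V g_smooth) auto
    show "smooth_on V (\<lambda>x. matrix_inv (frame_matrix \<xi> c (cinv c x)) $ m $ a)" for m a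
      using X_det by (intro matrix_inv_smooth V) (auto simp: frame_matrix_def X_smooth)
    fix x assume x: "x \<in> V"
    note p = V_cinv[OF x]
    show "g c (cinv c x) $ i $ j = g c (cinv c x) $ j $ i" for i j using g_sym[of "cinv c x" i j] p by simp
    show "matrix_inv (g c (cinv c x)) $ i $ j = matrix_inv (g c (cinv c x)) $ j $ i" for i j
      using arg_cong[OF gi_sym[of "cinv c x"], of "\<lambda>M. M $ j $ i"] p by (simp add: transpose_def)
    show "(\<Sum>k\<in>UNIV. g c (cinv c x) $ i $ k * matrix_inv (g c (cinv c x)) $ k $ j) = (if i = j then 1 else 0)" for i j
      using arg_cong[OF matrix_inv_works(1)[OF g_det[of "cinv c x"]], of "\<lambda>M. M $ i $ j"] p
      by (simp add: matrix_matrix_mult_def mat_def)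
    show "(\<Sum>m\<in>UNIV. \<xi> m c (cinv c x) $ a * matrix_inv (frame_matrix \<xi> c (cinv c x)) $ m $ b) = (if a = b then 1 else 0)" for a b
      using arg_cong[OF X_inv(1)[OF x], of "\<lambda>M. M $ a $ b"]
      by (simp add: matrix_matrix_mult_def mat_def frame_matrix_def)
    show "(\<Sum>a\<in>UNIV. matrix_inv (frame_matrix \<xi> c (cinv c x)) $ m $ a * \<xi> n c (cinv c x) $ a) = (if m = n then 1 else 0)" for m n
      using arg_cong[OF X_inv(2)[OF x], of "\<lambda>M. M $ m $ n"]
      by (simp add: matrix_matrix_mult_def mat_def frame_matrix_def)
    show "(\<Sum>k\<in>UNIV. \<xi> m c (cinv c x) $ k * pd k (\<lambda>x. g c (cinv c x) $ i $ j) x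
        + g c (cinv c x) $ k $ j * pd i (\<lambda>x. \<xi> m c (cinv c x) $ k) x
        + g c (cinv c x) $ i $ k * pd j (\<lambda>x. \<xi> m c (cinv c x) $ k) x) = 0" for m i j
      using conjunct2[OF kill[of m, unfolded killing_field_def partial_pd], rule_format, OF c p(1), of i j]
      by (simp add: p(2))
    show "(\<Sum>a\<in>UNIV. \<xi> i c (cinv c x) $ a * pd a (\<lambda>x. \<xi> j c (cinv c x) $ k) x
        - \<xi> j c (cinv c x) $ a * pd a (\<lambda>x. \<xi> i c (cinv c x) $ k) x)
      = (\<Sum>l\<in>UNIV. structure_const m i j l * \<xi> l c (cinv c x) $ k)" for i j k
      using arg_cong[OF has_brackets_structure_const[OF m c, of "cinv c x" i j], of "\<lambda>v. v $ k"] p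
      by (simp add: lie_bracket_def partial_pd)
  qed (rule g_smooth X_smooth)+
  then show ?thesis unfolding V_def .
qed

text \<open>The chart definitions are matched with the locale constants on all of \<open>V\<close>,
  because derivatives are taken. Orthonormality is required at \<open>p\<close> alone: it turns
  \<open>h\<close> into the identity there after the derivatives have been expressed through
  \<open>c\<close> and \<gamma>.\<close>

lemma frame_tensors:
  assumes atlas: "oriented_atlas \<A>" and metric: "riemannian_metric \<A> g" and U: "open U"
    and basis: "G3_basis \<A> g U \<xi>" "transitive_on \<A> U \<xi>" and m: "has_brackets \<A> U \<xi> M" and c: "c \<in> \<A>"
    and p: "p \<in> cdom c \<inter> U"
  defines "X \<equiv> frame_matrix \<xi> c p"
  shows "(\<Sum>l\<in>UNIV. structure_const M i j l * structure_const M l k r + structure_const M j k l * structure_const M l i r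
      + structure_const M k i l * structure_const M l j r) = 0" (is ?jacobi)
    and "transpose X ** g c p ** X = mat 1 \<Longrightarrow> transpose X ** ricci g c p ** X = frame_ricci (structure_const M)"
      (is "_ \<Longrightarrow> ?ricci")
    and "transpose X ** g c p ** X = mat 1 \<Longrightarrow> (\<Sum>k\<in>UNIV. \<Sum>a\<in>UNIV. \<Sum>b\<in>UNIV. X $ k $ i * X $ a $ m * X $ b $ n
          * cov_deriv g (traceless_ricci g) c p k a b)
      = - (\<Sum>l\<in>UNIV. conn (structure_const M) m i l * (transpose X ** traceless_ricci g c p ** X) $ l $ n
           + conn (structure_const M) n i l * (transpose X ** traceless_ricci g c p ** X) $ m $ l)"
      (is "_ \<Longrightarrow> ?nabla")
proof -
  define V where "V = coord c ` (cdom c \<inter> U)"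
  have chart: "is_chart c" using atlas c by (simp add: oriented_atlas_def)
  interpret killing_frame V "\<lambda>i j x. g c (cinv c x) $ i $ j"
    "\<lambda>i j x. matrix_inv (g c (cinv c x)) $ i $ j" "\<lambda>m a x. \<xi> m c (cinv c x) $ a"
    "\<lambda>m a x. matrix_inv (frame_matrix \<xi> c (cinv c x)) $ m $ a" "structure_const M"
    unfolding V_def by (rule chart_killing_frame[OF assms(1-7)])
  have inv: "cinv c (coord c q) = q" if "q \<in> cdom c" for q using chart_inverse(1)[OF chart] that .
  define x where "x = coord c p"
  have x: "x \<in> V" using p by (auto simp: x_def V_def)
  have cx: "cinv c x = p" using p inv by (auto simp: x_def)
  have coordV: "\<exists>q\<in>cdom c \<inter> U. y = coord c q" if "y \<in> V" for y using that by (auto simp: V_def)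
  have chr: "christoffel g c k i j q = \<Gamma> k i j (coord c q)" if "q \<in> cdom c \<inter> U" for k i j q
    using that inv by (simp add: christoffel_def \<Gamma>_def partial_pd)
  have chr_pd: "partial c a (christoffel g c k i j) q = pd a (\<Gamma> k i j) (coord c q)" if "q \<in> cdom c \<inter> U" for a k i j q
    unfolding partial_pd
  proof (rule pd_cong[OF V])
    show "coord c q \<in> V" using that by (auto simp: V_def)
    show "christoffel g c k i j (cinv c y) = \<Gamma> k i j y" if "y \<in> V" for y
      using coordV[OF that] chr inv by auto
  qed
  have ric: "ricci g c q $ i $ j = Ric i j (coord c q)" if "q \<in> cdom c \<inter> U" for i j q
    by (simp add: ricci_def Ric_def chr_pd[OF that] chr[OF that])
  have S: "traceless_ricci g c q $ i $ j = S i j (coord c q)" if "q \<in> cdom c \<inter> U" for i j q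
    using that inv by (simp add: traceless_ricci_def S_def scal_def ttr_def trace_def matrix_matrix_mult_def ric[OF that])
  have cov: "cov_deriv g (traceless_ricci g) c p k i j = nabS k i j x" for k i j
  proof -
    have "partial c k (\<lambda>q. traceless_ricci g c q $ i $ j) p = pd k (S i j) x"
      unfolding partial_pd x_def[symmetric]
    proof (rule pd_cong[OF V x])
      show "traceless_ricci g c (cinv c y) $ i $ j = S i j y" if "y \<in> V" for y
        using coordV[OF that] S inv by auto
    qed
    then show ?thesis using S[OF p, folded x_def] chr[OF p, folded x_def] by (simp add: cov_deriv_def nabS_def)
  qed
  show ?jacobi by (rule jacobi[OF x])
  have X: "X $ a $ m = \<xi> m c p $ a" for a m by (simp add: X_def frame_matrix_def)
  have frame: "(transpose X ** A ** X) $ m $ n = (\<Sum>a\<in>UNIV. \<Sum>b\<in>UNIV. A $ a $ b * (\<xi> m c p $ a * \<xi> n c p $ b))" for A m n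
    by (simp add: matrix_matrix_mult_def transpose_def X sum_3) (simp add: algebra_simps)
  assume ON: "transpose X ** g c p ** X = mat 1"
  have h: "h m n x = (if m = n then 1 else 0)" for m n
    using frame[of "g c p" m n] unfolding ON h_def cx by (simp add: mat_def)
  have \<gamma>: "\<gamma> n m k x = conn (structure_const M) n m k" for n m k
    using lower_\<gamma>[OF x, of n m k] by (simp add: h sum_delta_mult sum.distrib conn_def)
  have \<rho>: "(transpose X ** ricci g c p ** X) $ m $ n = \<rho> m n x" for m n
    using ric[OF p, folded x_def] by (simp add: frame \<rho>_def cx)
  show ?ricci
    unfolding vec_eq_iff \<rho> \<rho>_eq'[OF x] D_\<gamma>[OF x] \<gamma> frame_ricci_def by simp
  have \<sigma>: "(transpose X ** traceless_ricci g c p ** X) $ m $ n = \<sigma> m n x" for m n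
    using S[OF p, folded x_def] by (simp add: frame \<sigma>_def cx)
  show ?nabla
    unfolding cov \<sigma> X using nabS_frame[OF x, of i m n] by (simp add: cx \<gamma>)
qed

section \<open>Combinations of fields with constant coefficients and changes of basis\<close>

lemma vector_field_smooth:
  assumes "vector_field \<A> U X" "c \<in> \<A>"
  shows "smooth_on (coord c ` (cdom c \<inter> U)) (\<lambda>x. X c (cinv c x) $ k)"
  using conjunct1[OF assms(1)[unfolded vector_field_def], rule_format, OF assms(2), of k]
  by (simp add: smooth_in_chart_def o_def)

lemma partial_cong:
  assumes "is_chart c" "open W" "p \<in> cdom c \<inter> W" "\<And>q. q \<in> cdom c \<inter> W \<Longrightarrow> f q = f' q"
  shows "partial c i f p = partial c i f' p"
  unfolding partial_pd
proof (rule pd_cong[OF chart_inverse(2)[OF assms(1,2)]])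
  show "coord c p \<in> coord c ` (cdom c \<inter> W)" using assms(3) by blast
  fix y assume "y \<in> coord c ` (cdom c \<inter> W)"
  then obtain q where "q \<in> cdom c \<inter> W" "y = coord c q" by blast
  then show "f (cinv c y) = f' (cinv c y)" using chart_inverse(1)[OF assms(1), of q] assms(4) by auto
qed

lemma partial_lin_comb:
  assumes c: "is_chart c" "c \<in> \<A>" and U: "open U" and \<xi>: "\<And>i. vector_field \<A> U (\<xi> i)" and p: "p \<in> cdom c \<inter> U"
  shows "partial c i (\<lambda>q. lin_comb a \<xi> c q $ k) p = (\<Sum>j\<in>UNIV. a $ j * partial c i (\<lambda>q. \<xi> j c q $ k) p)"
proof -
  define V where "V = coord c ` (cdom c \<inter> U)"
  have V: "open V" unfolding V_def by (rule chart_inverse(2)[OF c(1) U])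
  have x: "coord c p \<in> V" using p by (auto simp: V_def)
  have s: "smooth_on V (\<lambda>x. \<xi> j c (cinv c x) $ k)" for j
    unfolding V_def by (rule vector_field_smooth[OF \<xi> c(2)])
  have 1: "pd i (\<lambda>x. a $ j * \<xi> j c (cinv c x) $ k) (coord c p) = a $ j * pd i (\<lambda>x. \<xi> j c (cinv c x) $ k) (coord c p)" for j
    using pd_mult[OF V x smooth_on_const[OF V] s, of i "a $ j" j] by simp
  show ?thesis unfolding partial_pd lin_comb_nth
    by (subst pd_sum[OF V x]) (auto intro: smooth_on_mult[OF V] smooth_on_const[OF V] s simp: 1)
qed

lemma vector_field_lin_comb:
  assumes atlas: "oriented_atlas \<A>" and U: "open U" and \<xi>: "\<And>i. vector_field \<A> U (\<xi> i)"
  shows "vector_field \<A> U (lin_comb a \<xi>)"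
  unfolding vector_field_def
proof (intro conjI ballI allI)
  fix c i assume c: "c \<in> \<A>"
  then have "is_chart c" using atlas by (simp add: oriented_atlas_def)
  from chart_inverse(2)[OF this U] have V: "open (coord c ` (cdom c \<inter> U))" .
  show "smooth_in_chart c U (\<lambda>p. lin_comb a \<xi> c p $ i)"
    unfolding smooth_in_chart_def o_def lin_comb_nth
    by (intro smooth_on_sum[OF V] smooth_on_mult[OF V] smooth_on_const[OF V] vector_field_smooth[OF \<xi> c])
next
  fix c d p assume c: "c \<in> \<A>" "d \<in> \<A>" and p: "p \<in> cdom c \<inter> cdom d \<inter> U"
  have "\<xi> i d p = transition_jacobian c d p *v \<xi> i c p" for i
    by (rule conjunct2[OF \<xi>[unfolded vector_field_def], rule_format, OF c p])
  then show "lin_comb a \<xi> d p = transition_jacobian c d p *v lin_comb a \<xi> c p"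
    unfolding lin_comb_def by (simp add: sum_3 matrix_vector_right_distrib matrix_vector_mult_scaleR)
qed

lemma killing_field_lin_comb:
  assumes atlas: "oriented_atlas \<A>" and U: "open U" and \<xi>: "\<And>i. killing_field \<A> g U (\<xi> i)"
  shows "killing_field \<A> g U (lin_comb a \<xi>)"
  unfolding killing_field_def
proof (intro conjI ballI allI)
  have vf: "vector_field \<A> U (\<xi> i)" for i using \<xi>[of i] by (rule conjunct1[OF iffD1[OF killing_field_def]])
  show "vector_field \<A> U (lin_comb a \<xi>)" by (rule vector_field_lin_comb[OF atlas U vf])
  fix c p i j assume c: "c \<in> \<A>" and p: "p \<in> cdom c \<inter> U"
  have chart: "is_chart c" using atlas c by (simp add: oriented_atlas_def)
  have k: "(\<Sum>k\<in>UNIV. \<xi> l c p $ k * partial c k (\<lambda>q. g c q $ i $ j) p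
        + g c p $ k $ j * partial c i (\<lambda>q. \<xi> l c q $ k) p
        + g c p $ i $ k * partial c j (\<lambda>q. \<xi> l c q $ k) p) = 0" for l
    by (rule conjunct2[OF \<xi>[unfolded killing_field_def], rule_format, OF c p])
  have "(\<Sum>k\<in>UNIV. lin_comb a \<xi> c p $ k * partial c k (\<lambda>q. g c q $ i $ j) p
        + g c p $ k $ j * partial c i (\<lambda>q. lin_comb a \<xi> c q $ k) p
        + g c p $ i $ k * partial c j (\<lambda>q. lin_comb a \<xi> c q $ k) p)
     = (\<Sum>l\<in>UNIV. a $ l * (\<Sum>k\<in>UNIV. \<xi> l c p $ k * partial c k (\<lambda>q. g c q $ i $ j) p
        + g c p $ k $ j * partial c i (\<lambda>q. \<xi> l c q $ k) p
        + g c p $ i $ k * partial c j (\<lambda>q. \<xi> l c q $ k) p))"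
    unfolding partial_lin_comb[OF chart c U vf p] unfolding lin_comb_nth by (simp add: sum_3) (simp add: algebra_simps)
  then show "(\<Sum>k\<in>UNIV. lin_comb a \<xi> c p $ k * partial c k (\<lambda>q. g c q $ i $ j) p
        + g c p $ k $ j * partial c i (\<lambda>q. lin_comb a \<xi> c q $ k) p
        + g c p $ i $ k * partial c j (\<lambda>q. lin_comb a \<xi> c q $ k) p) = 0"
    unfolding k by simp
qed

lemma lie_bracket_lin_comb:
  assumes c: "is_chart c" "c \<in> \<A>" and U: "open U" and \<xi>: "\<And>i. vector_field \<A> U (\<xi> i)" and p: "p \<in> cdom c \<inter> U"
  shows "lie_bracket (lin_comb a \<xi>) (lin_comb b \<xi>) c p
    = (\<Sum>i\<in>UNIV. \<Sum>j\<in>UNIV. (a $ i * b $ j) *\<^sub>R lie_bracket (\<xi> i) (\<xi> j) c p)"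
  unfolding vec_eq_iff lie_bracket_def vec_lambda_beta partial_lin_comb[OF c U \<xi> p] unfolding lin_comb_nth
  by (simp add: sum_3) (simp add: algebra_simps)

text \<open>The adjugate of \<open>P\<close>. Its rows are the cross products of the columns of
  \<open>P\<close> in cyclic order, hence the coefficients with which the new brackets combine the
  old ones.\<close>

definition adj3 :: "real^3^3 \<Rightarrow> real^3^3" where
  "adj3 P = vector [
     vector [P$2$2 * P$3$3 - P$3$2 * P$2$3, P$3$2 * P$1$3 - P$1$2 * P$3$3, P$1$2 * P$2$3 - P$2$2 * P$1$3],
     vector [P$2$3 * P$3$1 - P$3$3 * P$2$1, P$3$3 * P$1$1 - P$1$3 * P$3$1, P$1$3 * P$2$1 - P$2$3 * P$1$1],
     vector [P$2$1 * P$3$2 - P$3$1 * P$2$2, P$3$1 * P$1$2 - P$1$1 * P$3$2, P$1$1 * P$2$2 - P$2$1 * P$1$2]]"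

lemma adj3_mult: "adj3 P ** P = det P *\<^sub>R mat 1" "P ** adj3 P = det P *\<^sub>R mat 1"
  by (simp_all add: vec_eq_iff forall_3 adj3_def matrix_matrix_mult_def sum_3 det_3 mat_def algebra_simps)

text \<open>The right-hand form is what expanding the brackets yields. The left-hand form shows the
  bracket matrix transforming as a bilinear form up to a factor, so that congruence invariants
  apply.\<close>

lemma adj3_relation:
  assumes "det P \<noteq> 0"
  shows "P ** m' ** transpose P = det P *\<^sub>R m \<longleftrightarrow> m' ** transpose P = adj3 P ** m"
proof
  assume "P ** m' ** transpose P = det P *\<^sub>R m"
  then have "adj3 P ** (P ** m' ** transpose P) = adj3 P ** (det P *\<^sub>R m)" by simp
  then have "det P *\<^sub>R (m' ** transpose P) = det P *\<^sub>R (adj3 P ** m)"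
    by (simp add: matrix_mul_assoc adj3_mult matrix_ring_simps)
  then show "m' ** transpose P = adj3 P ** m" using assms by simp
next
  assume "m' ** transpose P = adj3 P ** m"
  then show "P ** m' ** transpose P = det P *\<^sub>R m"
    by (simp add: matrix_mul_assoc[symmetric]) (simp add: matrix_mul_assoc adj3_mult matrix_ring_simps)
qed

definition change_basis :: "real^3^3 \<Rightarrow> (3 \<Rightarrow> 'a vfield) \<Rightarrow> 3 \<Rightarrow> 'a vfield" where
  "change_basis P \<xi> j = lin_comb (column j P) \<xi>"

lemma frame_matrix_change_basis: "frame_matrix (change_basis P \<xi>) c p = frame_matrix \<xi> c p ** P"
  by (simp add: vec_eq_iff frame_matrix_def change_basis_def lin_comb_nth column_def matrix_matrix_mult_def mult.commute)

lemma lin_comb_change_basis: "lin_comb a (change_basis P \<xi>) = lin_comb (P *v a) \<xi>"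
  by (rule ext)+ (simp add: vec_eq_iff lin_comb_nth change_basis_def column_def matrix_vector_mult_def sum_3 algebra_simps)

lemma lin_comb_frame: "lin_comb a \<xi> c p = frame_matrix \<xi> c p *v a"
  by (simp add: vec_eq_iff lin_comb_nth frame_matrix_def matrix_vector_mult_def mult.commute)

lemma lie_bracket_change_basis:
  assumes c: "is_chart c" "c \<in> \<A>" and U: "open U" and \<xi>: "\<And>i. vector_field \<A> U (\<xi> i)" and p: "p \<in> cdom c \<inter> U"
    and m: "has_brackets \<A> U \<xi> m"
  shows "lie_bracket (change_basis P \<xi> 1) (change_basis P \<xi> 2) c p = lin_comb ((adj3 P ** m) $ 3) \<xi> c p"
    "lie_bracket (change_basis P \<xi> 2) (change_basis P \<xi> 3) c p = lin_comb ((adj3 P ** m) $ 1) \<xi> c p"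
    "lie_bracket (change_basis P \<xi> 3) (change_basis P \<xi> 1) c p = lin_comb ((adj3 P ** m) $ 2) \<xi> c p"
  unfolding change_basis_def lie_bracket_lin_comb[OF c U \<xi> p] has_brackets_structure_const[OF m c(2) p]
  by (simp_all add: vec_eq_iff lin_comb_nth column_def structure_const_def matrix_matrix_mult_def adj3_def sum_3)
    (simp_all add: algebra_simps)

lemma lin_comb_row: "lin_comb (m $ i) (change_basis P \<xi>) = lin_comb ((m ** transpose P) $ i) \<xi>"
  unfolding lin_comb_change_basis
  by (rule arg_cong[where f = "\<lambda>v. lin_comb v \<xi>"])
    (simp add: vec_eq_iff matrix_vector_mult_def matrix_matrix_mult_def transpose_def mult.commute)

lemma change_basis_has_brackets:
  assumes atlas: "oriented_atlas \<A>" and U: "open U" and \<xi>: "\<And>i. vector_field \<A> U (\<xi> i)"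
    and m: "has_brackets \<A> U \<xi> m" and P: "det P \<noteq> 0" "P ** m' ** transpose P = det P *\<^sub>R m"
  shows "has_brackets \<A> U (change_basis P \<xi>) m'"
proof -
  have *: "m' ** transpose P = adj3 P ** m" using P adj3_relation by blast
  have chart: "is_chart c" if "c \<in> \<A>" for c using atlas that by (simp add: oriented_atlas_def)
  show ?thesis unfolding has_brackets_def vf_eq_def lin_comb_row *
    using lie_bracket_change_basis[OF chart _ U \<xi> _ m] by blast
qed

lemma exists_related:
  fixes P m :: "real^3^3"
  assumes "det P \<noteq> 0"
  obtains m' where "P ** m' ** transpose P = det P *\<^sub>R m"
proof -
  have "transpose (matrix_inv P) ** transpose P = mat 1"
    using arg_cong[OF matrix_inv_works(1)[OF assms], of transpose] by (simp add: matrix_transpose_mul transpose_mat)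
  then have "(adj3 P ** m ** transpose (matrix_inv P)) ** transpose P = adj3 P ** m"
    by (simp add: matrix_mul_assoc[symmetric])
  from that[OF iffD2[OF adj3_relation[OF assms] this]] show ?thesis .
qed

text \<open>\<open>P\<close> is invertible, so the two bases have the same span over the constants
  and generate the same germs.\<close>

lemma change_basis_maximal:
  assumes atlas: "oriented_atlas \<A>" and U: "open U" and \<xi>: "maximal_transitive_G3_basis \<A> g U \<xi>" and P: "det P \<noteq> 0"
  shows "maximal_transitive_G3_basis \<A> g U (change_basis P \<xi>)"
proof -
  have basis: "G3_basis \<A> g U \<xi>" "transitive_on \<A> U \<xi>" "maximal_on \<A> g U \<xi>"
    using \<xi> unfolding maximal_transitive_G3_basis_def by blast+
  have kill: "killing_field \<A> g U (\<xi> i)" for i using basis(1) unfolding G3_basis_def by blast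
  have vf: "vector_field \<A> U (\<xi> i)" for i using kill[of i] unfolding killing_field_def by (rule conjunct1)
  note inv = matrix_inv_works[OF P]
  have "G3_basis \<A> g U (change_basis P \<xi>)"
    unfolding G3_basis_def
  proof (intro conjI allI impI)
    show "killing_field \<A> g U (change_basis P \<xi> i)" for i
      unfolding change_basis_def by (rule killing_field_lin_comb[OF atlas U kill])
    show "a = 0" if "vf_eq \<A> U (lin_comb a (change_basis P \<xi>)) (\<lambda>_ _. 0)" for a
    proof -
      have "P *v a = 0" using that basis(1) unfolding lin_comb_change_basis G3_basis_def by blast
      then have "matrix_inv P *v (P *v a) = 0" by simp
      then show ?thesis by (simp add: matrix_vector_mul_assoc inv)
    qed
    obtain m where m: "has_brackets \<A> U \<xi> m" using G3_basis_has_brackets[OF basis(1)] by blast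
    obtain m' where "P ** m' ** transpose P = det P *\<^sub>R m" by (rule exists_related[OF P])
    from change_basis_has_brackets[OF atlas U vf m P this]
    have m': "has_brackets \<A> U (change_basis P \<xi>) m'" .
    show "\<exists>a. vf_eq \<A> U (lie_bracket (change_basis P \<xi> i) (change_basis P \<xi> j)) (lin_comb a (change_basis P \<xi>))" for i j
      using has_brackets_structure_const[OF m', of _ _ i j]
      by (intro exI[of _ "\<chi> k. structure_const m' i j k"]) (auto simp: vf_eq_def lin_comb_def)
  qed
  moreover have "transitive_on \<A> U (change_basis P \<xi>)"
    unfolding transitive_on_def
  proof (intro ballI)
    fix c p assume c: "c \<in> \<A>" and p: "p \<in> cdom c \<inter> U"
    have "\<xi> i c p \<in> span (range (\<lambda>i. change_basis P \<xi> i c p))" for i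
    proof -
      have "\<xi> i = lin_comb (axis i 1) \<xi>"
        by (rule ext)+ (simp add: vec_eq_iff lin_comb_nth axis_def if_distrib[of "\<lambda>z. z * _"] cong: if_cong)
      also have "\<dots> = lin_comb (matrix_inv P *v axis i 1) (change_basis P \<xi>)"
        by (simp add: lin_comb_change_basis matrix_vector_mul_assoc inv)
      finally have eq: "\<xi> i c p = lin_comb (matrix_inv P *v axis i 1) (change_basis P \<xi>) c p"
        by (rule fun_cong[OF fun_cong])
      have mem: "lin_comb v \<zeta> c p \<in> span (range (\<lambda>i. \<zeta> i c p))" for v \<zeta>
        unfolding lin_comb_def by (intro span_sum span_scale) (auto intro: span_base)
      show ?thesis unfolding eq by (rule mem)
    qed
    then have "span (range (\<lambda>i. \<xi> i c p)) \<subseteq> span (range (\<lambda>i. change_basis P \<xi> i c p))"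
      by (intro span_minimal) auto
    moreover have "span (range (\<lambda>i. \<xi> i c p)) = UNIV"
      using basis(2) c p unfolding transitive_on_def by blast
    ultimately show "span (range (\<lambda>i. change_basis P \<xi> i c p)) = UNIV" by auto
  qed
  moreover have "maximal_on \<A> g U (change_basis P \<xi>)"
    unfolding maximal_on_def
  proof (intro ballI allI impI)
    fix p V X assume p: "p \<in> U" and V: "open V \<and> p \<in> V \<and> killing_field \<A> g V X"
    obtain W a where W: "open W \<and> p \<in> W \<and> W \<subseteq> U \<inter> V \<and> vf_eq \<A> W X (lin_comb a \<xi>)"
      using basis(3)[unfolded maximal_on_def, rule_format, OF p V] by blast
    have eq: "lin_comb (matrix_inv P *v a) (change_basis P \<xi>) = lin_comb a \<xi>"
      by (simp add: lin_comb_change_basis matrix_vector_mul_assoc inv)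
    show "\<exists>W a. open W \<and> p \<in> W \<and> W \<subseteq> U \<inter> V \<and> vf_eq \<A> W X (lin_comb a (change_basis P \<xi>))"
      by (rule exI[of _ W], rule exI[of _ "matrix_inv P *v a"], unfold eq, rule W)
  qed
  ultimately show ?thesis unfolding maximal_transitive_G3_basis_def by blast
qed

text \<open>Maximality of \<xi> writes each field of the second basis near \<open>p\<close> as a
  combination of \<xi> with constant coefficients, the columns of \<open>P\<close>. The brackets
  then agree near \<open>p\<close>, and since the frame at \<open>p\<close> is invertible, comparing
  values at \<open>p\<close> compares coefficients.\<close>

lemma germ_relation:
  assumes atlas: "oriented_atlas \<A>" 
    and U: "open U" "maximal_transitive_G3_basis \<A> g U \<xi>" "has_brackets \<A> U \<xi> m"
    and U': "open U'" "maximal_transitive_G3_basis \<A> g U' \<xi>'" "has_brackets \<A> U' \<xi>' m'"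
    and p: "p \<in> U" "p \<in> U'"
  obtains P where "det P \<noteq> 0" "P ** m' ** transpose P = det P *\<^sub>R m"
proof -
  have basis: "G3_basis \<A> g U \<xi>" "transitive_on \<A> U \<xi>" "maximal_on \<A> g U \<xi>"
    using U unfolding maximal_transitive_G3_basis_def by blast+
  have basis': "G3_basis \<A> g U' \<xi>'" "transitive_on \<A> U' \<xi>'"
    using U' unfolding maximal_transitive_G3_basis_def by blast+
  have vf: "vector_field \<A> U (\<xi> i)" for i
    using basis(1) unfolding G3_basis_def killing_field_def by blast
  have "\<exists>W a. open W \<and> p \<in> W \<and> W \<subseteq> U \<inter> U' \<and> vf_eq \<A> W (\<xi>' i) (lin_comb a \<xi>)" for i
    using basis(3) p U'(1) basis'(1) unfolding maximal_on_def G3_basis_def by blast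
  then obtain W a where W: "\<And>i. open (W i)" "\<And>i. p \<in> W i" "\<And>i. W i \<subseteq> U \<inter> U'"
    and a: "\<And>i. vf_eq \<A> (W i) (\<xi>' i) (lin_comb (a i) \<xi>)" by metis
  define P :: "real^3^3" where "P = (\<chi> k i. a i $ k)"
  define W0 where "W0 = (\<Inter>i. W i)"
  have W0: "open W0" "p \<in> W0" unfolding W0_def using W by (auto intro: open_INT)
  have "column i P = a i" for i by (simp add: P_def column_def vec_eq_iff)
  then have *: "vf_eq \<A> (W i) (\<xi>' i) (change_basis P \<xi> i)" for i
    using a by (simp add: change_basis_def)
  have eq: "\<xi>' i c q = change_basis P \<xi> i c q" if "c \<in> \<A>" "q \<in> cdom c \<inter> W0" for c q i
    using *[of i] that unfolding vf_eq_def W0_def by blast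
  obtain c where c: "c \<in> \<A>" "p \<in> cdom c" using atlas unfolding oriented_atlas_def by blast
  have chart: "is_chart c" using atlas c by (simp add: oriented_atlas_def)
  have pU: "p \<in> cdom c \<inter> U" "p \<in> cdom c \<inter> U'" "p \<in> cdom c \<inter> W0" using c p W0 by auto
  have lie: "lie_bracket (\<xi>' i) (\<xi>' j) c p = lie_bracket (change_basis P \<xi> i) (change_basis P \<xi> j) c p" for i j
  proof -
    have "partial c b (\<lambda>q. \<xi>' i c q $ k) p = partial c b (\<lambda>q. change_basis P \<xi> i c q $ k) p" for i k b
      using eq[OF c(1)] by (intro partial_cong[OF chart W0(1) pU(3)]) simp
    then show ?thesis using eq[OF c(1) pU(3)] by (simp add: lie_bracket_def)
  qed
  have fm: "frame_matrix \<xi>' c p = frame_matrix \<xi> c p ** P"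
    unfolding frame_matrix_change_basis[symmetric] using eq[OF c(1) pU(3)] by (simp add: frame_matrix_def)
  have det: "det (frame_matrix \<xi> c p) \<noteq> 0" "det (frame_matrix \<xi>' c p) \<noteq> 0"
    using frame_matrix_det[OF basis(2) c(1) pU(1)] frame_matrix_det[OF basis'(2) c(1) pU(2)] .
  then have P: "det P \<noteq> 0" by (simp add: fm det_mul)
  have inj: "v = w" if "lin_comb v \<xi> c p = lin_comb w \<xi> c p" for v w
  proof -
    have "matrix_inv (frame_matrix \<xi> c p) *v (frame_matrix \<xi> c p *v v) = matrix_inv (frame_matrix \<xi> c p) *v (frame_matrix \<xi> c p *v w)"
      using that by (simp add: lin_comb_frame)
    then show ?thesis by (simp add: matrix_vector_mul_assoc matrix_inv_works[OF det(1)])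
  qed
  have lc: "lin_comb v \<xi>' c p = lin_comb v (change_basis P \<xi>) c p" for v
    using eq[OF c(1) pU(3)] by (simp add: lin_comb_def)
  have b: "lie_bracket (\<xi>' 1) (\<xi>' 2) c p = lin_comb (m' $ 3) \<xi>' c p"
    "lie_bracket (\<xi>' 2) (\<xi>' 3) c p = lin_comb (m' $ 1) \<xi>' c p"
    "lie_bracket (\<xi>' 3) (\<xi>' 1) c p = lin_comb (m' $ 2) \<xi>' c p"
    using U'(3) c(1) pU(2) unfolding has_brackets_def vf_eq_def by blast+
  have "lin_comb ((m' ** transpose P) $ i) \<xi> c p = lin_comb ((adj3 P ** m) $ i) \<xi> c p" for i
  proof -
    have "\<forall>i. lin_comb ((m' ** transpose P) $ i) \<xi> c p = lin_comb ((adj3 P ** m) $ i) \<xi> c p"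
      using b unfolding lie lie_bracket_change_basis[OF chart c(1) U(1) vf pU(1) U(3)] lc lin_comb_row forall_3 by simp
    then show ?thesis by blast
  qed
  then have "(m' ** transpose P) $ i = (adj3 P ** m) $ i" for i using inj by blast
  then have "m' ** transpose P = adj3 P ** m" by (simp add: vec_eq_iff)
  then show ?thesis using that P adj3_relation by blast
qed

text \<open>The points near which some basis has bracket matrix \<open>m\<close> form an open set.
  So does the complement: if the domain \<open>U\<close> of any basis meets the set, the constant
  \<open>P\<close> found at a common point can be applied on all of \<open>U\<close>, which brings
  every point of \<open>U\<close> into the set.\<close>

lemma brackets_spread:
  fixes \<A> :: "'a::topological_space chart set"
  assumes conn: "connected (UNIV :: 'a set)" and atlas: "oriented_atlas \<A>" and adm: "admits_maximal_transitive_G3 \<A> g"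
    and start: "open U0" "p0 \<in> U0" "maximal_transitive_G3_basis \<A> g U0 \<xi>0" "has_brackets \<A> U0 \<xi>0 m"
  shows "\<exists>U \<xi>. open U \<and> p \<in> U \<and> maximal_transitive_G3_basis \<A> g U \<xi> \<and> has_brackets \<A> U \<xi> m"
proof -
  define Q where "Q = {p. \<exists>U \<xi>. open U \<and> p \<in> U \<and> maximal_transitive_G3_basis \<A> g U \<xi> \<and> has_brackets \<A> U \<xi> m}"
  have "open Q"
    unfolding open_subopen[of Q]
  proof
    fix q assume "q \<in> Q"
    then obtain U \<xi> where U: "open U" "q \<in> U" "maximal_transitive_G3_basis \<A> g U \<xi>" "has_brackets \<A> U \<xi> m"
      unfolding Q_def by auto
    then have "U \<subseteq> Q" unfolding Q_def by auto
    then show "\<exists>T. open T \<and> q \<in> T \<and> T \<subseteq> Q" using U by auto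
  qed
  moreover have "open (- Q)"
    unfolding open_subopen[of "- Q"]
  proof
    fix q assume q: "q \<in> - Q"
    obtain U \<xi> where U: "open U" "q \<in> U" "maximal_transitive_G3_basis \<A> g U \<xi>"
      using adm unfolding admits_maximal_transitive_G3_def by blast
    then have basis: "G3_basis \<A> g U \<xi>" unfolding maximal_transitive_G3_basis_def by blast
    then obtain m1 where m1: "has_brackets \<A> U \<xi> m1" using G3_basis_has_brackets by blast
    have vf: "vector_field \<A> U (\<xi> i)" for i
      using basis unfolding G3_basis_def killing_field_def by blast
    have "U \<inter> Q = {}"
    proof (rule ccontr)
      assume "U \<inter> Q \<noteq> {}"
      then obtain r U' \<xi>' where r: "r \<in> U" "r \<in> U'" and U': "open U'" "maximal_transitive_G3_basis \<A> g U' \<xi>'" "has_brackets \<A> U' \<xi>' m"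
        unfolding Q_def by blast
      obtain P where P: "det P \<noteq> 0" "P ** m ** transpose P = det P *\<^sub>R m1"
        by (rule germ_relation[OF atlas U(1,3) m1 U' r])
      have "q \<in> Q" unfolding Q_def
        using U(1,2) change_basis_maximal[OF atlas U(1,3) P(1)] change_basis_has_brackets[OF atlas U(1) vf m1 P] by auto
      then show False using q by blast
    qed
    then show "\<exists>T. open T \<and> q \<in> T \<and> T \<subseteq> - Q" using U by blast
  qed
  moreover have "p0 \<in> Q" unfolding Q_def using start by auto
  ultimately have "Q = UNIV"
    using connectedD[OF conn, of Q "- Q"] by auto
  then have "p \<in> Q" by simp
  then show ?thesis unfolding Q_def by simp
qed

section \<open>Normal forms of the brackets\<close>

text \<open>Gram-Schmidt for the inner product of \<open>G\<close>. The third vector is the cross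
  product of the covectors of \<open>v1\<close> and \<open>v2\<close>, hence orthogonal to both. In
  dimension three \<open>- P\<close> has the opposite determinant, which settles the
  orientation.\<close>

lemma exists_ON_frame:
  fixes G :: "real^3^3"
  assumes sym: "transpose G = G" and pos: "\<And>v. v \<noteq> 0 \<Longrightarrow> v \<bullet> (G *v v) > 0"
  obtains P where "transpose P ** G ** P = mat 1" "det P > 0"
proof -
  define B where "B u v = u \<bullet> (G *v v)" for u v
  have B_sym: "B u v = B v u" for u v
    unfolding B_def by (metis dot_lmul_matrix inner_commute sym transpose_matrix_vector)
  have normalize: "\<exists>k. B (k *\<^sub>R w) (k *\<^sub>R w) = 1" if "w \<noteq> 0" for w
  proof -
    have "B w w > 0" using pos[OF that] by (simp add: B_def)
    then show ?thesis
      by (intro exI[of _ "1 / sqrt (B w w)"]) (simp add: B_def matrix_vector_mult_scaleR power2_eq_square[symmetric] field_simps)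
  qed
  have "axis 1 1 \<noteq> (0::real^3)" by simp
  then obtain k1 where k1: "B (k1 *\<^sub>R axis 1 1) (k1 *\<^sub>R axis 1 1) = 1" using normalize by blast
  define v1 where "v1 = k1 *\<^sub>R (axis 1 1 :: real^3)"
  obtain w2 where w2: "w2 \<noteq> 0" "orthogonal (G *v v1) w2"
    using orthogonal_to_vector_exists[of "G *v v1"] by auto
  obtain k2 where k2: "B (k2 *\<^sub>R w2) (k2 *\<^sub>R w2) = 1" using normalize w2 by blast
  define v2 where "v2 = k2 *\<^sub>R w2"
  have B11: "B v1 v1 = 1" and B22: "B v2 v2 = 1" using k1 k2 by (simp_all add: v1_def v2_def)
  have B21: "B v2 v1 = 0" using w2(2) by (simp add: B_def v2_def orthogonal_def inner_commute)
  define w3 where "w3 = cross3 (G *v v1) (G *v v2)"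
  \<comment> \<open>This is the Gram determinant of \<open>v1\<close> and \<open>v2\<close>; it
    shows that \<open>w3\<close> is not zero.\<close>
  have "cross3 v1 v2 \<bullet> w3 = 1"
    unfolding w3_def dot_cross using B11 B22 B21 B_sym[of v1 v2] by (simp add: B_def)
  then have w3: "w3 \<noteq> 0" by auto
  obtain k3 where k3: "B (k3 *\<^sub>R w3) (k3 *\<^sub>R w3) = 1" using normalize w3 by blast
  define v3 where "v3 = k3 *\<^sub>R w3"
  have B33: "B v3 v3 = 1" using k3 by (simp add: v3_def)
  have B31: "B v3 v1 = 0" "B v3 v2 = 0"
    by (simp_all add: B_def v3_def w3_def inner_commute dot_cross_self)
  define P where "P = transpose (vector [v1, v2, v3] :: real^3^3)"
  have col: "(transpose P ** G ** P) $ i $ j = B (column i P) (column j P)" for i j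
    by (simp add: B_def matrix_matrix_mult_def matrix_vector_mult_def transpose_def column_def inner_vec_def sum_3 algebra_simps)
  have cols: "column 1 P = v1" "column 2 P = v2" "column 3 P = v3"
    by (simp_all add: P_def column_def transpose_def vec_eq_iff)
  have ON: "transpose P ** G ** P = mat 1"
    unfolding vec_eq_iff col forall_3 cols mat_def
    using B11 B22 B33 B21 B31 B_sym by simp
  have "det P * det G * det P = 1" using arg_cong[OF ON, of det] by (simp add: det_mul)
  then have "det P \<noteq> 0" by auto
  show ?thesis
  proof (cases "det P > 0")
    case True
    then show ?thesis using that ON by blast
  next
    case False
    have "transpose (- P) = - transpose P" by (simp add: transpose_def vec_eq_iff)
    then have "transpose (- P) ** G ** (- P) = mat 1"
      using ON by (simp add: matrix_ring_simps)
    moreover have "det (- P) > 0" using False \<open>det P \<noteq> 0\<close> by (simp add: det_3 algebra_simps)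
    ultimately show ?thesis using that by blast
  qed
qed

text \<open>At \<open>R\<close> and \<open>- R\<close> the cubic term dominates the others, so the
  polynomial changes sign in between.\<close>

lemma cubic_root:
  fixes a b c :: real
  shows "\<exists>x. x^3 + a * x\<^sup>2 + b * x + c = 0"
proof -
  define f where "f x = x^3 + a * x\<^sup>2 + b * x + c" for x
  define R where "R = 1 + \<bar>a\<bar> + \<bar>b\<bar> + \<bar>c\<bar>"
  have R: "R \<ge> 1" by (simp add: R_def)
  have bound: "\<bar>a * x\<^sup>2 + b * x + c\<bar> < R^3" if "\<bar>x\<bar> = R" for x
  proof -
    have "1 \<le> R\<^sup>2" using one_le_power[OF R] .
    have "R * 1 \<le> R * R" using R by (intro mult_left_mono) auto
    then have "R \<le> R\<^sup>2" by (simp add: power2_eq_square)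
    with \<open>1 \<le> R\<^sup>2\<close> have "\<bar>b\<bar> * R \<le> \<bar>b\<bar> * R\<^sup>2" "\<bar>c\<bar> * 1 \<le> \<bar>c\<bar> * R\<^sup>2"
      using mult_left_mono[of R "R\<^sup>2" "\<bar>b\<bar>"] mult_left_mono[of 1 "R\<^sup>2" "\<bar>c\<bar>"] by simp_all
    moreover have "x\<^sup>2 = R\<^sup>2" using arg_cong[OF that, of "\<lambda>t. t\<^sup>2"] by simp
    then have "\<bar>a * x\<^sup>2\<bar> = \<bar>a\<bar> * R\<^sup>2" "\<bar>b * x\<bar> = \<bar>b\<bar> * R"
      using that by (simp_all add: abs_mult)
    ultimately have "\<bar>a * x\<^sup>2 + b * x + c\<bar> \<le> (\<bar>a\<bar> + \<bar>b\<bar> + \<bar>c\<bar>) * R\<^sup>2"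
      by (simp add: algebra_simps) linarith
    also have "\<dots> = R^3 - R\<^sup>2" by (simp add: R_def power2_eq_square power3_eq_cube algebra_simps)
    also have "\<dots> < R^3" using R by simp
    finally show ?thesis .
  qed
  have "f (-R) \<le> 0" "0 \<le> f R"
    using bound[of R] bound[of "-R"] R by (auto simp: f_def)
  moreover have "-R \<le> R" using R by simp
  moreover have "continuous_on {-R..R} f" unfolding f_def by (intro continuous_intros)
  ultimately show ?thesis using IVT'[of f "-R" 0 R] by (auto simp: f_def)
qed

lemma exists_eigenvector:
  fixes M :: "real^3^3"
  obtains \<mu> v where "v \<noteq> 0" "M *v v = \<mu> *\<^sub>R v"
proof -
  \<comment> \<open>The sum of the principal 2 by 2 minors, which is the middle coefficient of the
    characteristic polynomial.\<close>
  define e2 where "e2 = M$1$1 * M$2$2 + M$1$1 * M$3$3 + M$2$2 * M$3$3 - M$1$2 * M$2$1 - M$1$3 * M$3$1 - M$2$3 * M$3$2"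
  obtain \<mu> where "\<mu>^3 + (- trace M) * \<mu>\<^sup>2 + e2 * \<mu> + (- det M) = 0"
    using cubic_root by blast
  moreover have "det (M - \<mu> *\<^sub>R mat 1) = - (\<mu>^3 + (- trace M) * \<mu>\<^sup>2 + e2 * \<mu> + (- det M))"
    by (simp add: det_3 trace_def sum_3 e2_def mat_def power2_eq_square power3_eq_cube algebra_simps)
  ultimately have "\<not> invertible (M - \<mu> *\<^sub>R mat 1)" by (simp add: invertible_det_nz)
  then obtain v where "v \<noteq> 0" "(M - \<mu> *\<^sub>R mat 1) *v v = 0"
    unfolding invertible_left_inverse matrix_left_invertible_ker by blast
  then have "M *v v = \<mu> *\<^sub>R v"
    by (simp add: matrix_vector_mult_diff_rdistrib scaleR_matrix_vector_assoc[symmetric])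
  then show ?thesis using that \<open>v \<noteq> 0\<close> by blast
qed

text \<open>The angle is half the polar angle \<open>t\<close> of the point with coordinates
  \<open>- d\<close> and \<open>k\<close>: the double angle formulas reduce the claim to
  \<open>k * cos t + d * sin t = 0\<close>.\<close>

lemma plane_rotation:
  fixes k d :: real
  obtains u v where "u\<^sup>2 + v\<^sup>2 = 1" "k * (u\<^sup>2 - v\<^sup>2) + 2 * d * u * v = 0"
proof (cases "k = 0 \<and> d = 0")
  case True
  then show ?thesis using that[of 1 0] by simp
next
  case False
  define r where "r = sqrt (k\<^sup>2 + d\<^sup>2)"
  have "k\<^sup>2 + d\<^sup>2 > 0" using False by (simp add: sum_power2_gt_zero_iff)
  then have r: "r > 0" "r\<^sup>2 = k\<^sup>2 + d\<^sup>2" by (auto simp: r_def)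
  have "(- d / r)\<^sup>2 + (k / r)\<^sup>2 = (k\<^sup>2 + d\<^sup>2) / r\<^sup>2"
    by (simp add: power_divide add_divide_distrib)
  also have "\<dots> = 1" unfolding r(2)[symmetric] using r(1) by simp
  finally have "(- d / r)\<^sup>2 + (k / r)\<^sup>2 = 1" .
  then obtain t where t: "- d / r = cos t" "k / r = sin t" using sincos_total_2pi by metis
  define u v where "u = cos (t / 2)" and "v = sin (t / 2)"
  have "cos t = u\<^sup>2 - v\<^sup>2" "sin t = 2 * u * v"
    using cos_double[of "t / 2"] sin_double[of "t / 2"] by (simp_all add: u_def v_def)
  with t r have "u\<^sup>2 - v\<^sup>2 = - d / r" "2 * u * v = k / r" by simp_all
  then have "k * (u\<^sup>2 - v\<^sup>2) + d * (2 * u * v) = 0" by simp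
  moreover have "u\<^sup>2 + v\<^sup>2 = 1" by (simp add: u_def v_def)
  ultimately show ?thesis using that by (simp add: mult_ac)
qed

text \<open>The skew part of \<open>M\<close> is the vector \<open>w\<close>, and \<open>transpose M *v w = 0\<close> is the Jacobi identity.\<close>

lemma bianchi_normal_form:
  fixes M :: "real^3^3"
  defines "w \<equiv> vector [M$2$3 - M$3$2, M$3$1 - M$1$3, M$1$2 - M$2$1] :: real^3"
  assumes jac: "transpose M *v w = 0"
  obtains Q a n1 n2 n3 where "transpose Q ** Q = mat 1" "det Q = 1"
    "transpose Q ** M ** Q = bianchi_matrix a n1 n2 n3" "a * n1 = 0"
proof -
  \<comment> \<open>A common eigenvector of \<open>M\<close> and its transpose: any eigenvector if
    \<open>M\<close> is symmetric, otherwise \<open>w\<close>, which the skew part annihilates and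
    the Jacobi identity puts in the kernel.\<close>
  obtain v \<mu> where v: "v \<noteq> 0" "M *v v = \<mu> *\<^sub>R v" "transpose M *v v = \<mu> *\<^sub>R v" and \<mu>: "\<mu> = 0 \<or> w = 0"
  proof (cases "w = 0")
    case True
    then have "transpose M = M"
      by (simp add: w_def vec_eq_iff forall_3 transpose_def)
    with exists_eigenvector[of M] that True show ?thesis by metis
  next
    case False
    have "M *v w = transpose M *v w"
      by (simp add: w_def vec_eq_iff forall_3 matrix_vector_mult_def transpose_def sum_3 algebra_simps)
    with that[of w 0] False jac show ?thesis by simp
  qed
  define e where "e = (1 / norm v) *\<^sub>R v"
  have e: "norm e = 1" "M *v e = \<mu> *\<^sub>R e" "transpose M *v e = \<mu> *\<^sub>R e"
    using v by (simp_all add: e_def matrix_vector_mult_scaleR)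
  \<comment> \<open>Rotating the first axis to \<open>e\<close> splits off the first row and column,
    because \<open>e\<close> is an eigenvector of both \<open>M\<close> and its transpose.\<close>
  obtain Q1 where Q1: "rotation_matrix Q1" "Q1 *v axis 1 1 = e"
    using rotation_matrix_exists_basis[of e 1] e by auto
  have Q1o: "transpose Q1 ** Q1 = mat 1" "Q1 ** transpose Q1 = mat 1" "det Q1 = 1"
    using Q1(1) by (auto simp: rotation_matrix_def orthogonal_matrix_def)
  define M' where "M' = transpose Q1 ** M ** Q1"
  have Qe: "transpose Q1 *v e = axis 1 1"
    by (simp add: Q1(2)[symmetric] matrix_vector_mul_assoc Q1o)
  note Qe' = Qe[unfolded transpose_matrix_vector]
  have "M' *v axis 1 1 = \<mu> *\<^sub>R axis 1 1"
    unfolding M'_def by (simp add: matrix_vector_mul_assoc[symmetric] Q1(2) e Qe Qe' matrix_vector_mult_scaleR)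
  then have c: "M' $ 1 $ 1 = \<mu>" "M' $ 2 $ 1 = 0" "M' $ 3 $ 1 = 0"
    by (simp_all add: vec_eq_iff forall_3 matrix_vector_mult_def axis_def sum_3)
  have "transpose M' *v axis 1 1 = transpose Q1 *v (transpose M *v (Q1 *v axis 1 1))"
    unfolding M'_def by (simp only: matrix_transpose_mul transpose_transpose matrix_vector_mul_assoc matrix_mul_assoc)
  also have "\<dots> = \<mu> *\<^sub>R axis 1 1"
    by (simp only: Q1(2) e(3) matrix_vector_mult_scaleR Qe)
  finally have "transpose M' *v axis 1 1 = \<mu> *\<^sub>R axis 1 1" .
  then have r: "M' $ 1 $ 2 = 0" "M' $ 1 $ 3 = 0"
    by (simp_all add: vec_eq_iff forall_3 matrix_vector_mult_def axis_def sum_3 transpose_def)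
  \<comment> \<open>A rotation of the remaining plane diagonalizes the symmetric part of the 2 by 2
    block and leaves its skew part unchanged, so a single number \<open>a\<close> survives.\<close>
  obtain x y where xy: "x\<^sup>2 + y\<^sup>2 = 1"
    "((M'$2$3 + M'$3$2) / 2) * (x\<^sup>2 - y\<^sup>2) + 2 * ((M'$3$3 - M'$2$2) / 2) * x * y = 0"
    using plane_rotation by blast
  define Q2 :: "real^3^3" where "Q2 = vector [vector [1, 0, 0], vector [0, x, - y], vector [0, y, x]]"
  have Q2o: "transpose Q2 ** Q2 = mat 1" "det Q2 = 1"
    using xy(1) by (simp_all add: Q2_def vec_eq_iff forall_3 matrix_matrix_mult_def transpose_def sum_3 mat_def
        det_3 power2_eq_square algebra_simps)
  define M2 where "M2 = transpose Q2 ** M' ** Q2"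
  define a where "a = M2 $ 3 $ 2"
  have entries: "M2 $ 1 $ 1 = \<mu>" "M2 $ 1 $ 2 = 0" "M2 $ 1 $ 3 = 0" "M2 $ 2 $ 1 = 0" "M2 $ 3 $ 1 = 0"
    by (simp_all add: M2_def Q2_def matrix_matrix_mult_def transpose_def sum_3 c r)
  have "M2 $ 2 $ 3 + M2 $ 3 $ 2 = 0"
    using xy(2) by (simp add: M2_def Q2_def matrix_matrix_mult_def transpose_def sum_3 c r power2_eq_square field_simps)
  then have M2: "M2 = bianchi_matrix a \<mu> (M2 $ 2 $ 2) (M2 $ 3 $ 3)"
    using entries by (simp add: vec_eq_iff forall_3 bianchi_matrix_def a_def)
  have Q: "transpose (Q1 ** Q2) ** M ** (Q1 ** Q2) = M2"
    by (simp add: M2_def M'_def matrix_transpose_mul matrix_mul_assoc)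
  have "a * \<mu> = 0"
  proof (cases "w = 0")
    case True
    then have "transpose M = M"
      by (simp add: w_def vec_eq_iff forall_3 transpose_def)
    then have "transpose M2 = M2"
      unfolding Q[symmetric] by (simp add: matrix_transpose_mul transpose_transpose matrix_mul_assoc)
    from arg_cong[OF this, of "\<lambda>M. M $ 2 $ 3"] have "M2 $ 3 $ 2 = M2 $ 2 $ 3"
      by (simp add: transpose_def)
    then show ?thesis using \<open>M2 $ 2 $ 3 + M2 $ 3 $ 2 = 0\<close> by (simp add: a_def)
  qed (use \<mu> in simp)
  moreover have "transpose (Q1 ** Q2) ** (Q1 ** Q2) = transpose Q2 ** (transpose Q1 ** Q1) ** Q2"
    by (simp add: matrix_transpose_mul matrix_mul_assoc)
  then have "transpose (Q1 ** Q2) ** (Q1 ** Q2) = mat 1" using Q1o Q2o by simp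
  moreover have "det (Q1 ** Q2) = 1" by (simp add: det_mul Q1o Q2o)
  ultimately show ?thesis using that[of "Q1 ** Q2" a \<mu>] Q M2 by metis
qed

section \<open>Bracket matrices of the listed types and their equivalence\<close>

definition brackets_matrix :: "real^3 \<Rightarrow> real^3 \<Rightarrow> real^3 \<Rightarrow> real^3^3" where
  "brackets_matrix u v w = vector [v, w, u]"

text \<open>
  Two bracket matrices are related in this way iff they describe the same Lie algebra in two bases,
  \<open>P\<close> being the matrix of the change of basis.
\<close>

definition bracket_equiv :: "real^3^3 \<Rightarrow> real^3^3 \<Rightarrow> bool" where
  "bracket_equiv m' m \<longleftrightarrow> (\<exists>P. det P \<noteq> 0 \<and> P ** m' ** transpose P = det P *\<^sub>R m)"

definition "mIV = brackets_matrix (vector [0, 0, 0]) (vector [1, 1, 0]) (vector [-1, 0, 0])"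
definition "mVI q = brackets_matrix (vector [0, 0, 0]) (vector [0, q, 0]) (vector [-1, 0, 0])"
definition "mVII q = brackets_matrix (vector [0, 0, 0]) (vector [-1, q, 0]) (vector [0, -1, 0])"
definition "mVIII = brackets_matrix (vector [1, 0, 0]) (vector [0, 0, 1]) (vector [0, -2, 0])"
definition "mIX = brackets_matrix (vector [0, 0, 1]) (vector [1, 0, 0]) (vector [0, 1, 0])"

lemmas m_defs = mIV_def mVI_def mVII_def mVIII_def mIX_def brackets_matrix_def

section \<open>Invariants of the normal form forced by each type\<close>

lemma det_scaleR3: "det (k *\<^sub>R A) = k^3 * det A" for A :: "real^3^3"
  by (simp add: det_3 power3_eq_cube algebra_simps)

lemma det_bianchi: "a * n1 = 0 \<Longrightarrow> det (bianchi_matrix a n1 n2 n3) = n1 * n2 * n3"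
  by (auto simp: det_3 bianchi_matrix_def)

text \<open>
  The span of \<open>\<xi> 1\<close> and \<open>\<xi> 2\<close> contains the derived algebra here; \<open>\<Delta>\<close> is the determinant of the symmetric part.
\<close>

lemma planar_invariants:
  assumes eq: "bracket_equiv (vector [vector [\<alpha>, \<beta>, 0], vector [\<gamma>, \<delta>, 0], vector [0, 0, 0]]) (bianchi_matrix a n1 n2 n3)"
    (is "bracket_equiv ?m _")
    and a: "a * n1 = 0"
  defines "\<Delta> \<equiv> \<alpha> * \<delta> - ((\<beta> + \<gamma>) / 2)\<^sup>2"
  shows "n1 * n2 * n3 = 0" "\<exists>k>0. n1 * n2 + n1 * n3 + n2 * n3 = k * \<Delta>" "a = 0 \<longleftrightarrow> \<beta> = \<gamma>"
    "\<alpha> \<noteq> 0 \<Longrightarrow> \<beta> = - \<gamma> \<Longrightarrow> \<delta> = 0 \<Longrightarrow> n1 + n2 + n3 \<noteq> 0"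
proof -
  obtain P where P: "det P \<noteq> 0" and PP: "P ** ?m ** transpose P = det P *\<^sub>R bianchi_matrix a n1 n2 n3"
    using eq unfolding bracket_equiv_def by blast
  define d where "d = det P"
  \<comment> \<open>\<open>x\<close> and \<open>y\<close> are the first two columns of
    \<open>P\<close>; the third drops out of the product because the third row and column of the
    matrix vanish.\<close>
  define x where "x i = P $ i $ 1" for i
  define y where "y i = P $ i $ 2" for i
  define W where "W i j = x i * y j - x j * y i" for i j
  define E where "E i j = \<alpha> * x i * x j + \<beta> * x i * y j + \<gamma> * y i * x j + \<delta> * y i * y j" for i j
  have ent: "E i j = d * bianchi_matrix a n1 n2 n3 $ i $ j" for i j
    using arg_cong[OF PP, of "\<lambda>M. M $ i $ j"]
    by (simp add: E_def d_def x_def y_def matrix_matrix_mult_def transpose_def sum_3 algebra_simps)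
  have d: "d \<noteq> 0" using P by (simp add: d_def)
  have dW: "d = P$3$3 * W 1 2 - P$2$3 * W 1 3 + P$1$3 * W 2 3"
    by (simp add: d_def W_def x_def y_def det_3 algebra_simps)
  have "det ?m = 0" by (simp add: det_3)
  then have "det (P ** ?m ** transpose P) = 0"
    by (simp add: det_mul)
  then show "n1 * n2 * n3 = 0"
    unfolding PP det_scaleR3 det_bianchi[OF a] using P by simp
  have B: "E 1 1 = d * n1" "E 2 2 = d * n2" "E 3 3 = d * n3" "E 1 2 = 0" "E 2 1 = 0" "E 1 3 = 0" "E 3 1 = 0"
    "E 2 3 = - (d * a)" "E 3 2 = d * a"
    by (simp_all add: ent bianchi_matrix_def)
  have \<Delta>: "4 * \<Delta> = 4 * \<alpha> * \<delta> - (\<beta> + \<gamma>)\<^sup>2"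
    by (simp add: \<Delta>_def power_divide)
  \<comment> \<open>Cauchy-Binet: a principal minor of the symmetrized form is \<Delta> times the
    square of \<open>W i j\<close>. Summing over the three pairs compares \<Delta> with the second
    symmetric polynomial.\<close>
  have gram: "4 * \<Delta> * (W i j)\<^sup>2 = 4 * (E i i * E j j) - (E i j + E j i)\<^sup>2" for i j
    unfolding \<Delta> by (simp add: W_def E_def power2_eq_square algebra_simps)
  define k where "k = (W 1 2)\<^sup>2 + (W 1 3)\<^sup>2 + (W 2 3)\<^sup>2"
  define X where "X = n1 * n2 + n1 * n3 + n2 * n3"
  have "4 * \<Delta> * k = 4 * \<Delta> * (W 1 2)\<^sup>2 + 4 * \<Delta> * (W 1 3)\<^sup>2 + 4 * \<Delta> * (W 2 3)\<^sup>2"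
    by (simp add: k_def algebra_simps)
  also have "\<dots> = 4 * (d\<^sup>2 * X)"
    unfolding gram B by (simp add: power2_eq_square X_def algebra_simps)
  finally have "d\<^sup>2 * X = k * \<Delta>" by (simp add: mult.commute)
  then have e2: "X = k / d\<^sup>2 * \<Delta>"
    using d by (simp add: eq_divide_eq mult.commute)
  have W: "W 1 2 \<noteq> 0 \<or> W 1 3 \<noteq> 0 \<or> W 2 3 \<noteq> 0" using d dW by auto
  have sq: "(u::real)\<^sup>2 + v\<^sup>2 + w\<^sup>2 > 0" if "u \<noteq> 0 \<or> v \<noteq> 0 \<or> w \<noteq> 0" for u v w
  proof -
    have "u\<^sup>2 > 0 \<or> v\<^sup>2 > 0 \<or> w\<^sup>2 > 0" using that by simp
    then show ?thesis using zero_le_power2[of u] zero_le_power2[of v] zero_le_power2[of w] by linarith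
  qed
  have "k / d\<^sup>2 > 0" using sq[OF W] d by (simp add: k_def)
  then show "\<exists>k>0. n1 * n2 + n1 * n3 + n2 * n3 = k * \<Delta>"
    using e2 unfolding X_def by blast
  \<comment> \<open>The skew part transforms by the same minors, which do not all vanish since
    \<open>P\<close> is invertible.\<close>
  have "(\<beta> - \<gamma>) * W i j = E i j - E j i" for i j
    by (simp add: W_def E_def algebra_simps)
  from this[of 1 2] this[of 1 3] this[of 2 3]
  have skew: "(\<beta> - \<gamma>) * W 1 2 = 0" "(\<beta> - \<gamma>) * W 1 3 = 0" "2 * d * a = - ((\<beta> - \<gamma>) * W 2 3)"
    unfolding B by simp_all
  show "a = 0 \<longleftrightarrow> \<beta> = \<gamma>"
  proof
    assume "a = 0"
    then have "(\<beta> - \<gamma>) * W 2 3 = 0" using skew(3) by simp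
    then show "\<beta> = \<gamma>" using skew(1,2) W by auto
  next
    assume "\<beta> = \<gamma>"
    then show "a = 0" using skew(3) d by simp
  qed
  assume *: "\<alpha> \<noteq> 0" "\<beta> = - \<gamma>" "\<delta> = 0"
  \<comment> \<open>The symmetric part has rank one here, so its trace is \<alpha> times a sum of
    squares.\<close>
  then have "d * (n1 + n2 + n3) = \<alpha> * ((x 1)\<^sup>2 + (x 2)\<^sup>2 + (x 3)\<^sup>2)"
    unfolding distrib_left B(1-3)[symmetric] by (simp add: E_def power2_eq_square algebra_simps)
  moreover have "x 1 \<noteq> 0 \<or> x 2 \<noteq> 0 \<or> x 3 \<noteq> 0" using W by (auto simp: W_def)
  from sq[OF this] have "(x 1)\<^sup>2 + (x 2)\<^sup>2 + (x 3)\<^sup>2 \<noteq> 0" by simp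
  ultimately show "n1 + n2 + n3 \<noteq> 0" using * by auto
qed

text \<open>If sum and product are positive, the numbers are roots of a monic cubic with
  coefficients of alternating sign, which has no root \<open>\<le> 0\<close>. If both are negative,
  this applies to the negated numbers.\<close>

lemma same_sign:
  fixes n1 n2 n3 :: real
  assumes e2: "n1 * n2 + n1 * n3 + n2 * n3 > 0" and e13: "(n1 + n2 + n3) * (n1 * n2 * n3) > 0"
  shows "n1 * n2 > 0 \<and> n1 * n3 > 0 \<and> n2 * n3 > 0"
proof -
  have pos: "x > 0"
    if "x * y + x * z + y * z > 0" "x + y + z > 0" "x * y * z > 0" for x y z :: real
  proof (rule ccontr)
    assume "\<not> x > 0"
    then have "0 \<le> - x" by simp
    have "0 = (- x)^3 + (x + y + z) * (- x)\<^sup>2 + (x * y + x * z + y * z) * (- x) + x * y * z"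
      by (simp add: power2_eq_square power3_eq_cube algebra_simps)
    also have "\<dots> > 0"
    proof -
      have "0 \<le> (- x)^3" using \<open>0 \<le> - x\<close> by (rule zero_le_power)
      moreover have "0 \<le> (x + y + z) * (- x)\<^sup>2" using that(2) by (intro mult_nonneg_nonneg) auto
      moreover have "0 \<le> (x * y + x * z + y * z) * (- x)"
        using that(1) \<open>0 \<le> - x\<close> by (intro mult_nonneg_nonneg) linarith+
      ultimately show ?thesis using that(3) by linarith
    qed
    finally show False by simp
  qed
  consider "n1 + n2 + n3 > 0" "n1 * n2 * n3 > 0" | "n1 + n2 + n3 < 0" "n1 * n2 * n3 < 0"
    using e13 by (auto simp: zero_less_mult_iff)
  then show ?thesis
  proof cases
    case 1
    then have "n1 > 0" "n2 > 0" "n3 > 0"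
      using pos[of n1 n2 n3] pos[of n2 n1 n3] pos[of n3 n1 n2] e2 by (simp_all add: algebra_simps)
    then show ?thesis by simp
  next
    case 2
    then have "- n1 > 0" "- n2 > 0" "- n3 > 0"
      using pos[of "- n1" "- n2" "- n3"] pos[of "- n2" "- n1" "- n3"] pos[of "- n3" "- n1" "- n2"] e2
      by (simp_all add: algebra_simps)
    then show ?thesis by (simp add: mult_neg_neg)
  qed
qed

text \<open>The matrix of type IX is the identity, so \<open>det P\<close> times the normal form is
  \<open>P ** transpose P\<close>. Its diagonal is positive, hence \<open>n1\<close>,
  \<open>n2\<close>, \<open>n3\<close> all have the sign of \<open>det P\<close>.\<close>

lemma equiv_IX_D:
  assumes "bracket_equiv mIX (bianchi_matrix a n1 n2 n3)"
  shows "n1 * n2 + n1 * n3 + n2 * n3 > 0" "(n1 + n2 + n3) * (n1 * n2 * n3) > 0"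
proof -
  obtain P where P: "det P \<noteq> 0" and PP: "P ** mIX ** transpose P = det P *\<^sub>R bianchi_matrix a n1 n2 n3"
    using assms unfolding bracket_equiv_def by blast
  have "mIX = mat 1" by (simp add: m_defs vec_eq_iff forall_3 mat_def)
  note PP = PP[unfolded this matrix_mul_rid]
  have ent: "(\<Sum>k\<in>UNIV. (P $ i $ k)\<^sup>2) = det P * bianchi_matrix a n1 n2 n3 $ i $ i" for i
    using arg_cong[OF PP, of "\<lambda>M. M $ i $ i"]
    by (simp add: matrix_matrix_mult_def transpose_def power2_eq_square)
  have pos: "0 < (\<Sum>k\<in>UNIV. (P $ i $ k)\<^sup>2)" for i
  proof -
    have "P $ i \<noteq> 0"
    proof
      assume "P $ i = 0"
      then have "row i P = 0" by (simp add: row_def vec_eq_iff)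
      then show False using P det_zero_row by blast
    qed
    then obtain k where "P $ i $ k \<noteq> 0" by (auto simp: vec_eq_iff)
    then have "0 < (P $ i $ k)\<^sup>2" by simp
    then show ?thesis by (intro sum_pos2[of _ k]) auto
  qed
  define d where "d = det P"
  have n: "d * n1 > 0" "d * n2 > 0" "d * n3 > 0"
    using pos[of 1] pos[of 2] pos[of 3] unfolding ent d_def by (simp_all add: bianchi_matrix_def)
  have "n1 > 0 \<and> n2 > 0 \<and> n3 > 0 \<or> n1 < 0 \<and> n2 < 0 \<and> n3 < 0"
    using n by (auto simp: zero_less_mult_iff)
  then have p: "n1 * n2 > 0" "n1 * n3 > 0" "n2 * n3 > 0" and nz: "n1 \<noteq> 0" "n2 \<noteq> 0" "n3 \<noteq> 0"
    by (auto simp: zero_less_mult_iff)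
  show "n1 * n2 + n1 * n3 + n2 * n3 > 0" using p by simp
  have "0 < n1\<^sup>2 * (n2 * n3) + n2\<^sup>2 * (n1 * n3) + n3\<^sup>2 * (n1 * n2)"
    using nz by (intro add_pos_pos mult_pos_pos[OF _ p(1)] mult_pos_pos[OF _ p(2)] mult_pos_pos[OF _ p(3)]) simp_all
  then show "(n1 + n2 + n3) * (n1 * n2 * n3) > 0"
    by (simp add: power2_eq_square algebra_simps)
qed

text \<open>The form of type VIII is nondegenerate and indefinite, and so is every form congruent to
  it; equal signs of \<open>n1\<close>, \<open>n2\<close>, \<open>n3\<close> would make it
  semidefinite.\<close>

lemma equiv_VIII_D:
  assumes "bracket_equiv mVIII (bianchi_matrix a n1 n2 n3)" and a: "a * n1 = 0"
  shows "n1 * n2 * n3 \<noteq> 0" "\<not> (n1 * n2 + n1 * n3 + n2 * n3 > 0 \<and> (n1 + n2 + n3) * (n1 * n2 * n3) > 0)"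
proof -
  obtain P where P: "det P \<noteq> 0" and PP: "P ** mVIII ** transpose P = det P *\<^sub>R bianchi_matrix a n1 n2 n3"
    using assms unfolding bracket_equiv_def by blast
  define d where "d = det P"
  have "det mVIII = 2" by (simp add: m_defs det_3)
  then have "det (P ** mVIII ** transpose P) \<noteq> 0"
    using P by (simp add: det_mul)
  then show "n1 * n2 * n3 \<noteq> 0"
    unfolding PP det_scaleR3 det_bianchi[OF a] by auto
  show "\<not> (n1 * n2 + n1 * n3 + n2 * n3 > 0 \<and> (n1 + n2 + n3) * (n1 * n2 * n3) > 0)"
  proof
    assume "n1 * n2 + n1 * n3 + n2 * n3 > 0 \<and> (n1 + n2 + n3) * (n1 * n2 * n3) > 0"
    then have "n1 * n2 > 0 \<and> n1 * n3 > 0 \<and> n2 * n3 > 0" using same_sign by blast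
    then have "n1 > 0 \<and> n2 > 0 \<and> n3 > 0 \<or> n1 < 0 \<and> n2 < 0 \<and> n3 < 0"
      by (auto simp: zero_less_mult_iff)
    then have sign: "d * n1 \<ge> 0 \<and> d * n2 \<ge> 0 \<and> d * n3 \<ge> 0 \<or> d * n1 \<le> 0 \<and> d * n2 \<le> 0 \<and> d * n3 \<le> 0"
      by (cases "d > 0") (auto simp: zero_le_mult_iff mult_le_0_iff)
    have form: "w \<bullet> (mVIII *v w) = d * n1 * (v$1)\<^sup>2 + d * n2 * (v$2)\<^sup>2 + d * n3 * (v$3)\<^sup>2" if "transpose P *v v = w" for v w
    proof -
      have "w \<bullet> (mVIII *v w) = v \<bullet> ((P ** mVIII ** transpose P) *v v)"
        unfolding that[symmetric]
        by (simp add: inner_vec_def matrix_vector_mult_def matrix_matrix_mult_def transpose_def sum_3 algebra_simps)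
      then show ?thesis unfolding PP
        by (simp add: inner_vec_def matrix_vector_mult_def bianchi_matrix_def sum_3 d_def power2_eq_square algebra_simps)
    qed
    have ex: "\<exists>v. transpose P *v v = w" for w
    proof -
      have "det (transpose P) \<noteq> 0" using P by simp
      from matrix_inv_works(1)[OF this] show ?thesis
        by (intro exI[of _ "matrix_inv (transpose P) *v w"]) (simp add: matrix_vector_mul_assoc)
    qed
    \<comment> \<open>Preimages of test vectors on which the form of type VIII takes the values
      \<open>- 2\<close> and \<open>2\<close>.\<close>
    obtain v where v: "transpose P *v v = vector [0, 1, 0]" using ex by blast
    obtain v' where v': "transpose P *v v' = vector [1, 0, 1]" using ex by blast
    have v2: "-2 = d * n1 * (v$1)\<^sup>2 + d * n2 * (v$2)\<^sup>2 + d * n3 * (v$3)\<^sup>2"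
      using form[OF v] by (simp add: m_defs inner_vec_def matrix_vector_mult_def sum_3)
    have v2': "2 = d * n1 * (v'$1)\<^sup>2 + d * n2 * (v'$2)\<^sup>2 + d * n3 * (v'$3)\<^sup>2"
      using form[OF v'] by (simp add: m_defs inner_vec_def matrix_vector_mult_def sum_3)
    from sign show False
    proof
      assume "d * n1 \<ge> 0 \<and> d * n2 \<ge> 0 \<and> d * n3 \<ge> 0"
      then have "0 \<le> d * n1 * (v$1)\<^sup>2 + d * n2 * (v$2)\<^sup>2 + d * n3 * (v$3)\<^sup>2"
        by (intro add_nonneg_nonneg mult_nonneg_nonneg[of "d * _"]) auto
      then show False using v2 by linarith
    next
      assume "d * n1 \<le> 0 \<and> d * n2 \<le> 0 \<and> d * n3 \<le> 0"
      then have "d * n1 * (v'$1)\<^sup>2 + d * n2 * (v'$2)\<^sup>2 + d * n3 * (v'$3)\<^sup>2 \<le> 0"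
        by (intro add_nonpos_nonpos mult_nonpos_nonneg[of "d * _"]) auto
      then show False using v2' by linarith
    qed
  qed
qed

text \<open>The cyclic permutation of the axes has determinant one. With it, the explicit
  equivalences for \<open>a = 0\<close> are only needed for one position of the exceptional
  entry.\<close>

lemma bracket_equiv_cycle:
  assumes "bracket_equiv m (bianchi_matrix 0 n2 n3 n1)"
  shows "bracket_equiv m (bianchi_matrix 0 n1 n2 n3)"
proof -
  obtain P where P: "det P \<noteq> 0" and PP: "P ** m ** transpose P = det P *\<^sub>R bianchi_matrix 0 n2 n3 n1"
    using assms unfolding bracket_equiv_def by blast
  define C :: "real^3^3" where "C = vector [vector [0, 0, 1], vector [1, 0, 0], vector [0, 1, 0]]"
  have C: "C ** bianchi_matrix 0 n2 n3 n1 ** transpose C = bianchi_matrix 0 n1 n2 n3" "det C = 1"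
    by (simp_all add: C_def bianchi_matrix_def vec_eq_iff forall_3 matrix_matrix_mult_def transpose_def sum_3 det_3)
  have "(C ** P) ** m ** transpose (C ** P) = C ** (P ** m ** transpose P) ** transpose C"
    by (simp add: matrix_transpose_mul matrix_mul_assoc)
  also have "\<dots> = det (C ** P) *\<^sub>R bianchi_matrix 0 n1 n2 n3"
    unfolding PP by (simp add: matrix_ring_simps C det_mul)
  finally show ?thesis unfolding bracket_equiv_def using P by (intro exI[of _ "C ** P"]) (simp add: det_mul C)
qed

section \<open>Explicit changes of basis from the listed types to the normal form\<close>

lemmas equiv_simps = matrix_matrix_mult_def transpose_def sum_3 bianchi_matrix_def m_defs forall_3 vec_eq_iff

lemma bracket_equivI:
  fixes P m m' :: "real^3^3"
  assumes "det P \<noteq> 0" "P ** m' ** transpose P = det P *\<^sub>R m"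
  shows "bracket_equiv m' m"
  unfolding bracket_equiv_def using assms by blast

text \<open>An invertible diagonal \<open>P\<close> has to satisfy \<open>x = y * z * n1\<close>,
  \<open>y = x * z * n2\<close> and \<open>z = x * y * n3\<close>; the normalizations of
  \<open>z\<close> and \<open>y\<close> solve this system.\<close>

lemma equiv_IX:
  assumes "n1 * n2 > 0" "n1 * n3 > 0"
  shows "bracket_equiv mIX (bianchi_matrix 0 n1 n2 n3)"
proof -
  define z where "z = 1 / sqrt (n1 * n2)"
  define y where "y = 1 / sqrt (n1 * n3)"
  define x where "x = y * z * n1"
  have z: "z\<^sup>2 * n1 * n2 = 1" "z \<noteq> 0" and y: "y\<^sup>2 * n1 * n3 = 1" "y \<noteq> 0"
    using assms by (auto simp: z_def y_def power_divide)
  have n1: "n1 \<noteq> 0" using assms by auto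
  have "x * z * n2 = y * (z\<^sup>2 * n1 * n2)" "x * y * n3 = z * (y\<^sup>2 * n1 * n3)"
    by (simp_all add: x_def power2_eq_square)
  then have eqs: "x = y * z * n1" "y = x * z * n2" "z = x * y * n3"
    using z(1) y(1) by (simp_all add: x_def)
  define P :: "real^3^3" where "P = vector [vector [x, 0, 0], vector [0, y, 0], vector [0, 0, z]]"
  define d where "d = x * y * z"
  have det: "det P = d" by (simp add: P_def det_3 d_def)
  show ?thesis
  proof (rule bracket_equivI)
    show "det P \<noteq> 0" using y z n1 by (simp add: det d_def x_def)
    have "d * n1 = x * x" by (simp add: d_def x_def)
    moreover have "d * n2 = y * (x * z * n2)" "d * n3 = z * (x * y * n3)" by (simp_all add: d_def)
    then have "d * n2 = y * y" "d * n3 = z * z" by (simp_all only: eqs(2,3)[symmetric])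
    ultimately show "P ** mIX ** transpose P = det P *\<^sub>R bianchi_matrix 0 n1 n2 n3"
      unfolding det by (simp add: P_def equiv_simps)
  qed
qed

text \<open>The form of type VIII is \<open>2 * w1 * w3 - 2 * w2^2\<close>. The rows of
  \<open>P\<close> are orthogonal for it, the first with positive and the others with negative
  square; the scales are matched to the determinant as for type IX.\<close>

lemma equiv_VIII:
  assumes "n1 * n2 < 0" "n1 * n3 < 0"
  shows "bracket_equiv mVIII (bianchi_matrix 0 n1 n2 n3)"
proof -
  define z where "z = 1 / sqrt (- (n1 * n2))"
  define y where "y = 1 / sqrt (- (n1 * n3))"
  define x where "x = y * z * n1"
  have z: "z\<^sup>2 * n1 * n2 = - 1" "z \<noteq> 0" and y: "y\<^sup>2 * n1 * n3 = - 1" "y \<noteq> 0"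
    using assms by (auto simp: z_def y_def power_divide)
  have n1: "n1 \<noteq> 0" using assms by auto
  have "x * z * n2 = y * (z\<^sup>2 * n1 * n2)" "x * y * n3 = z * (y\<^sup>2 * n1 * n3)"
    by (simp_all add: x_def power2_eq_square mult_ac)
  then have eqs: "x = y * z * n1" "y = - (x * z * n2)" "z = - (x * y * n3)"
    using z(1) y(1) by (simp_all add: x_def)
  define P :: "real^3^3" where "P = vector [vector [x, 0, x], vector [y, 0, - y], vector [0, z, 0]]"
  define d where "d = 2 * x * y * z"
  have det: "det P = d" by (simp add: P_def det_3 d_def)
  show ?thesis
  proof (rule bracket_equivI)
    show "det P \<noteq> 0" using y z n1 by (simp add: det d_def x_def)
    have "d * n1 = 2 * (x * x)" by (simp add: d_def x_def)
    moreover have "d * n2 = - 2 * (y * - (x * z * n2))" "d * n3 = - 2 * (z * - (x * y * n3))" by (simp_all add: d_def)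
    then have "d * n2 = - 2 * (y * y)" "d * n3 = - 2 * (z * z)" by (simp_all only: eqs(2,3)[symmetric])
    ultimately show "P ** mVIII ** transpose P = det P *\<^sub>R bianchi_matrix 0 n1 n2 n3"
      unfolding det by (simp add: P_def equiv_simps)
  qed
qed

text \<open>The form is \<open>- 2 * w1 * w2\<close>, for which the first two rows of
  \<open>P\<close> are orthogonal with squares \<open>2 * x^2\<close> and \<open>- 2\<close>;
  \<open>x\<close> and \<open>z\<close> are adjusted to the determinant
  \<open>2 * x * z\<close>.\<close>

lemma equiv_VI0:
  assumes "n1 * n2 < 0"
  shows "bracket_equiv (mVI (-1)) (bianchi_matrix 0 n1 n2 0)"
proof -
  define z where "z = 1 / sqrt (- (n1 * n2))"
  define x where "x = z * n1"
  have z: "z\<^sup>2 * n1 * n2 = - 1" "z \<noteq> 0" and n1: "n1 \<noteq> 0"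
    using assms by (auto simp: z_def power_divide)
  have xz: "x * z * n2 = - 1" using z(1) by (simp add: x_def power2_eq_square mult_ac)
  define P :: "real^3^3" where "P = vector [vector [x, - x, 0], vector [1, 1, 0], vector [0, 0, z]]"
  define d where "d = 2 * x * z"
  have det: "det P = d" by (simp add: P_def det_3 d_def)
  show ?thesis
  proof (rule bracket_equivI)
    show "det P \<noteq> 0" using z n1 by (simp add: det d_def x_def)
    have "d * n1 = 2 * (x * x)" by (simp add: d_def x_def)
    moreover have "d * n2 = 2 * (x * z * n2)" by (simp add: d_def)
    then have "d * n2 = - 2" unfolding xz by simp
    ultimately show "P ** mVI (-1) ** transpose P = det P *\<^sub>R bianchi_matrix 0 n1 n2 0"
      unfolding det by (simp add: P_def equiv_simps)
  qed
qed

lemma equiv_VII0: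
  assumes "n1 * n2 > 0"
  shows "bracket_equiv (mVII 0) (bianchi_matrix 0 n1 n2 0)"
proof -
  define z where "z = 1 / sqrt (n1 * n2)"
  define x where "x = - z * n1"
  have z: "z\<^sup>2 * n1 * n2 = 1" "z \<noteq> 0" and n1: "n1 \<noteq> 0"
    using assms by (auto simp: z_def power_divide)
  have xz: "x * z * n2 = - 1" using z(1) by (simp add: x_def power2_eq_square mult_ac)
  define P :: "real^3^3" where "P = vector [vector [x, 0, 0], vector [0, 1, 0], vector [0, 0, z]]"
  define d where "d = x * z"
  have det: "det P = d" by (simp add: P_def det_3 d_def)
  show ?thesis
  proof (rule bracket_equivI)
    show "det P \<noteq> 0" using z n1 by (simp add: det d_def x_def)
    have "d * n1 = - (x * x)" by (simp add: d_def x_def)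
    moreover have "d * n2 = - 1" using xz by (simp add: d_def)
    ultimately show "P ** mVII 0 ** transpose P = det P *\<^sub>R bianchi_matrix 0 n1 n2 0"
      unfolding det by (simp add: P_def equiv_simps)
  qed
qed

text \<open>For a \<open>P\<close> of this shape, the symmetric part requires
  \<open>1 - q = 2 * z * w\<close> and the skew part \<open>q + 1 = - 2 * z * a\<close>. Their sum
  \<open>z * (w - a) = 1\<close> determines \<open>z\<close>, and then \<open>q\<close>. The
  excluded value \<open>n2 * n3 = - a^2\<close> means \<open>w = a\<close>, where \<open>z\<close>
  is undefined, or \<open>w = - a\<close>, where \<open>q = 0\<close>.\<close>

lemma equiv_VIh:
  assumes n: "n2 * n3 < 0" and a: "a \<noteq> 0" "n2 * n3 \<noteq> - a\<^sup>2"
  shows "\<exists>q. q \<noteq> -1 \<and> q \<noteq> 1 \<and> q \<noteq> 0 \<and> bracket_equiv (mVI q) (bianchi_matrix a 0 n2 n3)"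
proof -
  define w where "w = sqrt (- (n2 * n3))"
  have w: "w\<^sup>2 = - (n2 * n3)" "w \<noteq> 0" using n by (auto simp: w_def)
  then have "w\<^sup>2 \<noteq> a\<^sup>2" using a by auto
  then have wa: "w - a \<noteq> 0" "w + a \<noteq> 0" by (auto simp: eq_neg_iff_add_eq_0[symmetric])
  define z where "z = 1 / (w - a)"
  have z: "z * (w - a) = 1" "z \<noteq> 0" using wa by (simp_all add: z_def)
  define q where "q = - 1 - 2 * z * a"
  have q1: "1 - q = 2 * (z * w)" using z(1) by (simp add: q_def algebra_simps)
  have q2: "q + 1 = - 2 * (z * a)" by (simp add: q_def)
  define P :: "real^3^3" where "P = vector [vector [0, 0, z], vector [n2, - n2, 0], vector [w, w, 0]]"
  define d where "d = 2 * (n2 * (w * z))"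
  have det: "det P = d" by (simp add: P_def det_3 d_def)
  have "bracket_equiv (mVI q) (bianchi_matrix a 0 n2 n3)"
  proof (rule bracket_equivI)
    show "det P \<noteq> 0" using z w n by (auto simp: det d_def)
    have "d * n3 = 2 * (w * z) * (n2 * n3)" by (simp add: d_def)
    also have "\<dots> = - (1 - q) * (w * w)"
      using w(1) by (simp add: q1 power2_eq_square)
    finally have 3: "d * n3 = q * (w * w) - w * w" by (simp add: algebra_simps)
    have "d * n2 = (1 - q) * (n2 * n2)" by (simp add: q1 d_def)
    then have 2: "d * n2 = n2 * n2 - q * (n2 * n2)" by (simp add: algebra_simps)
    have "d * a = - (q + 1) * (n2 * w)" by (simp add: q2 d_def)
    then have 1: "d * a = - (n2 * w) - q * (n2 * w)" by (simp add: algebra_simps)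
    show "P ** mVI q ** transpose P = det P *\<^sub>R bianchi_matrix a 0 n2 n3"
      unfolding det using 1 2 3 by (simp add: P_def equiv_simps)
  qed
  moreover have "q \<noteq> 1" using q1 z w by auto
  moreover have "q \<noteq> -1" using q2 z a by auto
  moreover have "z * (w + a) \<noteq> 0" using wa z by simp
  then have "q \<noteq> 0" using q1 q2 by (auto simp: algebra_simps)
  ultimately show ?thesis by blast
qed

text \<open>Here \<open>c\<close> is half of \<open>q\<close>, and the entry \<open>c * y\<close> of
  \<open>P\<close> cancels the symmetric off-diagonal term. The skew part forces
  \<open>c = - z * a\<close>, and the last diagonal entry then forces
  \<open>z^2 * (n2 * n3 + a^2) = 1\<close>. Positivity of \<open>n2 * n3\<close> gives
  \<open>q^2 < 4\<close>.\<close>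

lemma equiv_VIIh:
  assumes n: "n2 * n3 > 0" and a: "a \<noteq> 0"
  shows "\<exists>q. q \<noteq> 0 \<and> q\<^sup>2 < 4 \<and> bracket_equiv (mVII q) (bianchi_matrix a 0 n2 n3)"
proof -
  define z where "z = 1 / sqrt (n2 * n3 + a\<^sup>2)"
  have pos: "n2 * n3 + a\<^sup>2 > 0" using n by (simp add: add_pos_nonneg)
  then have z: "z\<^sup>2 * (n2 * n3 + a\<^sup>2) = 1" "z \<noteq> 0" by (auto simp: z_def power_divide)
  have n2: "n2 \<noteq> 0" using n by auto
  define c where "c = - z * a"
  define y where "y = - 1 / (z * n2)"
  have y: "y * z * n2 = - 1" using z n2 by (simp add: y_def)
  have c2: "1 - c\<^sup>2 = z\<^sup>2 * (n2 * n3)" using z(1) by (simp add: c_def power_mult_distrib algebra_simps)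
  define P :: "real^3^3" where "P = vector [vector [0, 0, z], vector [1, 0, 0], vector [c * y, y, 0]]"
  define d where "d = y * z"
  have det: "det P = d" by (simp add: P_def det_3 d_def)
  have "bracket_equiv (mVII (2 * c)) (bianchi_matrix a 0 n2 n3)"
  proof (rule bracket_equivI)
    show "det P \<noteq> 0" using y by (auto simp: det d_def)
    have 2: "d * n2 = - 1" using y by (simp add: d_def)
    have 1: "d * a = - (c * y)" by (simp add: c_def d_def)
    have "y\<^sup>2 * (1 - c\<^sup>2) = (y * z * n2) * (y * z * n3)" unfolding c2 by (simp add: power2_eq_square mult_ac)
    then have 3: "d * n3 = c\<^sup>2 * y\<^sup>2 - y\<^sup>2" unfolding y by (simp add: d_def algebra_simps)
    show "P ** mVII (2 * c) ** transpose P = det P *\<^sub>R bianchi_matrix a 0 n2 n3"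
      unfolding det using 1 2 3 by (simp add: P_def equiv_simps) (simp add: power2_eq_square algebra_simps)
  qed
  moreover have "2 * c \<noteq> 0" using z a by (simp add: c_def)
  moreover have "(2 * c)\<^sup>2 < 4"
  proof -
    have "0 < z\<^sup>2 * (n2 * n3)" using z(2) n by simp
    then show ?thesis using c2 by (simp add: power_mult_distrib)
  qed
  ultimately show ?thesis by blast
qed

text \<open>The symmetric part has rank one; the two choices of \<open>P\<close> differ in which of
  the second and third axes carries its nonzero entry.\<close>

lemma equiv_IV:
  assumes a: "a \<noteq> 0" and n: "n2 * n3 = 0" "n2 \<noteq> 0 \<or> n3 \<noteq> 0"
  shows "bracket_equiv mIV (bianchi_matrix a 0 n2 n3)"
proof (cases "n3 = 0")
  case True
  then have n2: "n2 \<noteq> 0" using n by simp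
  define P :: "real^3^3" where "P = vector [vector [0, 0, - 1 / a], vector [1, 0, 0], vector [0, - a / n2, 0]]"
  show ?thesis
  proof (rule bracket_equivI)
    have det: "det P = 1 / n2" using a by (simp add: P_def det_3)
    show "det P \<noteq> 0" unfolding det using n2 by simp
    show "P ** mIV ** transpose P = det P *\<^sub>R bianchi_matrix a 0 n2 n3"
      unfolding det True using n2 by (simp add: P_def equiv_simps)
  qed
next
  case False
  then have n2: "n2 = 0" using n by simp
  define P :: "real^3^3" where "P = vector [vector [0, 0, - 1 / a], vector [0, a / n3, 0], vector [1, 0, 0]]"
  show ?thesis
  proof (rule bracket_equivI)
    have det: "det P = 1 / n3" using a by (simp add: P_def det_3)
    show "det P \<noteq> 0" unfolding det using False by simp
    show "P ** mIV ** transpose P = det P *\<^sub>R bianchi_matrix a 0 n2 n3"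
      unfolding det n2 using False by (simp add: P_def equiv_simps)
  qed
qed

section \<open>The theorem\<close>

text \<open>In dimension three the Jacobi identity has content only for the indices 1, 2, 3. There
  it puts the vector dual to the skew part into the kernel of the transpose.\<close>

lemma jacobi_matrix:
  assumes "\<And>i j k r. (\<Sum>l\<in>UNIV. structure_const M i j l * structure_const M l k r
      + structure_const M j k l * structure_const M l i r + structure_const M k i l * structure_const M l j r) = 0"
  shows "transpose M *v vector [M$2$3 - M$3$2, M$3$1 - M$1$3, M$1$2 - M$2$1] = 0"
proof -
  have "(transpose M *v vector [M$2$3 - M$3$2, M$3$1 - M$1$3, M$1$2 - M$2$1]) $ r = 0" for r
    using assms[of 1 2 3 r]
    by (simp add: structure_const_def matrix_vector_mult_def transpose_def sum_3 algebra_simps)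
  then show ?thesis by (simp add: vec_eq_iff)
qed

text \<open>Two constant changes of basis: \<open>P1\<close> makes the fields orthonormal and
  positively oriented at \<open>p\<close>, then the rotation \<open>Q\<close> brings the bracket
  matrix to normal form without disturbing this. Because \<open>Q\<close> is orthogonal with
  determinant one, it acts on bracket matrices by conjugation.\<close>

lemma bianchi_frame_at:
  assumes atlas: "oriented_atlas \<A>" and metric: "riemannian_metric \<A> g" and adm: "admits_maximal_transitive_G3 \<A> g"
    and c: "c \<in> \<A>" and p: "p \<in> cdom c"
  obtains U \<xi> a n1 n2 n3 where "open U" "p \<in> U" "maximal_transitive_G3_basis \<A> g U \<xi>"
    "has_brackets \<A> U \<xi> (bianchi_matrix a n1 n2 n3)" "a * n1 = 0" "on_frame (g c p) (frame_matrix \<xi> c p)"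
proof -
  obtain U \<xi> where U: "open U" "p \<in> U" and \<xi>: "maximal_transitive_G3_basis \<A> g U \<xi>"
    using adm unfolding admits_maximal_transitive_G3_def by blast
  have vf: "\<And>i. vector_field \<A> U (\<xi> i)" if "maximal_transitive_G3_basis \<A> g U \<xi>" for \<xi>
    using that unfolding maximal_transitive_G3_basis_def G3_basis_def killing_field_def by blast
  have basis: "G3_basis \<A> g U \<xi>" "transitive_on \<A> U \<xi>" if "maximal_transitive_G3_basis \<A> g U \<xi>" for \<xi>
    using that unfolding maximal_transitive_G3_basis_def by blast+
  have pU: "p \<in> cdom c \<inter> U" using p U by blast
  obtain m where m: "has_brackets \<A> U \<xi> m" using G3_basis_has_brackets[OF basis(1)[OF \<xi>]] by blast
  define X where "X = frame_matrix \<xi> c p"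
  have X: "det X \<noteq> 0" unfolding X_def by (rule frame_matrix_det[OF basis(2)[OF \<xi>] c pU])
  have G: "transpose (g c p) = g c p" "\<And>v. v \<noteq> 0 \<Longrightarrow> v \<bullet> (g c p *v v) > 0"
    using conjunct1[OF conjunct2[OF metric[unfolded riemannian_metric_def]], rule_format, OF c p] by blast+
  obtain P0 where P0: "transpose P0 ** g c p ** P0 = mat 1" "det P0 > 0"
    by (rule exists_ON_frame[OF G])
  define P1 where "P1 = matrix_inv X ** P0"
  have XP1: "X ** P1 = P0" by (simp add: P1_def matrix_mul_assoc matrix_inv_works[OF X])
  then have "det X * det P1 = det P0" by (metis det_mul)
  then have P1: "det P1 \<noteq> 0" using P0 by auto
  define \<xi>1 where "\<xi>1 = change_basis P1 \<xi>"
  have max1: "maximal_transitive_G3_basis \<A> g U \<xi>1"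
    unfolding \<xi>1_def by (rule change_basis_maximal[OF atlas U(1) \<xi> P1])
  obtain M where M: "has_brackets \<A> U \<xi>1 M" using G3_basis_has_brackets[OF basis(1)[OF max1]] by blast
  have "transpose M *v vector [M$2$3 - M$3$2, M$3$1 - M$1$3, M$1$2 - M$2$1] = 0"
    by (rule jacobi_matrix[OF frame_tensors(1)[OF atlas metric U(1) basis[OF max1] M c pU]])
  then obtain Q a n1 n2 n3 where Q: "transpose Q ** Q = mat 1" "det Q = 1"
    and QM: "transpose Q ** M ** Q = bianchi_matrix a n1 n2 n3" and a: "a * n1 = 0"
    using bianchi_normal_form by blast
  have Q': "Q ** transpose Q = mat 1" using Q(1) matrix_left_right_inverse by blast
  have "Q ** bianchi_matrix a n1 n2 n3 ** transpose Q = (Q ** transpose Q) ** M ** (Q ** transpose Q)"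
    unfolding QM[symmetric] by (simp only: matrix_mul_assoc)
  then have rel: "Q ** bianchi_matrix a n1 n2 n3 ** transpose Q = det Q *\<^sub>R M"
    by (simp add: Q Q')
  have Q0: "det Q \<noteq> 0" using Q by simp
  define \<xi>2 where "\<xi>2 = change_basis Q \<xi>1"
  have max2: "maximal_transitive_G3_basis \<A> g U \<xi>2"
    unfolding \<xi>2_def by (rule change_basis_maximal[OF atlas U(1) max1 Q0])
  have br2: "has_brackets \<A> U \<xi>2 (bianchi_matrix a n1 n2 n3)"
    unfolding \<xi>2_def by (rule change_basis_has_brackets[OF atlas U(1) vf[OF max1] M Q0 rel])
  have fr: "frame_matrix \<xi>2 c p = P0 ** Q"
    by (simp add: \<xi>2_def \<xi>1_def frame_matrix_change_basis X_def[symmetric] XP1)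
  have "transpose (P0 ** Q) ** g c p ** (P0 ** Q) = transpose Q ** (transpose P0 ** g c p ** P0) ** Q"
    by (simp only: matrix_transpose_mul matrix_mul_assoc)
  then have "on_frame (g c p) (frame_matrix \<xi>2 c p)"
    unfolding on_frame_def fr using P0 Q by (simp add: det_mul)
  from that[OF U max2 br2 a this] show ?thesis .
qed

lemma invariants_at:
  assumes atlas: "oriented_atlas \<A>" and metric: "riemannian_metric \<A> g" and gen: "algebraically_general \<A> g (ricci g)"
    and c: "c \<in> \<A>" and p: "p \<in> cdom c" and U: "open U" "p \<in> U"
    and \<xi>: "maximal_transitive_G3_basis \<A> g U \<xi>" "has_brackets \<A> U \<xi> (bianchi_matrix a n1 n2 n3)"
    and a: "a * n1 = 0" and frame: "on_frame (g c p) (frame_matrix \<xi> c p)"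
  shows "inv_e g c p \<noteq> 0" "nu1 g c p = n1 + n2 + n3" "nu2 g c p = n1 * n2 + n1 * n3 + n2 * n3"
    "nu3 g c p = n1 * n2 * n3" "a_form g c p = 0 \<longleftrightarrow> a = 0"
    "\<not> (n1 = 0 \<and> n2 * n3 = - a\<^sup>2)" "\<not> (n1 = 0 \<and> n2 = 0 \<and> n3 = 0)"
    "a = 0 \<longrightarrow> \<not> (n1 = 0 \<and> n2 = 0)" "a = 0 \<longrightarrow> \<not> (n1 = 0 \<and> n3 = 0)" "a = 0 \<longrightarrow> \<not> (n2 = 0 \<and> n3 = 0)"
proof -
  let ?X = "frame_matrix \<xi> c p"
  let ?M = "bianchi_matrix a n1 n2 n3"
  interpret on_frame "g c p" ?X by (rule frame)
  have basis: "G3_basis \<A> g U \<xi>" "transitive_on \<A> U \<xi>"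
    using \<xi>(1) unfolding maximal_transitive_G3_basis_def by blast+
  have pU: "p \<in> cdom c \<inter> U" using p U by blast
  note tensors = frame_tensors(2,3)[OF atlas metric U(1) basis \<xi>(2) c pU ON, folded F_def]
  show e: "inv_e g c p \<noteq> 0"
    by (rule e_nonzero[where g = g and c = c and p = p, OF refl gen[unfolded algebraically_general_def, rule_format, OF c p]])
  have sym: "transpose (F (ricci g c p)) = F (ricci g c p)"
    unfolding tensors(1) frame_ricci_bianchi[OF a] by (simp add: vec_eq_iff forall_3 transpose_def)
  note N = N_frame[where g = g and c = c and p = p, OF refl e sym tensors(2)]
  have "F (N_tensor g c p) = vector [vector [n1, 0, 0], vector [0, n2, 0], vector [0, 0, n3]]"
    unfolding N(1) by (simp add: vec_eq_iff forall_3 transpose_def bianchi_matrix_def)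
  note nu_frame[where g = g and c = c and p = p, OF refl this]
  then show "nu1 g c p = n1 + n2 + n3" "nu2 g c p = n1 * n2 + n1 * n3 + n2 * n3" "nu3 g c p = n1 * n2 * n3"
    by simp_all
  have "transpose ?X *v a_form g c p = vector [- a, 0, 0]"
    unfolding vec_eq_iff N(2) by (simp add: forall_3 sum_3 bianchi_matrix_def)
  moreover have "(vector [- a, 0, 0] :: real^3) = 0 \<longleftrightarrow> a = 0"
    by (simp add: vec_eq_iff forall_3)
  ultimately show "a_form g c p = 0 \<longleftrightarrow> a = 0"
    using F_eq_0[of "a_form g c p"] by metis
  note deg = bianchi_degenerate[where g = g and c = c and p = p, OF refl e tensors(1) a]
  show "\<not> (n1 = 0 \<and> n2 * n3 = - a\<^sup>2)" by (rule deg(1))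
  show "\<not> (n1 = 0 \<and> n2 = 0 \<and> n3 = 0)" by (rule deg(2))
  show "a = 0 \<longrightarrow> \<not> (n1 = 0 \<and> n2 = 0)" using deg(3) by (rule impI)
  show "a = 0 \<longrightarrow> \<not> (n1 = 0 \<and> n3 = 0)" using deg(4) by (rule impI)
  show "a = 0 \<longrightarrow> \<not> (n2 = 0 \<and> n3 = 0)" using deg(5) by (rule impI)
qed

text \<open>A condition on all points is decided at one: \<open>germ_relation\<close> gives one
  direction, and \<open>brackets_spread\<close> carries a basis with the wanted brackets from
  \<open>p\<close> to every point.\<close>

lemma group_brackets_iff:
  fixes \<A> :: "'a::topological_space chart set"
  assumes conn: "connected (UNIV :: 'a set)" and atlas: "oriented_atlas \<A>" and adm: "admits_maximal_transitive_G3 \<A> g"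
    and U: "open U" "p \<in> U" "maximal_transitive_G3_basis \<A> g U \<xi>" "has_brackets \<A> U \<xi> m"
  shows "group_brackets \<A> g u v w \<longleftrightarrow> bracket_equiv (brackets_matrix u v w) m"
proof -
  have gb: "group_brackets \<A> g u v w \<longleftrightarrow>
      (\<forall>q. \<exists>U \<xi>. open U \<and> q \<in> U \<and> maximal_transitive_G3_basis \<A> g U \<xi> \<and> has_brackets \<A> U \<xi> (brackets_matrix u v w))"
    by (simp add: group_brackets_def has_brackets_def brackets_matrix_def)
  show ?thesis
  proof
    assume "group_brackets \<A> g u v w"
    then obtain U' \<xi>' where U': "open U'" "p \<in> U'" "maximal_transitive_G3_basis \<A> g U' \<xi>'"
      "has_brackets \<A> U' \<xi>' (brackets_matrix u v w)"
      unfolding gb by blast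
    obtain P where "det P \<noteq> 0" "P ** brackets_matrix u v w ** transpose P = det P *\<^sub>R m"
      by (rule germ_relation[OF atlas U(1,3,4) U'(1,3,4) U(2) U'(2)])
    then show "bracket_equiv (brackets_matrix u v w) m" unfolding bracket_equiv_def by blast
  next
    assume "bracket_equiv (brackets_matrix u v w) m"
    then obtain P where P: "det P \<noteq> 0" "P ** brackets_matrix u v w ** transpose P = det P *\<^sub>R m"
      unfolding bracket_equiv_def by blast
    have vf: "\<And>i. vector_field \<A> U (\<xi> i)"
      using U(3) unfolding maximal_transitive_G3_basis_def G3_basis_def killing_field_def by blast
    show "group_brackets \<A> g u v w" unfolding gb
      using brackets_spread[OF conn atlas adm U(1,2) change_basis_maximal[OF atlas U(1,3) P(1)]
          change_basis_has_brackets[OF atlas U(1) vf U(4) P]] by blast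
  qed
qed

text \<open>From left to right the invariants are read off the representative of the type; the
  converses use the explicit equivalences. Since \<open>a * n1 = 0\<close>, either
  \<open>a = 0\<close>, where the axes may be permuted, or \<open>n1 = 0\<close>, where the second
  invariant is \<open>n2 * n3\<close>.\<close>

lemma bracket_equiv_classification:
  fixes a n1 n2 n3 :: real
  defines "B \<equiv> bianchi_matrix a n1 n2 n3"
    and "e1 \<equiv> n1 + n2 + n3" and "e2 \<equiv> n1 * n2 + n1 * n3 + n2 * n3" and "e3 \<equiv> n1 * n2 * n3"
  assumes an: "a * n1 = 0"
    and deg: "\<not> (n1 = 0 \<and> n2 * n3 = - a\<^sup>2)" "\<not> (n1 = 0 \<and> n2 = 0 \<and> n3 = 0)"
    "a = 0 \<longrightarrow> \<not> (n1 = 0 \<and> n2 = 0)" "a = 0 \<longrightarrow> \<not> (n1 = 0 \<and> n3 = 0)" "a = 0 \<longrightarrow> \<not> (n2 = 0 \<and> n3 = 0)"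
  shows IV: "bracket_equiv mIV B \<longleftrightarrow> e1 \<noteq> 0 \<and> e2 = 0 \<and> e3 = 0"
    and VI0: "bracket_equiv (mVI (-1)) B \<longleftrightarrow> e2 < 0 \<and> e3 = 0 \<and> a = 0"
    and VIh: "(\<exists>q. q \<noteq> -1 \<and> q \<noteq> 1 \<and> q \<noteq> 0 \<and> bracket_equiv (mVI q) B) \<longleftrightarrow> e2 < 0 \<and> e3 = 0 \<and> a \<noteq> 0"
    and VII0: "bracket_equiv (mVII 0) B \<longleftrightarrow> e2 > 0 \<and> e3 = 0 \<and> a = 0"
    and VIIh: "(\<exists>q. q \<noteq> 0 \<and> q\<^sup>2 < 4 \<and> bracket_equiv (mVII q) B) \<longleftrightarrow> e2 > 0 \<and> e3 = 0 \<and> a \<noteq> 0"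
    and IX: "bracket_equiv mIX B \<longleftrightarrow> e2 > 0 \<and> e1 * e3 > 0"
    and VIII: "bracket_equiv mVIII B \<longleftrightarrow> e3 \<noteq> 0 \<and> (e2 \<le> 0 \<or> e1 * e3 \<le> 0)"
proof -
  have VI_D: "e3 = 0" "e2 < 0" "a = 0 \<longleftrightarrow> q = -1" if "bracket_equiv (mVI q) B" "q \<noteq> 1" for q
  proof -
    have eq: "bracket_equiv (vector [vector [0, q, 0], vector [-1, 0, 0], vector [0, 0, 0]]) (bianchi_matrix a n1 n2 n3)"
      using that by (simp add: m_defs B_def)
    \<comment> \<open>The second factor is \<Delta> for this matrix, with the entries left in place;
      it equals \<open>- ((q - 1) / 2)^2\<close>.\<close>
    obtain k where "k > 0" "e2 = k * (0 * 0 - ((q + - 1) / 2)\<^sup>2)"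
      using planar_invariants(2)[OF eq an] unfolding e2_def by blast
    moreover have "((q + - 1) / 2)\<^sup>2 > 0" using that(2) by simp
    ultimately show "e2 < 0" by (simp add: mult_pos_neg)
    show "e3 = 0" using planar_invariants(1)[OF eq an] unfolding e3_def .
    show "a = 0 \<longleftrightarrow> q = -1" by (rule planar_invariants(3)[OF eq an])
  qed
  have VII_D: "e3 = 0" "e2 > 0" "a = 0 \<longleftrightarrow> q = 0" if "bracket_equiv (mVII q) B" "q\<^sup>2 < 4" for q
  proof -
    have eq: "bracket_equiv (vector [vector [-1, q, 0], vector [0, -1, 0], vector [0, 0, 0]]) (bianchi_matrix a n1 n2 n3)"
      using that by (simp add: m_defs B_def)
    obtain k where "k > 0" "e2 = k * (-1 * -1 - ((q + 0) / 2)\<^sup>2)"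
      using planar_invariants(2)[OF eq an] unfolding e2_def by blast
    moreover have "(-1 * -1 - ((q + 0) / 2)\<^sup>2) > 0" using that(2) by (simp add: power_divide)
    ultimately show "e2 > 0" by (metis mult_pos_pos)
    show "e3 = 0" using planar_invariants(1)[OF eq an] unfolding e3_def .
    show "a = 0 \<longleftrightarrow> q = 0" by (rule planar_invariants(3)[OF eq an])
  qed
  have IV_D: "e3 = 0" "e2 = 0" "e1 \<noteq> 0" if "bracket_equiv mIV B"
  proof -
    have eq: "bracket_equiv (vector [vector [1, 1, 0], vector [-1, 0, 0], vector [0, 0, 0]]) (bianchi_matrix a n1 n2 n3)"
      using that by (simp add: m_defs B_def)
    obtain k where "k > 0" "e2 = k * (1 * 0 - ((1 + - 1) / 2)\<^sup>2)"
      using planar_invariants(2)[OF eq an] unfolding e2_def by blast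
    then show "e2 = 0" by simp
    show "e3 = 0" using planar_invariants(1)[OF eq an] unfolding e3_def .
    show "e1 \<noteq> 0" using planar_invariants(4)[OF eq an] unfolding e1_def by simp
  qed
  have a0: "B = bianchi_matrix 0 n1 n2 n3" if "a = 0" using that by (simp add: B_def)
  have n0: "B = bianchi_matrix a 0 n2 n3" "n1 = 0" "e2 = n2 * n3" if "a \<noteq> 0"
    using that an by (simp_all add: B_def e2_def)
  show "bracket_equiv mIV B \<longleftrightarrow> e1 \<noteq> 0 \<and> e2 = 0 \<and> e3 = 0"
  proof
    assume *: "e1 \<noteq> 0 \<and> e2 = 0 \<and> e3 = 0"
    \<comment> \<open>For \<open>a = 0\<close> the vanishing of both symmetric polynomials would
      leave two zeros among \<open>n1\<close>, \<open>n2\<close>, \<open>n3\<close>, a degenerate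
      algebra.\<close>
    then have "a \<noteq> 0" using deg(3-5) by (auto simp: e1_def e2_def e3_def)
    from n0[OF this] * deg(2) show "bracket_equiv mIV B"
      using equiv_IV[OF \<open>a \<noteq> 0\<close>, of n2 n3] by simp
  qed (use IV_D in blast)
  show "bracket_equiv (mVI (-1)) B \<longleftrightarrow> e2 < 0 \<and> e3 = 0 \<and> a = 0"
  proof
    assume *: "e2 < 0 \<and> e3 = 0 \<and> a = 0"
    then consider "n3 = 0" "n1 * n2 < 0" | "n1 = 0" "n2 * n3 < 0" | "n2 = 0" "n3 * n1 < 0"
      by (auto simp: e2_def e3_def mult.commute)
    then show "bracket_equiv (mVI (-1)) B"
      using a0 * equiv_VI0[of n1 n2] bracket_equiv_cycle[OF equiv_VI0[of n2 n3]]
        bracket_equiv_cycle[OF bracket_equiv_cycle[OF equiv_VI0[of n3 n1]]]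
      by cases simp_all
  qed (use VI_D[of "-1"] in simp)
  show "bracket_equiv (mVII 0) B \<longleftrightarrow> e2 > 0 \<and> e3 = 0 \<and> a = 0"
  proof
    assume *: "e2 > 0 \<and> e3 = 0 \<and> a = 0"
    then consider "n3 = 0" "n1 * n2 > 0" | "n1 = 0" "n2 * n3 > 0" | "n2 = 0" "n3 * n1 > 0"
      by (auto simp: e2_def e3_def mult.commute)
    then show "bracket_equiv (mVII 0) B"
      using a0 * equiv_VII0[of n1 n2] bracket_equiv_cycle[OF equiv_VII0[of n2 n3]]
        bracket_equiv_cycle[OF bracket_equiv_cycle[OF equiv_VII0[of n3 n1]]]
      by cases simp_all
  qed (use VII_D[of 0] in simp)
  show "(\<exists>q. q \<noteq> -1 \<and> q \<noteq> 1 \<and> q \<noteq> 0 \<and> bracket_equiv (mVI q) B) \<longleftrightarrow> e2 < 0 \<and> e3 = 0 \<and> a \<noteq> 0"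
  proof
    assume *: "e2 < 0 \<and> e3 = 0 \<and> a \<noteq> 0"
    then have "n2 * n3 < 0" "n2 * n3 \<noteq> - a\<^sup>2" using n0 deg(1) by auto
    then show "\<exists>q. q \<noteq> -1 \<and> q \<noteq> 1 \<and> q \<noteq> 0 \<and> bracket_equiv (mVI q) B"
      using equiv_VIh[of n2 n3 a] n0(1) * by simp
  qed (use VI_D in blast)
  show "(\<exists>q. q \<noteq> 0 \<and> q\<^sup>2 < 4 \<and> bracket_equiv (mVII q) B) \<longleftrightarrow> e2 > 0 \<and> e3 = 0 \<and> a \<noteq> 0"
  proof
    assume *: "e2 > 0 \<and> e3 = 0 \<and> a \<noteq> 0"
    then have "n2 * n3 > 0" using n0 by auto
    then show "\<exists>q. q \<noteq> 0 \<and> q\<^sup>2 < 4 \<and> bracket_equiv (mVII q) B"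
      using equiv_VIIh[of n2 n3 a] n0(1) * by simp
  qed (use VII_D in blast)
  show "bracket_equiv mIX B \<longleftrightarrow> e2 > 0 \<and> e1 * e3 > 0"
  proof
    assume *: "e2 > 0 \<and> e1 * e3 > 0"
    then have "n1 * n2 > 0" "n1 * n3 > 0" using same_sign unfolding e1_def e2_def e3_def by blast+
    moreover then have "a = 0" using an by auto
    ultimately show "bracket_equiv mIX B" using equiv_IX a0 by simp
  qed (use equiv_IX_D in \<open>auto simp: e1_def e2_def e3_def B_def\<close>)
  show "bracket_equiv mVIII B \<longleftrightarrow> e3 \<noteq> 0 \<and> (e2 \<le> 0 \<or> e1 * e3 \<le> 0)"
  proof
    assume "bracket_equiv mVIII B"
    from equiv_VIII_D[OF this[unfolded B_def] an]
    show "e3 \<noteq> 0 \<and> (e2 \<le> 0 \<or> e1 * e3 \<le> 0)" unfolding e1_def e2_def e3_def by linarith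
  next
    assume *: "e3 \<noteq> 0 \<and> (e2 \<le> 0 \<or> e1 * e3 \<le> 0)"
    then have nz: "n1 \<noteq> 0" "n2 \<noteq> 0" "n3 \<noteq> 0" by (auto simp: e3_def)
    then have a: "a = 0" using an by simp
    have "\<not> (n1 > 0 \<and> n2 > 0 \<and> n3 > 0)"
    proof
      assume n: "n1 > 0 \<and> n2 > 0 \<and> n3 > 0"
      then have "e2 > 0" "e1 > 0" "e3 > 0"
        unfolding e1_def e2_def e3_def by (auto intro!: add_pos_pos mult_pos_pos)
      then show False using * mult_pos_pos[of e1 e3] by linarith
    qed
    moreover have "\<not> (n1 < 0 \<and> n2 < 0 \<and> n3 < 0)"
    proof
      assume n: "n1 < 0 \<and> n2 < 0 \<and> n3 < 0"
      then have "e2 > 0" "e1 < 0" "e3 < 0"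
        unfolding e1_def e2_def e3_def by (auto intro!: add_pos_pos mult_neg_neg mult_pos_neg)
      then show False using * mult_neg_neg[of e1 e3] by linarith
    qed
    \<comment> \<open>No zeros and mixed signs: exactly one of the three numbers differs in sign
      from the other two, and a cyclic permutation moves it to the first place.\<close>
    ultimately consider "n1 * n2 < 0" "n1 * n3 < 0" | "n2 * n3 < 0" "n2 * n1 < 0" | "n3 * n1 < 0" "n3 * n2 < 0"
      using nz by (cases "n1 > 0"; cases "n2 > 0"; cases "n3 > 0") (auto simp: mult_less_0_iff)
    then show "bracket_equiv mVIII B"
      using a0[OF a] equiv_VIII[of n1 n2 n3] bracket_equiv_cycle[OF equiv_VIII[of n2 n3 n1]]
        bracket_equiv_cycle[OF bracket_equiv_cycle[OF equiv_VIII[of n3 n1 n2]]]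
      by cases simp_all
  qed
qed

theorem theorem7:
  fixes \<A> :: "'a::{t2_space, second_countable_topology} chart set"
    and g :: "'a tensor2"
  assumes "connected (UNIV :: 'a set)"
    and "oriented_atlas \<A>"
    and "riemannian_metric \<A> g"
    and "algebraically_general \<A> g (ricci g)"
    and "admits_maximal_transitive_G3 \<A> g"
  shows "\<forall>c\<in>\<A>. \<forall>p\<in>cdom c.
    inv_e g c p \<noteq> 0 \<and>
    (type_IV \<A> g \<longleftrightarrow> nu1 g c p \<noteq> 0 \<and> nu2 g c p = 0 \<and> nu3 g c p = 0) \<and>
    (type_VI0 \<A> g \<longleftrightarrow> nu2 g c p < 0 \<and> nu3 g c p = 0 \<and> a_form g c p = 0) \<and>
    ((\<exists>h. h \<noteq> -1 \<and> type_VIh \<A> g h) \<longleftrightarrow>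
       nu2 g c p < 0 \<and> nu3 g c p = 0 \<and> a_form g c p \<noteq> 0) \<and>
    (type_VII0 \<A> g \<longleftrightarrow> nu2 g c p > 0 \<and> nu3 g c p = 0 \<and> a_form g c p = 0) \<and>
    ((\<exists>h. type_VIIh \<A> g h) \<longleftrightarrow>
       nu2 g c p > 0 \<and> nu3 g c p = 0 \<and> a_form g c p \<noteq> 0) \<and>
    (type_IX \<A> g \<longleftrightarrow> nu2 g c p > 0 \<and> nu1 g c p * nu3 g c p > 0) \<and>
    (type_VIII \<A> g \<longleftrightarrow> nu3 g c p \<noteq> 0 \<and> (nu2 g c p \<le> 0 \<or> nu1 g c p * nu3 g c p \<le> 0))"
proof (intro ballI)
  fix c p assume c: "c \<in> \<A>" and p: "p \<in> cdom c"
  obtain U \<xi> a n1 n2 n3 where U: "open U" "p \<in> U" "maximal_transitive_G3_basis \<A> g U \<xi>"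
    "has_brackets \<A> U \<xi> (bianchi_matrix a n1 n2 n3)" and an: "a * n1 = 0"
    and frame: "on_frame (g c p) (frame_matrix \<xi> c p)"
    by (rule bianchi_frame_at[OF assms(2,3,5) c p])
  note inv = invariants_at[OF assms(2-4) c p U an frame]
  note cls = bracket_equiv_classification[OF an inv(6-10), folded inv(2-4)]
  note gb = group_brackets_iff[OF assms(1,2,5) U]
  define H where "H q = (q + 1)\<^sup>2 / (q - 1)\<^sup>2" for q :: real
  \<comment> \<open>The condition \<open>h \<noteq> -1\<close> leaves out type III, that is
    \<open>q = 0\<close>: the two squares in \<open>H q\<close> differ by
    \<open>4 * q\<close>.\<close>
  have H: "- H q = -1 \<longleftrightarrow> q = 0" if "q \<noteq> 1" for q
  proof -
    have "H q = 1 \<longleftrightarrow> (q + 1)\<^sup>2 = (q - 1)\<^sup>2"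
      using that by (simp add: H_def divide_eq_eq)
    also have "(q + 1)\<^sup>2 = (q - 1)\<^sup>2 + 4 * q" by (simp add: power2_eq_square algebra_simps)
    finally show ?thesis by simp
  qed
  have T4: "type_IV \<A> g \<longleftrightarrow> bracket_equiv mIV (bianchi_matrix a n1 n2 n3)"
    by (simp add: type_IV_def gb mIV_def)
  have VI: "type_VI \<A> g q \<longleftrightarrow> q \<noteq> 1 \<and> bracket_equiv (mVI q) (bianchi_matrix a n1 n2 n3)" for q
    by (simp add: type_VI_def gb mVI_def)
  have T60: "type_VI0 \<A> g \<longleftrightarrow> bracket_equiv (mVI (-1)) (bianchi_matrix a n1 n2 n3)"
    by (simp add: type_VI0_def VI)
  have T6h: "(\<exists>h. h \<noteq> -1 \<and> type_VIh \<A> g h) \<longleftrightarrow>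
      (\<exists>q. q \<noteq> -1 \<and> q \<noteq> 1 \<and> q \<noteq> 0 \<and> bracket_equiv (mVI q) (bianchi_matrix a n1 n2 n3))"
  proof
    assume "\<exists>h. h \<noteq> -1 \<and> type_VIh \<A> g h"
    then obtain q where q: "q \<noteq> -1" "- H q \<noteq> -1" "type_VI \<A> g q"
      unfolding type_VIh_def H_def by blast
    note R = conjunct1[OF iffD1[OF VI q(3)]] conjunct2[OF iffD1[OF VI q(3)]]
    have "q \<noteq> 0" using q(2) iffD2[OF H[OF R(1)]] by (rule contrapos_nn)
    with R q(1)
    show "\<exists>q. q \<noteq> -1 \<and> q \<noteq> 1 \<and> q \<noteq> 0 \<and> bracket_equiv (mVI q) (bianchi_matrix a n1 n2 n3)"
      by blast
  next
    assume "\<exists>q. q \<noteq> -1 \<and> q \<noteq> 1 \<and> q \<noteq> 0 \<and> bracket_equiv (mVI q) (bianchi_matrix a n1 n2 n3)"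
    then obtain q where q: "q \<noteq> -1" "q \<noteq> 1" "q \<noteq> 0" "type_VI \<A> g q" unfolding VI by blast
    have "type_VIh \<A> g (- H q)" unfolding type_VIh_def H_def using q(1,4) by blast
    moreover have "- H q \<noteq> -1" using q(3) iffD1[OF H[OF q(2)]] by (rule contrapos_nn)
    ultimately show "\<exists>h. h \<noteq> -1 \<and> type_VIh \<A> g h" by blast
  qed
  have VII: "type_VII \<A> g q \<longleftrightarrow> q\<^sup>2 < 4 \<and> bracket_equiv (mVII q) (bianchi_matrix a n1 n2 n3)" for q
    by (simp add: type_VII_def gb mVII_def)
  have T70: "type_VII0 \<A> g \<longleftrightarrow> bracket_equiv (mVII 0) (bianchi_matrix a n1 n2 n3)"
    by (simp add: type_VII0_def VII)
  have T7h: "(\<exists>h. type_VIIh \<A> g h) \<longleftrightarrow>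
      (\<exists>q. q \<noteq> 0 \<and> q\<^sup>2 < 4 \<and> bracket_equiv (mVII q) (bianchi_matrix a n1 n2 n3))"
  proof
    assume "\<exists>h. type_VIIh \<A> g h"
    then show "\<exists>q. q \<noteq> 0 \<and> q\<^sup>2 < 4 \<and> bracket_equiv (mVII q) (bianchi_matrix a n1 n2 n3)"
      unfolding type_VIIh_def VII by blast
  next
    assume "\<exists>q. q \<noteq> 0 \<and> q\<^sup>2 < 4 \<and> bracket_equiv (mVII q) (bianchi_matrix a n1 n2 n3)"
    then obtain q where "q \<noteq> 0" "type_VII \<A> g q" unfolding VII by blast
    then have "type_VIIh \<A> g (q\<^sup>2 / (4 - q\<^sup>2))" unfolding type_VIIh_def by blast
    then show "\<exists>h. type_VIIh \<A> g h" ..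
  qed
  have T9: "type_IX \<A> g \<longleftrightarrow> bracket_equiv mIX (bianchi_matrix a n1 n2 n3)"
    by (simp add: type_IX_def gb mIX_def)
  have T8: "type_VIII \<A> g \<longleftrightarrow> bracket_equiv mVIII (bianchi_matrix a n1 n2 n3)"
    by (simp add: type_VIII_def gb mVIII_def)
  show "inv_e g c p \<noteq> 0 \<and>
    (type_IV \<A> g \<longleftrightarrow> nu1 g c p \<noteq> 0 \<and> nu2 g c p = 0 \<and> nu3 g c p = 0) \<and>
    (type_VI0 \<A> g \<longleftrightarrow> nu2 g c p < 0 \<and> nu3 g c p = 0 \<and> a_form g c p = 0) \<and>
    ((\<exists>h. h \<noteq> -1 \<and> type_VIh \<A> g h) \<longleftrightarrow>
       nu2 g c p < 0 \<and> nu3 g c p = 0 \<and> a_form g c p \<noteq> 0) \<and>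
    (type_VII0 \<A> g \<longleftrightarrow> nu2 g c p > 0 \<and> nu3 g c p = 0 \<and> a_form g c p = 0) \<and>
    ((\<exists>h. type_VIIh \<A> g h) \<longleftrightarrow>
       nu2 g c p > 0 \<and> nu3 g c p = 0 \<and> a_form g c p \<noteq> 0) \<and>
    (type_IX \<A> g \<longleftrightarrow> nu2 g c p > 0 \<and> nu1 g c p * nu3 g c p > 0) \<and>
    (type_VIII \<A> g \<longleftrightarrow> nu3 g c p \<noteq> 0 \<and> (nu2 g c p \<le> 0 \<or> nu1 g c p * nu3 g c p \<le> 0))"
    unfolding T4 T60 T6h T70 T7h T8 T9 inv(5) cls by (intro conjI refl inv(1))
qed

end
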